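(* Fix a field $\Bbbk$. Let $L\in\mathcal L(n)$ be a finite atomic lattice and suppose that $P\in\mathcal L(n)$ satisfies $P>L$ in $\mathcal L(n)$, that $P$ is rigid, and that $P$ has the same (total) Betti numbers as $L$. Then for every finite atomic lattice $L'$ with $B(L)\cong B(L')$ as posets, the minimal free resolution of any monomial ideal with lcm-lattice $L'$ is supported on $B(P)$. In other words, $P$ is a rigid deformation of $L'$: any monomial ideal with lcm-lattice $P$ is a rigid deformation of any monomial ideal with lcm-lattice $L'$.
   Context: Lattices. $\mathcal L(n)$ is the set of finite atomic lattices with $n$ ordered atoms, partially ordered by: $P\ge Q$ if there is a join-preserving map $P\to Q$ which is a bijection on atoms (respecting the ordering of atoms). The lcm-lattice of a monomial ideal is the set of least common multiples of subsets of its minimal generators, ordered by divisibility, with minimum $\hat 0=1$; every finite atomic lattice is isomorphic to the lcm-lattice of some monomial ideal, and homological terms for a lattice refer to monomial ideals over $\Bbbk$ having it as lcm-lattice. Betti poset. For a finite poset $Q$ with minimum $\hat0$ and $p\in Q$, $\Delta_p=\Delta_p^Q$ is the order complex of the open interval $(\hat 0,p)$ and $h_i(\Delta_p)=\dim_\Bbbk\widetilde H_i(\Delta_p,\Bbbk)$; the order complex of an empty poset is $\{\varnothing\}$, with $\widetilde H_{-1}=\Bbbk$. $B(Q)=\{p\in Q:h_i(\Delta_p)\ne0\text{ for some }i\}$. The total Betti numbers of a finite atomic lattice $L$ are $\beta_0=1$ and $\beta_i(L)=\sum_{p\in L\setminus\{\hat0\}}h_{i-2}(\Delta_p)$ for $i\geq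 1$, which are the Betti numbers of $R/I$ for any monomial ideal $I$ with lcm-lattice $L$. Rigidity. A finite atomic lattice $L$ (or a monomial ideal with lcm-lattice $L$) is rigid if: (R1) for every $p\in L$, $h_i(\Delta_p)$ is nonzero for at most one $i$, and for that $i$ it equals $1$; (R2) if $p\ne q\in L$ satisfy $h_i(\Delta_p)=h_i(\Delta_q)=1$ for some common $i$, then $p,q$ are incomparable. The sequence $\mathcal D(Q)$. For a finite poset $Q$ with minimum $\hat 0$ put $\mathcal D_0=\widetilde H_{-1}(\{\varnothing\},\Bbbk)\cong\Bbbk$ and, for $\ell\ge1$, $\mathcal D_\ell=\bigoplus_{p\in Q\setminus\{\hat0\}}\mathcal D_{\ell,p}$ with $\mathcal D_{\ell,p}=\widetilde H_{\ell-2}(\Delta_p,\Bbbk)$. Write $p\lessdot q$ if $q$ covers $p$, let $\Delta_{\lceil p\rceil}$ be the order complex of $(\hat0,p]$, so $\Delta_q=\bigcup_{p\lessdot q}\Delta_{\lceil p\rceil}$, and set $\Delta_{q,p}=\Delta_{\lceil p\rceil}\cap\bigcup_{b\lessdot q,\,b\ne p}\Delta_{\lceil b\rceil}\subset\Delta_p$. For $i\ge2$, $\varphi_i:\mathcal D_i\to\mathcal D_{i-1}$ is given on $\mathcal D_{i,q}$ by $\sum_{p\lessdot q}\varphi_i^{q,p}$, where $\varphi_i^{q,p}:\mathcal D_{i,q}\to\mathcal D_{i-1,p}$ is the composition of the Mayer–Vietoris connecting map $\widetilde H_{i-2}(\Delta_q,\Bbbk)\to\widetilde H_{i-3}(\Delta_{q,p},\Bbbk)$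 for $\Delta_q=\Delta_{\lceil p\rceil}\cup\bigcup_{b\lessdot q,\,b\neq p}\Delta_{\lceil b\rceil}$ (a cycle $z=z'+z''$ with $z'$ supported on $\Delta_{\lceil p\rceil}$ and $z''$ on the other subcomplex is sent to the class of the boundary of $z'$) with the map $\widetilde H_{i-3}(\Delta_{q,p},\Bbbk)\to\widetilde H_{i-3}(\Delta_p,\Bbbk)$ induced by inclusion. $\varphi_1:\mathcal D_1\to\mathcal D_0$ is the identity of $\widetilde H_{-1}(\{\varnothing\},\Bbbk)$ on each summand $\mathcal D_{1,a}$, $a$ an atom. "Supported on". Let $N$ be a monomial ideal in a polynomial ring $S$ over $\Bbbk$. The minimal free resolution of $N$ is supported on a finite poset $Q$ with minimum $\hat 0$ if there is an order-preserving map $\eta$ from $Q$ to the monomials of $S$ (ordered by divisibility), with $\eta(\hat0)=1$, such that the sequence with $F_0=S$, $F_i=\bigoplus_{q\in Q\setminus\{\hat0\}}S(-\deg\eta(q))\otimes_\Bbbk\mathcal D_{i,q}$ for $i\ge1$, and differential with components $\frac{\eta(q)}{\eta(p)}\otimes\varphi_i^{q,p}$ for $p\lessdot q$, is a minimal free resolution of $S/N$. Rigid deformation. A monomial ideal $J$ is a rigid deformation of a monomial ideal $I$ if $J$ is rigid and the minimal free resolution of $J$ can be relabeled to minimally resolve $I$. Relabeling means: for some order-preserving map $g$ from $B(L_J)$ ($L_J$ the lcm-lattice of $J$) to the monomials of the ring of $I$, replace each homogeneous basis element of multidegree (monomial) $m$ by one of multidegree $g(m)$, and each matrix entry $c\cdot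 m/m'$ ($c\in\Bbbk$) of the differential by $c\cdot g(m)/g(m')$. *)

theory Defs
  imports
    "HOL-Library.Poly_Mapping"
    "HOL-Library.Function_Algebras"
    "HOL-Library.Lub_Glb"
begin

text \<open>
  A finite poset is a finite set \<open>Q :: 'a set\<close> over a type of class \<open>order\<close>, with the induced
  order. Sums, differences and zero of functions (chains, exponent vectors, elements of free
  modules) are the pointwise ones of \<open>Function_Algebras\<close>.
\<close>

subsection \<open>Posets and finite atomic lattices\<close>

definition pbot :: "'a::order set \<Rightarrow> 'a" where
  "pbot Q = (LEAST x. x \<in> Q)"

definition covers :: "'a::order set \<Rightarrow> 'a \<Rightarrow> 'a \<Rightarrow> bool" where
  "covers Q q p \<longleftrightarrow> p \<in> Q \<and> q \<in> Q \<and> p < q \<and> \<not> (\<exists>x\<in>Q. p < x \<and> x < q)"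

definition atoms :: "'a::order set \<Rightarrow> 'a set" where
  "atoms Q = {a. covers Q a (pbot Q)}"

definition finite_lattice :: "'a::order set \<Rightarrow> bool" where
  "finite_lattice L \<longleftrightarrow> finite L \<and> L \<noteq> {} \<and>
     (\<forall>x\<in>L. \<forall>y\<in>L. (\<exists>j. isLub L {x, y} j) \<and> (\<exists>m. isGlb L {x, y} m))"

definition finite_atomic_lattice :: "'a::order set \<Rightarrow> bool" where
  "finite_atomic_lattice L \<longleftrightarrow> finite_lattice L \<and>
     (\<forall>x\<in>L. \<exists>A \<subseteq> atoms L. isLub L A x)"

definition poset_iso :: "'a::order set \<Rightarrow> 'b::order set \<Rightarrow> ('a \<Rightarrow> 'b) \<Rightarrow> bool" where
  "poset_iso A B f \<longleftrightarrow> bij_betw f A B \<and> (\<forall>x\<in>A. \<forall>y\<in>A. x \<le> y \<longleftrightarrow> f x \<le> f y)"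

definition poset_isomorphic :: "'a::order set \<Rightarrow> 'b::order set \<Rightarrow> bool" where
  "poset_isomorphic A B \<longleftrightarrow> (\<exists>f. poset_iso A B f)"

text \<open>
  Members of \<open>\<L>(n)\<close> are pairs of a lattice \<open>L\<close> and an enumeration \<open>a 0, \<dots>, a (n - 1)\<close> of its
  atoms, identified up to isomorphism preserving the enumeration. Accordingly the strict order
  is \<open>\<ge>\<close> together with not being isomorphic in this sense.
\<close>

definition atom_ordered_lattice :: "nat \<Rightarrow> 'a::order set \<Rightarrow> (nat \<Rightarrow> 'a) \<Rightarrow> bool" where
  "atom_ordered_lattice n L a \<longleftrightarrow> finite_atomic_lattice L \<and> bij_betw a {..<n} (atoms L)"

definition join_preserving :: "'a::order set \<Rightarrow> 'b::order set \<Rightarrow> ('a \<Rightarrow> 'b) \<Rightarrow> bool" where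
  "join_preserving P Q f \<longleftrightarrow> f ` P \<subseteq> Q \<and>
     (\<forall>X j. X \<subseteq> P \<longrightarrow> isLub P X j \<longrightarrow> isLub Q (f ` X) (f j))"

definition lat_ge ::
  "nat \<Rightarrow> 'a::order set \<Rightarrow> (nat \<Rightarrow> 'a) \<Rightarrow> 'b::order set \<Rightarrow> (nat \<Rightarrow> 'b) \<Rightarrow> bool" where
  "lat_ge n P a Q b \<longleftrightarrow> (\<exists>f. join_preserving P Q f \<and> (\<forall>i<n. f (a i) = b i))"

definition lat_eq ::
  "nat \<Rightarrow> 'a::order set \<Rightarrow> (nat \<Rightarrow> 'a) \<Rightarrow> 'b::order set \<Rightarrow> (nat \<Rightarrow> 'b) \<Rightarrow> bool" where
  "lat_eq n P a Q b \<longleftrightarrow> (\<exists>f. poset_iso P Q f \<and> (\<forall>i<n. f (a i) = b i))"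

definition lat_gt ::
  "nat \<Rightarrow> 'a::order set \<Rightarrow> (nat \<Rightarrow> 'a) \<Rightarrow> 'b::order set \<Rightarrow> (nat \<Rightarrow> 'b) \<Rightarrow> bool" where
  "lat_gt n P a Q b \<longleftrightarrow> lat_ge n P a Q b \<and> \<not> lat_eq n P a Q b"


subsection \<open>Reduced simplicial homology of order complexes\<close>

text \<open>
  Complexes are sets of finite sets and contain the empty face, which has dimension \<open>-1\<close>. All
  faces are chains of the ambient order, and the vertices of a face are listed increasingly;
  so \<open>x\<close> has position \<open>card {y \<in> \<tau>. y < x}\<close> in the face \<open>insert x \<tau>\<close>.
\<close>

definition order_complex :: "'a::order set \<Rightarrow> 'a set set" where
  "order_complex A = {\<sigma>. finite \<sigma> \<and> \<sigma> \<subseteq> A \<and> Complete_Partial_Order.chain (\<le>) \<sigma>}"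

definition chains :: "'a set set \<Rightarrow> int \<Rightarrow> ('a set \<Rightarrow> 'k::field) set" where
  "chains K i = {c. \<forall>\<sigma>. c \<sigma> \<noteq> 0 \<longrightarrow> \<sigma> \<in> K \<and> int (card \<sigma>) = i + 1}"

definition bdry :: "('a::order set \<Rightarrow> 'k::field) \<Rightarrow> 'a set \<Rightarrow> 'k" where
  "bdry c \<tau> = (\<Sum>x | x \<notin> \<tau> \<and> c (insert x \<tau>) \<noteq> 0.
      (-1) ^ card {y \<in> \<tau>. y < x} * c (insert x \<tau>))"

definition cycles :: "'a::order set set \<Rightarrow> int \<Rightarrow> ('a set \<Rightarrow> 'k::field) set" where
  "cycles K i = {z \<in> chains K i. bdry z = 0}"

definition boundaries :: "'a::order set set \<Rightarrow> int \<Rightarrow> ('a set \<Rightarrow> 'k::field) set" where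
  "boundaries K i = bdry ` chains K (i + 1)"

definition hclass ::
  "'a::order set set \<Rightarrow> int \<Rightarrow> ('a set \<Rightarrow> 'k::field) \<Rightarrow> ('a set \<Rightarrow> 'k) set" where
  "hclass K i z = (\<lambda>b. z + b) ` boundaries K i"

definition homology :: "'a::order set set \<Rightarrow> int \<Rightarrow> ('a set \<Rightarrow> 'k::field) set set" where
  "homology K i = hclass K i ` cycles K i"

definition lincomb :: "(('b \<Rightarrow> 'k) \<Rightarrow> 'k) \<Rightarrow> ('b \<Rightarrow> 'k) set \<Rightarrow> 'b \<Rightarrow> 'k::field" where
  "lincomb u b = (\<lambda>\<sigma>. \<Sum>x\<in>b. u x * x \<sigma>)"

text \<open>
  A basis of the vector space \<open>homology K i\<close> is given by a set of cycles representing it; the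
  uniqueness requirement forces distinct members to have distinct classes.
\<close>

definition homology_basis ::
  "'a::order set set \<Rightarrow> int \<Rightarrow> ('a set \<Rightarrow> 'k::field) set \<Rightarrow> bool" where
  "homology_basis K i b \<longleftrightarrow> finite b \<and> b \<subseteq> cycles K i \<and>
     (\<forall>\<xi>\<in>homology K i. \<exists>!u. (\<forall>x. x \<notin> b \<longrightarrow> u x = 0) \<and> \<xi> = hclass K i (lincomb u b))"

definition hbasis :: "'a::order set set \<Rightarrow> int \<Rightarrow> ('a set \<Rightarrow> 'k::field) set" where
  "hbasis K i = (SOME b. homology_basis K i b)"

definition hcoord ::
  "'a::order set set \<Rightarrow> int \<Rightarrow> ('a set \<Rightarrow> 'k::field) set \<Rightarrow> ('a set \<Rightarrow> 'k) \<Rightarrow> 'k" where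
  "hcoord K i \<xi> = (THE u. (\<forall>x. x \<notin> hbasis K i \<longrightarrow> u x = 0) \<and>
      \<xi> = hclass K i (lincomb u (hbasis K i)))"

definition hdim :: "'k::field itself \<Rightarrow> 'a::order set set \<Rightarrow> int \<Rightarrow> nat" where
  "hdim k K i = card (hbasis K i :: ('a set \<Rightarrow> 'k) set)"


subsection \<open>Betti posets, Betti numbers and rigidity\<close>

definition Delta :: "'a::order set \<Rightarrow> 'a \<Rightarrow> 'a set set" where
  "Delta Q p = order_complex {x \<in> Q. pbot Q < x \<and> x < p}"

definition Delta_closed :: "'a::order set \<Rightarrow> 'a \<Rightarrow> 'a set set" where
  "Delta_closed Q p = order_complex {x \<in> Q. pbot Q < x \<and> x \<le> p}"

definition betti_poset :: "'k::field itself \<Rightarrow> 'a::order set \<Rightarrow> 'a set" where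
  "betti_poset k Q = {p \<in> Q. \<exists>i. hdim k (Delta Q p) i \<noteq> 0}"

definition betti :: "'k::field itself \<Rightarrow> 'a::order set \<Rightarrow> nat \<Rightarrow> nat" where
  "betti k L i = (if i = 0 then 1 else \<Sum>p\<in>L - {pbot L}. hdim k (Delta L p) (int i - 2))"

text \<open>
  \<open>Delta L (pbot L)\<close> consists of the empty face, so the minimum belongs to the Betti poset. It
  accounts for the zeroth Betti number and not, as the atoms do, for the first one; therefore it
  takes no part in the second condition, which no lattice with an atom could satisfy otherwise.
\<close>

definition rigid :: "'k::field itself \<Rightarrow> 'a::order set \<Rightarrow> bool" where
  "rigid k L \<longleftrightarrow>
     (\<forall>p\<in>L. \<forall>i. hdim k (Delta L p) i \<noteq> 0 \<longrightarrow>
        hdim k (Delta L p) i = 1 \<and> (\<forall>j. hdim k (Delta L p) j \<noteq> 0 \<longrightarrow> j = i)) \<and>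
     (\<forall>p\<in>L - {pbot L}. \<forall>q\<in>L - {pbot L}. \<forall>i.
        p \<noteq> q \<and> hdim k (Delta L p) i = 1 \<and> hdim k (Delta L q) i = 1 \<longrightarrow>
        \<not> p \<le> q \<and> \<not> q \<le> p)"


subsection \<open>The maps between the homology groups\<close>

text \<open>Connecting map of the Mayer--Vietoris sequence of \<open>K1 \<union> K2\<close>, in degree \<open>i\<close>.\<close>

definition mv_connect ::
  "'a::order set set \<Rightarrow> 'a set set \<Rightarrow> int \<Rightarrow> ('a set \<Rightarrow> 'k::field) set \<Rightarrow> ('a set \<Rightarrow> 'k) set" where
  "mv_connect K1 K2 i \<xi> = (THE \<zeta>. \<exists>z z' z''. z \<in> \<xi> \<and> z = z' + z'' \<and>
      z' \<in> chains K1 i \<and> z'' \<in> chains K2 i \<and> \<zeta> = hclass (K1 \<inter> K2) (i - 1) (bdry z'))"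

text \<open>Map into the homology of the larger complex \<open>K\<close> induced by inclusion.\<close>

definition h_incl ::
  "'a::order set set \<Rightarrow> int \<Rightarrow> ('a set \<Rightarrow> 'k::field) set \<Rightarrow> ('a set \<Rightarrow> 'k) set" where
  "h_incl K i \<xi> = (THE \<zeta>. \<exists>z\<in>\<xi>. \<zeta> = hclass K i z)"

definition phi ::
  "'a::order set \<Rightarrow> nat \<Rightarrow> 'a \<Rightarrow> 'a \<Rightarrow> ('a set \<Rightarrow> 'k::field) set \<Rightarrow> ('a set \<Rightarrow> 'k) set" where
  "phi Q i q p \<xi> = h_incl (Delta Q p) (int i - 3)
     (mv_connect (Delta_closed Q p) (\<Union>b\<in>{b. covers Q q b \<and> b \<noteq> p}. Delta_closed Q b)
        (int i - 2) \<xi>)"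


subsection \<open>Monomial ideals\<close>

text \<open>
  Monomials are exponent vectors \<open>'v \<Rightarrow> nat\<close> with \<open>'v\<close> a finite type of variables. Divisibility is
  then the pointwise order, the monomial \<open>1\<close> is \<open>0\<close>, the quotient of a monomial by a divisor is
  the difference, and the least common multiple of a finite set \<open>X\<close> is the pointwise maximum,
  that is \<open>Sup X\<close> (with \<open>Sup {} = 0\<close>).
\<close>

type_synonym 'v monom = "'v \<Rightarrow> nat"
type_synonym ('v, 'k) mpoly = "('v \<Rightarrow> nat) \<Rightarrow>\<^sub>0 'k"

definition monomial_ideal :: "('v, 'k::field) mpoly set \<Rightarrow> bool" where
  "monomial_ideal N \<longleftrightarrow> (\<exists>M. N = module.span (*) ((\<lambda>m. Poly_Mapping.single m 1) ` M))"

definition min_gens :: "('v, 'k::field) mpoly set \<Rightarrow> 'v monom set" where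
  "min_gens N = {m. Poly_Mapping.single m 1 \<in> N \<and>
     (\<forall>m'. Poly_Mapping.single m' 1 \<in> N \<and> m' \<le> m \<longrightarrow> m' = m)}"

definition lcm_lattice :: "('v, 'k::field) mpoly set \<Rightarrow> 'v monom set" where
  "lcm_lattice N = Sup ` Pow (min_gens N)"


subsection \<open>Multigraded free complexes and minimal free resolutions\<close>

text \<open>
  A complex of multigraded free modules with homogeneous bases \<open>gens i\<close>: the basis element \<open>e\<close> of
  \<open>F\<^sub>i\<close> has multidegree \<open>mdeg i e\<close>, and the entry of the \<open>i\<close>-th differential from \<open>e\<close> to the basis
  element \<open>e'\<close> of \<open>F\<^sub>i\<^sub>-\<^sub>1\<close> is the scalar \<open>coef i e e'\<close> times the quotient of the multidegrees.
  Elements of \<open>F\<^sub>i\<close> are coordinate vectors.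
\<close>

record ('e, 'v, 'k) based_complex =
  gens :: "nat \<Rightarrow> 'e set"
  mdeg :: "nat \<Rightarrow> 'e \<Rightarrow> 'v \<Rightarrow> nat"
  coef :: "nat \<Rightarrow> 'e \<Rightarrow> 'e \<Rightarrow> 'k"

definition free_mod ::
  "('e, 'v, 'k::field) based_complex \<Rightarrow> nat \<Rightarrow> ('e \<Rightarrow> ('v, 'k) mpoly) set" where
  "free_mod F i = {f. \<forall>e. e \<notin> gens F i \<longrightarrow> f e = 0}"

definition diffl :: "('e, 'v, 'k::field) based_complex \<Rightarrow> nat \<Rightarrow>
    ('e \<Rightarrow> ('v, 'k) mpoly) \<Rightarrow> 'e \<Rightarrow> ('v, 'k) mpoly" where
  "diffl F i f = (\<lambda>e'. if e' \<in> gens F (i - 1) then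
      \<Sum>e\<in>gens F i. f e * Poly_Mapping.single (mdeg F i e - mdeg F (i - 1) e') (coef F i e e')
    else 0)"

text \<open>
  \<open>F\<close> is a minimal free resolution of \<open>S/N\<close> with \<open>F\<^sub>0 = S\<close>. The last condition says that the
  images of the differentials lie in \<open>\<mm>F\<^sub>i\<^sub>-\<^sub>1\<close>, \<open>\<mm>\<close> being the ideal of the polynomials with constant
  term \<open>0\<close>.
\<close>

definition minimal_free_resolution ::
  "('e, 'v, 'k::field) based_complex \<Rightarrow> ('v, 'k) mpoly set \<Rightarrow> bool" where
  "minimal_free_resolution F N \<longleftrightarrow>
     (\<forall>i. finite (gens F i)) \<and>
     (\<forall>i\<ge>1. \<forall>e\<in>gens F i. \<forall>e'\<in>gens F (i - 1).
        coef F i e e' \<noteq> 0 \<longrightarrow> mdeg F (i - 1) e' \<le> mdeg F i e) \<and>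
     (\<exists>e0. gens F 0 = {e0} \<and> mdeg F 0 e0 = 0 \<and>
        (\<lambda>f. f e0) ` diffl F 1 ` free_mod F 1 = N) \<and>
     (\<forall>i\<ge>1. diffl F (i + 1) ` free_mod F (i + 1) = {f \<in> free_mod F i. diffl F i f = 0}) \<and>
     (\<forall>i\<ge>1. \<forall>f\<in>free_mod F i. \<forall>e. Poly_Mapping.lookup (diffl F i f e) 0 = 0)"


subsection \<open>Resolutions supported on a poset\<close>

text \<open>
  The basis of \<open>F\<^sub>i\<close> consists of the pairs \<open>(q, z)\<close> with \<open>z\<close> in the chosen basis of \<open>\<D>\<^sub>i\<^sub>,\<^sub>q\<close>. For
  \<open>i = 0\<close> the only summand is \<open>\<D>\<^sub>0\<close>, placed at \<open>q = pbot Q\<close>; the complex of the empty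
  face used for it is \<open>{{}}\<close>.
\<close>

definition poset_complex :: "'a::order set \<Rightarrow> ('a \<Rightarrow> 'v monom) \<Rightarrow>
    ('a \<times> ('a set \<Rightarrow> 'k::field), 'v, 'k) based_complex" where
  "poset_complex Q \<eta> = \<lparr>
     gens = (\<lambda>i. if i = 0 then {pbot Q} \<times> hbasis {{}} (-1)
        else SIGMA q : Q - {pbot Q}. hbasis (Delta Q q) (int i - 2)),
     mdeg = (\<lambda>i (q, z). \<eta> q),
     coef = (\<lambda>i (q, z) (p, w).
        if \<not> covers Q q p then 0
        else if i = 1 then hcoord {{}} (-1) (hclass {{}} (-1) z) w
        else hcoord (Delta Q p) (int i - 3) (phi Q i q p (hclass (Delta Q q) (int i - 2) z)) w)
   \<rparr>"

definition supported_on :: "('v, 'k::field) mpoly set \<Rightarrow> 'a::order set \<Rightarrow> bool" where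
  "supported_on N Q \<longleftrightarrow> (\<exists>\<eta> :: 'a \<Rightarrow> 'v monom. mono_on Q \<eta> \<and> \<eta> (pbot Q) = 0 \<and>
     minimal_free_resolution (poset_complex Q \<eta>) N)"


subsection \<open>Rigid deformations\<close>

definition relabel ::
  "('w monom \<Rightarrow> 'v monom) \<Rightarrow> ('e, 'w, 'k) based_complex \<Rightarrow> ('e, 'v, 'k) based_complex" where
  "relabel g F = \<lparr>gens = gens F, mdeg = (\<lambda>i e. g (mdeg F i e)), coef = coef F\<rparr>"

text \<open>
  The minimal free resolution is unique up to multigraded isomorphism, so it may be taken in any
  homogeneous bases; here these are indexed by natural numbers.
\<close>

definition rigid_deformation ::
  "('w, 'k::field) mpoly set \<Rightarrow> ('v, 'k) mpoly set \<Rightarrow> bool" where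
  "rigid_deformation J I \<longleftrightarrow> rigid TYPE('k) (lcm_lattice J) \<and>
     (\<exists>(F :: (nat, 'w, 'k) based_complex) (g :: 'w monom \<Rightarrow> 'v monom).
        minimal_free_resolution F J \<and>
        mono_on (betti_poset TYPE('k) (lcm_lattice J)) g \<and>
        minimal_free_resolution (relabel g F) I)"

end

theory Submission
  imports Defs "HOL-Library.Countable_Set"
begin

text \<open>
  Homology is computed at the level of chains. Removing an element with acyclic link, or more
  generally passing to a subposet all of whose lower (or all of whose upper) fibres are acyclic,
  does not change the homology of an order complex. In particular a down-set has the homology of
  its intersection with the Betti poset.

  Rigidity of \<open>P\<close> equips \<open>Q = B(P)\<close> with a strictly increasing rank such that the chains below an
  element of rank \<open>i\<close> have at most \<open>i - 1\<close> elements, while the only homology is a line in the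
  degree \<open>i - 2\<close> of the longest chains. So this homology is spanned by one cycle without
  boundaries to divide out, the maps \<open>\<phi>\<close> take such a cycle to its links, and the restriction of
  \<open>\<D>\<close> to a down-set of \<open>Q\<close> is exact if its order complex is acyclic. By multigrading, a labelling
  of \<open>Q\<close> gives a minimal resolution as soon as the elements whose label divides a given monomial
  of the ideal form an acyclic down-set and no nonzero entry connects equal labels.

  The map \<open>f\<close> from \<open>P\<close> to \<open>L\<close> has an upper adjoint \<open>g\<close> with \<open>f \<circ> g = id\<close>, so that \<open>(0, y)\<close> in \<open>L\<close>
  has the homology of its preimage. Attaching the elements of the fibre over \<open>y\<close> one after another
  to this preimage yields an acyclic complex, which bounds the Betti numbers of \<open>L\<close> at \<open>y\<close> by
  those of \<open>P\<close> on the fibre. As the total Betti numbers agree, equality holds throughout; this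
  forces \<open>f ` B(P) \<subseteq> B(L)\<close> and the vanishing of all entries between elements with equal image.
\<close>

section \<open>Chains, cones and links\<close>

abbreviation ochains :: "'a::order set \<Rightarrow> int \<Rightarrow> ('a set \<Rightarrow> 'k::field) set" where
  "ochains A i \<equiv> chains (order_complex A) i"

definition scale_fun :: "'k::field \<Rightarrow> ('b \<Rightarrow> 'k) \<Rightarrow> 'b \<Rightarrow> 'k" (infixr "*\<^sub>F" 75) where
  "a *\<^sub>F f = (\<lambda>x. a * f x)"

definition face_sign :: "'a::order \<Rightarrow> 'a set \<Rightarrow> 'k::field" where
  "face_sign x \<tau> = (-1) ^ card {y \<in> \<tau>. y < x}"

definition cone :: "'a::order \<Rightarrow> ('a set \<Rightarrow> 'k::field) \<Rightarrow> 'a set \<Rightarrow> 'k" where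
  "cone q w \<sigma> = (if q \<in> \<sigma> then face_sign q (\<sigma> - {q}) * w (\<sigma> - {q}) else 0)"

definition link :: "'a::order \<Rightarrow> ('a set \<Rightarrow> 'k::field) \<Rightarrow> 'a set \<Rightarrow> 'k" where
  "link q c \<tau> = (if q \<in> \<tau> then 0 else face_sign q \<tau> * c (insert q \<tau>))"

definition deletion :: "'a \<Rightarrow> ('a set \<Rightarrow> 'k::zero) \<Rightarrow> 'a set \<Rightarrow> 'k" where
  "deletion q c \<sigma> = (if q \<in> \<sigma> then 0 else c \<sigma>)"

definition comparables :: "'a::order set \<Rightarrow> 'a \<Rightarrow> 'a set" where
  "comparables A q = {x \<in> A. x < q \<or> q < x}"

lemma scale_fun_apply [simp]: "(a *\<^sub>F f) x = a * f x"
  by (simp add: scale_fun_def)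

lemma (in module) subspace_sums_subset:
  "subspace U \<Longrightarrow> V \<subseteq> U \<Longrightarrow> W \<subseteq> U \<Longrightarrow> {v + w | v w. v \<in> V \<and> w \<in> W} \<subseteq> U"
  using subspace_add by blast

interpretation fun_space: vector_space "(*\<^sub>F) :: 'k::field \<Rightarrow> ('b \<Rightarrow> 'k) \<Rightarrow> 'b \<Rightarrow> 'k"
  by unfold_locales (auto simp: fun_eq_iff algebra_simps)

lemma sum_fun_apply: "(\<Sum>x\<in>S. f x) y = (\<Sum>x\<in>S. f x y)"
  for f :: "'c \<Rightarrow> 'b \<Rightarrow> 'k::comm_monoid_add"
  by (induction S rule: infinite_finite_induct) auto

lemma sum_antisymmetric_eq_0:
  fixes f :: "'b \<Rightarrow> 'b \<Rightarrow> 'c::ab_group_add"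
  assumes "finite A" "\<And>x y. f x y = - f y x" "\<And>x. f x x = 0"
  shows "(\<Sum>x\<in>A. \<Sum>y\<in>A. f x y) = 0"
  using assms(1)
proof (induction A rule: finite_induct)
  case (insert z A)
  have "(\<Sum>x\<in>A. f x z) = - (\<Sum>x\<in>A. f z x)"
    unfolding sum_negf[symmetric] by (rule sum.cong[OF refl assms(2)])
  then show ?case
    using insert assms(3) by (simp add: sum.distrib)
qed simp

lemma face_sign_square [simp]: "face_sign x \<tau> * (face_sign x \<tau> :: 'k::field) = 1"
  by (simp add: face_sign_def flip: power_add mult_2)

lemma face_sign_square_mult [simp]: "face_sign x \<tau> * ((face_sign x \<tau> :: 'k::field) * a) = a"
  by (simp flip: mult.assoc)

lemma face_sign_insert:
  assumes "finite \<tau>" "y \<notin> \<tau>"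
  shows "face_sign x (insert y \<tau>) = (if y < x then - face_sign x \<tau> else (face_sign x \<tau> :: 'k::field))"
proof -
  have "{z \<in> insert y \<tau>. z < x} = (if y < x then insert y {z \<in> \<tau>. z < x} else {z \<in> \<tau>. z < x})"
    by auto
  then show ?thesis
    using assms by (simp add: face_sign_def)
qed

lemma order_complex_iff:
  "\<sigma> \<in> order_complex A \<longleftrightarrow> finite \<sigma> \<and> \<sigma> \<subseteq> A \<and> (\<forall>x\<in>\<sigma>. \<forall>y\<in>\<sigma>. x \<le> y \<or> y \<le> x)"
  by (auto simp: order_complex_def chain_def)

lemma order_complex_mono: "A \<subseteq> B \<Longrightarrow> order_complex A \<subseteq> order_complex B"
  by (fastforce simp: order_complex_iff)

lemma comparables_subset: "comparables A q \<subseteq> A - {q}"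
  by (auto simp: comparables_def)

lemma finite_comparables: "finite A \<Longrightarrow> finite (comparables A q)"
  by (simp add: comparables_def)

lemma insert_in_order_complex_iff:
  assumes "q \<notin> \<tau>"
  shows "insert q \<tau> \<in> order_complex A \<longleftrightarrow> q \<in> A \<and> \<tau> \<in> order_complex (comparables A q)"
proof -
  have "x < q \<or> q < x \<longleftrightarrow> x \<le> q \<or> q \<le> x" if "x \<in> \<tau>" for x
    using that assms by (auto simp: order_le_less)
  then show ?thesis
    by (auto simp: order_complex_iff comparables_def)
qed

lemma chainsI:
  assumes "\<And>\<sigma>. c \<sigma> \<noteq> 0 \<Longrightarrow> \<sigma> \<in> K \<and> int (card \<sigma>) = i + 1"
  shows "c \<in> chains K i"
  using assms by (simp add: chains_def)

lemma chainsD: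
  assumes "c \<in> chains K i" "c \<sigma> \<noteq> 0"
  shows "\<sigma> \<in> K" "int (card \<sigma>) = i + 1"
  using assms by (auto simp: chains_def)

lemma chains_zero [simp]: "0 \<in> chains K i"
  by (simp add: chains_def)

lemma chains_mono: "c \<in> chains K i \<Longrightarrow> K \<subseteq> K' \<Longrightarrow> c \<in> chains K' i"
  by (auto simp: chains_def)

lemma ochains_mono: "c \<in> ochains A i \<Longrightarrow> A \<subseteq> B \<Longrightarrow> c \<in> ochains B i"
  by (rule chains_mono[OF _ order_complex_mono])

lemma ochains_Int: "c \<in> ochains A i \<Longrightarrow> c \<in> ochains B j \<Longrightarrow> c \<in> ochains (A \<inter> B) i"
  by (auto simp: chains_def order_complex_iff)

lemma chains_subspace: "fun_space.subspace (chains K i :: ('a set \<Rightarrow> 'k::field) set)"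
proof (rule fun_space.subspaceI)
  fix c d :: "'a set \<Rightarrow> 'k" assume "c \<in> chains K i" "d \<in> chains K i"
  then have "c \<sigma> = 0 \<and> d \<sigma> = 0" if "\<not> (\<sigma> \<in> K \<and> int (card \<sigma>) = i + 1)" for \<sigma>
    using that by (auto simp: chains_def)
  then show "c + d \<in> chains K i"
    by (fastforce simp: chains_def)
qed (auto simp: chains_def)

lemmas chains_add = fun_space.subspace_add[OF chains_subspace]
  and chains_diff = fun_space.subspace_diff[OF chains_subspace]
  and chains_minus = fun_space.subspace_neg[OF chains_subspace]
  and chains_scale = fun_space.subspace_scale[OF chains_subspace]
  and chains_sum = fun_space.subspace_sum[OF chains_subspace]

lemma link_add: "link q (c + d) = link q c + link q d"
  and link_diff: "link q (c - d) = link q c - link q d"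
  and link_minus: "link q (- c) = - link q c"
  and link_zero [simp]: "link q 0 = 0"
  and link_scale: "link q (a *\<^sub>F c) = a *\<^sub>F link q c"
  by (auto simp: fun_eq_iff link_def algebra_simps)

lemma link_sum: "link q (\<Sum>x\<in>S. f x) = (\<Sum>x\<in>S. link q (f x))"
  by (auto simp: fun_eq_iff link_def sum_fun_apply sum_distrib_left)

lemma cone_add: "cone q (c + d) = cone q c + cone q d"
  and cone_zero [simp]: "cone q 0 = 0"
  and cone_minus: "cone q (- c) = - cone q c"
  by (auto simp: fun_eq_iff cone_def algebra_simps)

lemma cone_sum: "cone q (\<Sum>x\<in>S. f x) = (\<Sum>x\<in>S. cone q (f x))"
  by (auto simp: fun_eq_iff cone_def sum_fun_apply sum_distrib_left)

lemma cone_link_deletion: "cone q (link q c) + deletion q c = c"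
  by (auto simp: fun_eq_iff cone_def link_def deletion_def insert_absorb)

lemma link_in_ochains:
  assumes "c \<in> ochains A i"
  shows "link q c \<in> ochains (comparables A q) (i - 1)"
proof (rule chainsI)
  fix \<tau> assume "link q c \<tau> \<noteq> 0"
  then have q: "q \<notin> \<tau>" and "c (insert q \<tau>) \<noteq> 0"
    by (auto simp: link_def split: if_splits)
  then have "insert q \<tau> \<in> order_complex A" "int (card (insert q \<tau>)) = i + 1"
    using chainsD[OF assms] by blast+
  moreover have "finite \<tau>"
    using calculation(1) by (simp add: order_complex_iff)
  ultimately show "\<tau> \<in> order_complex (comparables A q) \<and> int (card \<tau>) = i - 1 + 1"
    using q by (simp add: insert_in_order_complex_iff)
qed

lemma cone_in_ochains:
  assumes "q \<in> A" "w \<in> ochains (comparables A q) i"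
  shows "cone q w \<in> ochains A (i + 1)"
proof (rule chainsI)
  fix \<sigma> assume "cone q w \<sigma> \<noteq> 0"
  then have q: "q \<in> \<sigma>" and "w (\<sigma> - {q}) \<noteq> 0"
    by (auto simp: cone_def split: if_splits)
  then have face: "\<sigma> - {q} \<in> order_complex (comparables A q)" "int (card (\<sigma> - {q})) = i + 1"
    using chainsD[OF assms(2)] by blast+
  then have "insert q (\<sigma> - {q}) \<in> order_complex A"
    using insert_in_order_complex_iff[of q "\<sigma> - {q}" A] assms(1) by blast
  moreover have "card \<sigma> = Suc (card (\<sigma> - {q}))"
    using face(1) q
    by (metis card_Suc_Diff1 finite_Diff2 finite.emptyI finite_insert order_complex_iff)
  ultimately show "\<sigma> \<in> order_complex A \<and> int (card \<sigma>) = i + 1 + 1"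
    using q face(2) by (simp add: insert_absorb)
qed

lemma deletion_in_ochains: "c \<in> ochains A i \<Longrightarrow> deletion q c \<in> ochains (A - {q}) i"
  using chainsD[of c "order_complex A" i]
  by (intro chainsI) (fastforce simp: deletion_def order_complex_iff split: if_splits)

lemma ochains_face_subset: "c \<in> ochains A i \<Longrightarrow> c \<sigma> \<noteq> 0 \<Longrightarrow> \<sigma> \<subseteq> A"
  using chainsD(1) by (fastforce simp: order_complex_iff)

lemma link_eq_0: "c \<in> ochains A i \<Longrightarrow> q \<notin> A \<Longrightarrow> link q c = 0"
  using ochains_face_subset[of c A i] unfolding fun_eq_iff link_def zero_fun_apply
  by (metis insert_subset mult_zero_right)

lemma link_cone:
  assumes "w \<in> ochains A i" "q \<notin> A"
  shows "link q (cone q w) = w"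
  using ochains_face_subset[OF assms(1)] assms(2) by (fastforce simp: fun_eq_iff cone_def link_def)

lemma link_link_same: "link q (link q c) = 0"
  by (auto simp: fun_eq_iff link_def)

lemma link_link_commute:
  assumes "c \<in> ochains A i"
  shows "link x (link y c) = - link y (link x c)"
proof
  fix \<tau>
  show "link x (link y c) \<tau> = (- link y (link x c)) \<tau>"
  proof (cases "x \<in> \<tau> \<or> y \<in> \<tau> \<or> x = y \<or> c (insert x (insert y \<tau>)) = 0")
    case True
    then show ?thesis
      by (auto simp: link_def insert_commute)
  next
    case False
    then have "insert x (insert y \<tau>) \<in> order_complex A"
      using chainsD(1)[OF assms] by blast
    then have "x < y \<or> y < x" "finite \<tau>"
      using False by (auto simp: order_complex_iff order_le_less)
    then show ?thesis
      using False by (auto simp: link_def insert_commute face_sign_insert dest: less_asym)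
  qed
qed

lemma link_cone_commute:
  assumes "w \<in> ochains (comparables A q) i" "x \<noteq> q"
  shows "link x (cone q w) = - cone q (link x w)"
proof
  fix \<tau>
  define \<rho> where "\<rho> = \<tau> - {q}"
  show "link x (cone q w) \<tau> = (- cone q (link x w)) \<tau>"
  proof (cases "x \<in> \<tau> \<or> q \<notin> \<tau> \<or> w (insert x \<rho>) = 0")
    case True
    then show ?thesis
      using assms(2) by (auto simp: link_def cone_def \<rho>_def insert_Diff_if)
  next
    case False
    then have \<tau>: "\<tau> = insert q \<rho>" "q \<notin> \<rho>" "x \<notin> \<rho>"
      by (auto simp: \<rho>_def)
    have "insert x \<rho> \<in> order_complex (comparables A q)"
      using False chainsD(1)[OF assms(1)] by blast
    then have "q < x \<or> x < q" "finite \<rho>"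
      by (auto simp: order_complex_iff comparables_def)
    then show ?thesis
      using \<tau> False assms(2)
      by (auto simp: link_def cone_def insert_Diff_if face_sign_insert dest: less_asym)
  qed
qed

text \<open>As the boundary is the sum of the links, its properties reduce to the two preceding
  commutation rules.\<close>

lemma bdry_eq_sum_links:
  assumes "finite A" "c \<in> ochains A i"
  shows "bdry c = (\<Sum>x\<in>A. link x c)"
proof
  fix \<tau>
  have "bdry c \<tau> = (\<Sum>x | x \<notin> \<tau> \<and> c (insert x \<tau>) \<noteq> 0. link x c \<tau>)"
    unfolding bdry_def by (intro sum.cong) (auto simp: link_def face_sign_def)
  also have "\<dots> = (\<Sum>x\<in>A. link x c \<tau>)"
    using assms(1) ochains_face_subset[OF assms(2)]
    by (intro sum.mono_neutral_left) (auto simp: link_def)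
  finally show "bdry c \<tau> = (\<Sum>x\<in>A. link x c) \<tau>"
    by (simp add: sum_fun_apply)
qed

lemma bdry_zero [simp]: "bdry 0 = 0"
  by (simp add: bdry_def fun_eq_iff)

lemma bdry_add:
  assumes "finite A" "c \<in> ochains A i" "d \<in> ochains A i"
  shows "bdry (c + d) = bdry c + bdry d"
  using assms by (simp add: bdry_eq_sum_links[of A _ i] chains_add link_add sum.distrib)

lemma bdry_diff:
  assumes "finite A" "c \<in> ochains A i" "d \<in> ochains A i"
  shows "bdry (c - d) = bdry c - bdry d"
  using assms by (simp add: bdry_eq_sum_links[of A _ i] chains_diff link_diff sum_subtractf)

lemma bdry_minus:
  assumes "finite A" "c \<in> ochains A i"
  shows "bdry (- c) = - bdry c"
  using assms by (simp add: bdry_eq_sum_links[of A _ i] chains_minus link_minus sum_negf)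

lemma bdry_scale:
  assumes "finite A" "c \<in> ochains A i"
  shows "bdry (a *\<^sub>F c) = a *\<^sub>F bdry c"
  using assms
  by (simp add: bdry_eq_sum_links[of A _ i] chains_scale link_scale fun_space.scale_sum_right)

lemma bdry_sum:
  assumes "finite A" "\<And>x. x \<in> S \<Longrightarrow> f x \<in> ochains A i"
  shows "bdry (\<Sum>x\<in>S. f x) = (\<Sum>x\<in>S. bdry (f x))"
proof -
  have "bdry (\<Sum>x\<in>S. f x) = (\<Sum>a\<in>A. \<Sum>x\<in>S. link a (f x))"
    using bdry_eq_sum_links[OF assms(1) chains_sum[OF assms(2)]] by (simp only: link_sum)
  also have "\<dots> = (\<Sum>x\<in>S. \<Sum>a\<in>A. link a (f x))"
    by (rule sum.swap)
  also have "\<dots> = (\<Sum>x\<in>S. bdry (f x))"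
    by (rule sum.cong[OF refl]) (rule bdry_eq_sum_links[OF assms, symmetric])
  finally show ?thesis .
qed

lemma bdry_in_ochains:
  assumes "finite A" "c \<in> ochains A i"
  shows "bdry c \<in> ochains A (i - 1)"
proof -
  have "comparables A x \<subseteq> A" for x
    using comparables_subset by blast
  then show ?thesis
    unfolding bdry_eq_sum_links[OF assms] using assms(2)
    by (intro chains_sum ochains_mono[OF link_in_ochains])
qed

lemma bdry_in_ochains_plus1:
  "finite A \<Longrightarrow> c \<in> ochains A (i + 1) \<Longrightarrow> bdry c \<in> ochains A i"
  using bdry_in_ochains[of A c "i + 1"] by simp

lemma link_in_ochains_self: "c \<in> ochains A i \<Longrightarrow> link q c \<in> ochains A (i - 1)"
  by (rule ochains_mono[OF link_in_ochains]) (auto simp: comparables_def)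

lemma link_bdry:
  assumes "finite A" "c \<in> ochains A i"
  shows "link q (bdry c) = - bdry (link q c)"
proof -
  have "link q (bdry c) = (\<Sum>x\<in>A. link q (link x c))"
    by (simp only: bdry_eq_sum_links[OF assms] link_sum)
  also have "\<dots> = (\<Sum>x\<in>A. - link x (link q c))"
    by (rule sum.cong[OF refl]) (rule link_link_commute[OF assms(2)])
  also have "\<dots> = - bdry (link q c)"
    by (simp only: bdry_eq_sum_links[OF assms(1) link_in_ochains_self[OF assms(2)]] sum_negf)
  finally show ?thesis .
qed

lemma bdry_bdry:
  assumes "finite A" "c \<in> ochains A i"
  shows "bdry (bdry c) = 0"
proof -
  have "bdry (bdry c) = (\<Sum>x\<in>A. \<Sum>y\<in>A. link x (link y c))"
    by (simp only: bdry_eq_sum_links[OF assms(1) bdry_in_ochains[OF assms]] link_sum[symmetric]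
      bdry_eq_sum_links[OF assms, symmetric])
  also have "\<dots> = 0"
    by (rule sum_antisymmetric_eq_0[OF assms(1) link_link_commute[OF assms(2)] link_link_same])
  finally show ?thesis .
qed

lemma bdry_cone:
  assumes "finite A" "q \<in> A" "w \<in> ochains (comparables A q) i"
  shows "bdry (cone q w) = w - cone q (bdry w)"
proof -
  have q: "q \<notin> comparables A q"
    by (simp add: comparables_def)
  have w: "w \<in> ochains A i"
    by (rule ochains_mono[OF assms(3)]) (use comparables_subset in auto)
  have "bdry w = (\<Sum>x\<in>A - {q}. link x w)"
    unfolding bdry_eq_sum_links[OF assms(1) w] sum.remove[OF assms(1,2)] link_eq_0[OF assms(3) q]
    by simp
  moreover have "bdry (cone q w) = link q (cone q w) + (\<Sum>x\<in>A - {q}. link x (cone q w))"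
    unfolding bdry_eq_sum_links[OF assms(1) cone_in_ochains[OF assms(2,3)]]
    by (rule sum.remove[OF assms(1,2)])
  moreover have "(\<Sum>x\<in>A - {q}. link x (cone q w)) = (\<Sum>x\<in>A - {q}. - cone q (link x w))"
    by (rule sum.cong[OF refl]) (use link_cone_commute[OF assms(3)] in auto)
  ultimately show ?thesis
    by (simp only: link_cone[OF assms(3) q] sum_negf cone_sum) simp
qed

lemma bdry_decompose:
  assumes "finite A" "q \<in> A" "c \<in> ochains A i"
  shows "bdry c = link q c - cone q (bdry (link q c)) + bdry (deletion q c)"
proof -
  have l: "link q c \<in> ochains (comparables A q) (i - 1)"
    by (rule link_in_ochains[OF assms(3)])
  have "cone q (link q c) \<in> ochains A i" "deletion q c \<in> ochains A i"
    using cone_in_ochains[OF assms(2) l] ochains_mono[OF deletion_in_ochains[OF assms(3)]] by auto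
  then have "bdry (cone q (link q c) + deletion q c) = bdry (cone q (link q c)) + bdry (deletion q c)"
    by (rule bdry_add[OF assms(1)])
  then show ?thesis
    by (simp only: cone_link_deletion bdry_cone[OF assms(1,2) l])
qed

lemma bdry_link_eq_0:
  assumes "finite A" "c \<in> ochains A i" "bdry c \<in> ochains (A - {q}) j"
  shows "bdry (link q c) = 0"
  using link_bdry[OF assms(1,2), of q] link_eq_0[OF assms(3), of q] by simp

lemma bdry_decompose_if_bdry_avoids:
  assumes "finite A" "q \<in> A" "c \<in> ochains A i" "bdry c \<in> ochains (A - {q}) j"
  shows "bdry c = link q c + bdry (deletion q c)"
  using bdry_decompose[OF assms(1-3)] bdry_link_eq_0[OF assms(1,3,4)] by simp

abbreviation ocycles :: "'a::order set \<Rightarrow> int \<Rightarrow> ('a set \<Rightarrow> 'k::field) set" where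
  "ocycles A i \<equiv> cycles (order_complex A) i"

abbreviation obounds :: "'a::order set \<Rightarrow> int \<Rightarrow> ('a set \<Rightarrow> 'k::field) set" where
  "obounds A i \<equiv> boundaries (order_complex A) i"

lemma obounds_iff: "z \<in> obounds A i \<longleftrightarrow> (\<exists>d\<in>ochains A (i + 1). bdry d = z)"
  by (auto simp: boundaries_def)

lemma ocycles_subset_ochains:
  "(ocycles A i :: ('a::order set \<Rightarrow> 'k::field) set) \<subseteq> ochains A i"
  by (auto simp: cycles_def)

lemma ocycles_mono:
  "A \<subseteq> B \<Longrightarrow> (ocycles A i :: ('a::order set \<Rightarrow> 'k::field) set) \<subseteq> ocycles B i"
  by (auto simp: cycles_def intro: ochains_mono)

lemma obounds_mono:
  "A \<subseteq> B \<Longrightarrow> (obounds A i :: ('a::order set \<Rightarrow> 'k::field) set) \<subseteq> obounds B i"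
  by (auto simp: boundaries_def intro: ochains_mono)

lemma obounds_subset_ocycles:
  "finite A \<Longrightarrow> (obounds A i :: ('a::order set \<Rightarrow> 'k::field) set) \<subseteq> ocycles A i"
  by (auto simp: boundaries_def cycles_def bdry_in_ochains_plus1 bdry_bdry)

lemma bdry_in_obounds: "d \<in> ochains A (i + 1) \<Longrightarrow> bdry d \<in> obounds A i"
  by (auto simp: boundaries_def)

lemma ocycles_subspace:
  "finite A \<Longrightarrow> fun_space.subspace (ocycles A i :: ('a::order set \<Rightarrow> 'k::field) set)"
  by (rule fun_space.subspaceI)
    (auto simp: cycles_def chains_add chains_scale bdry_add[of A _ i] bdry_scale[of A _ i])

lemma obounds_subspace:
  assumes "finite A"
  shows "fun_space.subspace (obounds A i :: ('a::order set \<Rightarrow> 'k::field) set)"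
proof (rule fun_space.subspaceI)
  show "0 \<in> (obounds A i :: ('a set \<Rightarrow> 'k) set)"
    unfolding obounds_iff by (rule bexI[of _ 0]) (rule bdry_zero, rule chains_zero)
next
  fix x y :: "'a set \<Rightarrow> 'k" assume "x \<in> obounds A i" "y \<in> obounds A i"
  then obtain c d where cd: "c \<in> ochains A (i + 1)" "d \<in> ochains A (i + 1)" "bdry c = x"
      "bdry d = y"
    unfolding obounds_iff by blast
  then have "bdry (c + d) = x + y"
    using bdry_add[OF assms cd(1,2)] by blast
  then show "x + y \<in> obounds A i"
    using bdry_in_obounds[OF chains_add[OF cd(1,2)]] by simp
next
  fix x :: "'a set \<Rightarrow> 'k" and a assume "x \<in> obounds A i"
  then obtain c where c: "c \<in> ochains A (i + 1)" "bdry c = x"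
    unfolding obounds_iff by blast
  then have "bdry (a *\<^sub>F c) = a *\<^sub>F x"
    using bdry_scale[OF assms c(1)] by blast
  then show "a *\<^sub>F x \<in> obounds A i"
    using bdry_in_obounds[OF chains_scale[OF c(1)], of a] by simp
qed

lemma bdry_diff_bdry:
  assumes "finite A" "c \<in> ochains A i" "d \<in> ochains A (i + 1)"
  shows "bdry (c - bdry d) = bdry c"
  using bdry_diff[OF assms(1,2) bdry_in_ochains_plus1[OF assms(1,3)]] bdry_bdry[OF assms(1,3)]
  by simp

section \<open>Acyclicity and fibres\<close>

definition acyclic_over :: "'k::field itself \<Rightarrow> 'a::order set \<Rightarrow> bool" where
  "acyclic_over k A \<longleftrightarrow> (\<forall>i. (ocycles A i :: ('a set \<Rightarrow> 'k) set) \<subseteq> obounds A i)"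

text \<open>Vanishing of the homology of the pair, that is, the inclusion of \<open>X\<close> in \<open>A\<close> induces
  isomorphisms in homology.\<close>

definition rel_acyclic :: "'k::field itself \<Rightarrow> 'a::order set \<Rightarrow> 'a set \<Rightarrow> bool" where
  "rel_acyclic k X A \<longleftrightarrow> X \<subseteq> A \<and> (\<forall>i. \<forall>c\<in>(ochains A i :: ('a set \<Rightarrow> 'k) set).
     bdry c \<in> ochains X (i - 1) \<longrightarrow> (\<exists>d\<in>ochains A (i + 1). c - bdry d \<in> ochains X i))"

lemma rel_acyclicD:
  fixes k :: "'k::field itself" and c :: "'a::order set \<Rightarrow> 'k::field"
  assumes "rel_acyclic k X A" "c \<in> ochains A i" "bdry c \<in> ochains X (i - 1)"
  obtains d where "d \<in> ochains A (i + 1)" "c - bdry d \<in> ochains X i"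
  using assms unfolding rel_acyclic_def by blast

lemma rel_acyclic_refl: "rel_acyclic k A A"
  for k :: "'k::field itself"
proof -
  have "c - bdry 0 \<in> ochains A i" if "c \<in> ochains A i" for i and c :: "'a set \<Rightarrow> 'k"
    using that by simp
  then show ?thesis
    unfolding rel_acyclic_def using chains_zero by blast
qed

lemma rel_acyclic_trans:
  fixes k :: "'k::field itself"
  assumes "finite Z" "rel_acyclic k X Y" "rel_acyclic k Y Z"
  shows "rel_acyclic k X Z"
  unfolding rel_acyclic_def
proof (intro conjI allI ballI impI)
  have XY: "X \<subseteq> Y" and YZ: "Y \<subseteq> Z"
    using assms by (auto simp: rel_acyclic_def)
  then show "X \<subseteq> Z" by simp
  fix i and c :: "'a set \<Rightarrow> 'k"
  assume c: "c \<in> ochains Z i" and bc: "bdry c \<in> ochains X (i - 1)"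
  obtain d where d: "d \<in> ochains Z (i + 1)" "c - bdry d \<in> ochains Y i"
    using rel_acyclicD[OF assms(3) c ochains_mono[OF bc XY]] .
  then obtain e where e: "e \<in> ochains Y (i + 1)" "c - bdry d - bdry e \<in> ochains X i"
    using rel_acyclicD[OF assms(2) d(2)] bdry_diff_bdry[OF assms(1) c d(1)] bc by metis
  have eZ: "e \<in> ochains Z (i + 1)"
    using ochains_mono[OF e(1) YZ] .
  have "c - bdry (d + e) = c - bdry d - bdry e"
    using bdry_add[OF assms(1) d(1) eZ] by (simp add: algebra_simps)
  then show "\<exists>d\<in>ochains Z (i + 1). c - bdry d \<in> ochains X i"
    using e(2) chains_add[OF d(1) eZ] by metis
qed

lemma ocycles_rel_acyclic:
  fixes k :: "'k::field itself"
  assumes "finite A" "rel_acyclic k X A"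
  shows "(ocycles A i :: ('a::order set \<Rightarrow> 'k) set) = {v + w | v w. v \<in> ocycles X i \<and> w \<in> obounds A i}"
proof (intro equalityI subsetI)
  fix z :: "'a set \<Rightarrow> 'k" assume "z \<in> ocycles A i"
  then have z: "z \<in> ochains A i" "bdry z = 0"
    by (auto simp: cycles_def)
  then obtain d where d: "d \<in> ochains A (i + 1)" "z - bdry d \<in> ochains X i"
    using rel_acyclicD[OF assms(2) z(1)] by (metis chains_zero)
  then have "z - bdry d \<in> ocycles X i"
    using bdry_diff_bdry[OF assms(1) z(1) d(1)] z(2) by (simp add: cycles_def)
  moreover have "z = (z - bdry d) + bdry d" by simp
  ultimately show "z \<in> {v + w | v w. v \<in> ocycles X i \<and> w \<in> obounds A i}"
    using bdry_in_obounds[OF d(1)] by blast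
next
  have XA: "X \<subseteq> A"
    using assms(2) by (simp add: rel_acyclic_def)
  show "z \<in> ocycles A i" if "z \<in> {v + w | v w. v \<in> ocycles X i \<and> w \<in> obounds A i}"
    for z :: "'a set \<Rightarrow> 'k"
    using that
      fun_space.subspace_sums_subset[OF ocycles_subspace ocycles_mono[OF XA] obounds_subset_ocycles]
      assms(1)
    by blast
qed

lemma obounds_rel_acyclic:
  fixes k :: "'k::field itself"
  assumes "finite A" "rel_acyclic k X A"
  shows "(obounds X i :: ('a::order set \<Rightarrow> 'k) set) = ocycles X i \<inter> obounds A i"
proof (intro equalityI subsetI)
  fix z :: "'a set \<Rightarrow> 'k" assume "z \<in> obounds X i"
  moreover have "X \<subseteq> A" "finite X"
    using assms finite_subset by (auto simp: rel_acyclic_def)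
  ultimately show "z \<in> ocycles X i \<inter> obounds A i"
    using obounds_subset_ocycles[of X i] obounds_mono[of X A i] by blast
next
  fix z :: "'a set \<Rightarrow> 'k" assume "z \<in> ocycles X i \<inter> obounds A i"
  then obtain d where z: "z \<in> ochains X i" and d: "d \<in> ochains A (i + 1)" "bdry d = z"
    by (auto simp: cycles_def boundaries_def)
  then obtain e where e: "e \<in> ochains A (i + 1 + 1)" "d - bdry e \<in> ochains X (i + 1)"
    using rel_acyclicD[OF assms(2) d(1)] by auto
  then show "z \<in> obounds X i"
    using bdry_in_obounds[OF e(2)] bdry_diff_bdry[OF assms(1) d(1) e(1)] d(2) by simp
qed

lemma acyclic_over_iff_rel_acyclic:
  fixes k :: "'k::field itself"
  assumes "finite A" "rel_acyclic k X A"
  shows "acyclic_over k X \<longleftrightarrow> acyclic_over k A"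
proof -
  have XA: "X \<subseteq> A"
    using assms(2) by (simp add: rel_acyclic_def)
  show ?thesis
  proof
    assume X: "acyclic_over k X"
    have "{v + w | v w. v \<in> ocycles X i \<and> w \<in> obounds A i} \<subseteq> (obounds A i :: ('a set \<Rightarrow> 'k) set)"
      for i
      using X obounds_mono[OF XA] unfolding acyclic_over_def
      by (intro fun_space.subspace_sums_subset obounds_subspace assms(1)) blast+
    then show "acyclic_over k A"
      unfolding acyclic_over_def ocycles_rel_acyclic[OF assms] by blast
  next
    assume "acyclic_over k A"
    then show "acyclic_over k X"
      using ocycles_mono[OF XA, where 'k='k]
      unfolding acyclic_over_def obounds_rel_acyclic[OF assms] by blast
  qed
qed

lemma comparables_Int: "comparables (A \<inter> X) q = comparables A q \<inter> X"
  by (auto simp: comparables_def)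

lemma replace_link:
  assumes "finite A" "q \<in> A" "c \<in> ochains A i" "v \<in> ochains (comparables A q) i"
  obtains d c' where "d \<in> ochains A (i + 1)" "c' \<in> ochains (A - {q}) i"
    and "c - bdry d = cone q (link q c - bdry v) + c'"
proof
  show "- cone q v \<in> ochains A (i + 1)"
    by (rule chains_minus[OF cone_in_ochains[OF assms(2,4)]])
  show "deletion q c + v \<in> ochains (A - {q}) i"
    by (intro chains_add deletion_in_ochains ochains_mono[OF assms(4)] assms(3) comparables_subset)
  have "c - bdry (- cone q v) = (cone q (link q c) + deletion q c) + (v - cone q (bdry v))"
    using bdry_minus[OF assms(1) cone_in_ochains[OF assms(2,4)]] bdry_cone[OF assms(1,2,4)]
    by (simp add: cone_link_deletion)
  also have "\<dots> = cone q (link q c - bdry v) + (deletion q c + v)"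
    using cone_add[of q "link q c" "- bdry v"] by (simp add: cone_minus)
  finally show "c - bdry (- cone q v) = cone q (link q c - bdry v) + (deletion q c + v)" .
qed

lemma push_off_vertex:
  assumes "finite A" "q \<in> A" "c \<in> ochains A i" "link q c \<in> obounds (comparables A q) (i - 1)"
  obtains d where "d \<in> ochains A (i + 1)" "c - bdry d \<in> ochains (A - {q}) i"
proof -
  obtain v where v: "v \<in> ochains (comparables A q) i" "bdry v = link q c"
    using assms(4) by (auto simp: obounds_iff)
  obtain d c' where "d \<in> ochains A (i + 1)" "c' \<in> ochains (A - {q}) i" "c - bdry d = c'"
    using replace_link[OF assms(1-3) v(1)] v(2) by auto
  then show thesis
    using that by blast
qed

lemma link_in_ocycles:
  assumes "finite A" "c \<in> ochains A i" "bdry c \<in> ochains (A - {q}) j"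
  shows "link q c \<in> ocycles (comparables A q) (i - 1)"
  using link_in_ochains[OF assms(2)] bdry_link_eq_0[OF assms] by (simp add: cycles_def)

lemma rel_acyclic_remove:
  fixes k :: "'k::field itself"
  assumes "finite A" "q \<in> A" "acyclic_over k (comparables A q)"
  shows "rel_acyclic k (A - {q}) A"
  unfolding rel_acyclic_def
proof (intro conjI allI ballI impI)
  fix i and c :: "'a set \<Rightarrow> 'k"
  assume c: "c \<in> ochains A i" and "bdry c \<in> ochains (A - {q}) (i - 1)"
  then have "link q c \<in> obounds (comparables A q) (i - 1)"
    using assms(3) link_in_ocycles[OF assms(1) c] unfolding acyclic_over_def by blast
  then show "\<exists>d\<in>ochains A (i + 1). c - bdry d \<in> ochains (A - {q}) i"
    using push_off_vertex[OF assms(1,2) c] by metis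
qed auto

lemma bdry_summand_in_ochains:
  assumes "finite A" "B \<subseteq> A" and c: "c \<in> ochains A i" "bdry c \<in> ochains (A \<inter> X) (i - 1)"
    and d: "d \<in> ochains A (i + 1)" and x: "x \<in> ochains (A \<inter> X) i" and c': "c' \<in> ochains B i"
    and split: "c - bdry d = x + c'"
  shows "bdry c' \<in> ochains (B \<inter> X) (i - 1)"
proof -
  have "bdry c = bdry x + bdry c'"
    using bdry_add[OF assms(1) ochains_mono[OF x] ochains_mono[OF c' assms(2)]]
    by (simp add: bdry_diff_bdry[OF assms(1) c(1) d, symmetric] split)
  then have "bdry c' = bdry c - bdry x" by simp
  also have "\<dots> \<in> ochains (A \<inter> X) (i - 1)"
    by (intro chains_diff c(2) bdry_in_ochains x) (use assms(1) in simp)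
  finally have "bdry c' \<in> ochains (B \<inter> (A \<inter> X)) (i - 1)"
    by (rule ochains_Int[OF bdry_in_ochains[OF finite_subset[OF assms(2,1)] c']])
  then show ?thesis
    by (rule ochains_mono) auto
qed

lemma rel_acyclic_insert:
  fixes k :: "'k::field itself"
  assumes "finite A" "q \<in> A" "q \<in> X"
    and link: "rel_acyclic k (comparables A q \<inter> X) (comparables A q)"
    and rest: "rel_acyclic k ((A - {q}) \<inter> X) (A - {q})"
  shows "rel_acyclic k (A \<inter> X) A"
  unfolding rel_acyclic_def
proof (intro conjI allI ballI impI)
  fix i and c :: "'a set \<Rightarrow> 'k"
  assume c: "c \<in> ochains A i" and bc: "bdry c \<in> ochains (A \<inter> X) (i - 1)"
  have "bdry (link q c) = link q (- bdry c)"
    using link_bdry[OF assms(1) c] by (simp add: link_minus)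
  also have "\<dots> \<in> ochains (comparables A q \<inter> X) (i - 1 - 1)"
    unfolding comparables_Int[symmetric] by (intro link_in_ochains chains_minus bc)
  finally obtain v where v: "v \<in> ochains (comparables A q) i"
      "link q c - bdry v \<in> ochains (comparables A q \<inter> X) (i - 1)"
    using rel_acyclicD[OF link link_in_ochains[OF c]] by auto
  define x where "x = cone q (link q c - bdry v)"
  obtain d c' where d: "d \<in> ochains A (i + 1)" and c': "c' \<in> ochains (A - {q}) i"
    and split: "c - bdry d = x + c'"
    using replace_link[OF assms(1,2) c v(1)] unfolding x_def .
  have x: "x \<in> ochains (A \<inter> X) i"
    using cone_in_ochains[of q "A \<inter> X" _ "i - 1"] v(2) assms(2,3)
    by (simp add: x_def comparables_Int)
  have "bdry c' \<in> ochains ((A - {q}) \<inter> X) (i - 1)"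
    by (rule bdry_summand_in_ochains[OF assms(1) _ c bc d x c' split]) auto
  then obtain e where e: "e \<in> ochains (A - {q}) (i + 1)" "c' - bdry e \<in> ochains ((A - {q}) \<inter> X) i"
    using rel_acyclicD[OF rest c'] by metis
  have eA: "e \<in> ochains A (i + 1)"
    by (rule ochains_mono[OF e(1)]) auto
  have "c - bdry (d + e) = x + (c' - bdry e)"
    using bdry_add[OF assms(1) d eA] split by (simp add: algebra_simps)
  also have "\<dots> \<in> ochains (A \<inter> X) i"
    by (intro chains_add x ochains_mono[OF e(2)]) auto
  finally show "\<exists>d\<in>ochains A (i + 1). c - bdry d \<in> ochains (A \<inter> X) i"
    using chains_add[OF d eA] by blast
qed auto

lemma rel_acyclic_step:
  fixes k :: "'k::field itself"
  assumes "finite A" "q \<in> A"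
    and link: "rel_acyclic k (comparables A q \<inter> X) (comparables A q)"
    and rest: "rel_acyclic k ((A - {q}) \<inter> X) (A - {q})"
    and fiber: "q \<notin> X \<Longrightarrow> acyclic_over k (comparables A q \<inter> X)"
  shows "rel_acyclic k (A \<inter> X) A"
proof (cases "q \<in> X")
  case True
  show ?thesis
    by (rule rel_acyclic_insert[OF assms(1,2) True link rest])
next
  case False
  have "acyclic_over k (comparables A q)"
    using acyclic_over_iff_rel_acyclic[OF finite_comparables[OF assms(1)] link] fiber[OF False]
    by blast
  then have "rel_acyclic k (A - {q}) A"
    by (rule rel_acyclic_remove[OF assms(1,2)])
  moreover have "(A - {q}) \<inter> X = A \<inter> X"
    using False by auto
  ultimately show ?thesis
    using rel_acyclic_trans[OF assms(1) rest] by simp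
qed

lemma ex_max_if_finite: "finite A \<Longrightarrow> A \<noteq> {} \<Longrightarrow> \<exists>m\<in>A. \<not> (\<exists>x\<in>A. m < x)"
  for A :: "'a::order set"
  using finite_has_maximal[of A] by (metis less_le)

lemma rel_acyclic_if_fibers_acyclic:
  fixes k :: "'k::field itself"
  assumes "finite A" and R: "R = (<) \<or> R = (>)"
    and "\<And>y. y \<in> A - X \<Longrightarrow> acyclic_over k {x \<in> A \<inter> X. R x y}"
  shows "rel_acyclic k (A \<inter> X) A"
  using assms(1,3)
proof (induction A rule: finite_psubset_induct)
  case (psubset A)
  show ?case
  proof (cases "A = {}")
    case True
    then show ?thesis
      using rel_acyclic_refl[of k "{}"] by simp
  next
    case False
    then obtain q where q: "q \<in> A" "\<And>x. x \<in> A \<Longrightarrow> \<not> R q x"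
      using R ex_max_if_finite[OF psubset.hyps] ex_min_if_finite[OF psubset.hyps] by metis
    have comparables: "comparables A q = {x \<in> A. R x q}"
      using R q by (auto simp: comparables_def)
    have IH: "rel_acyclic k (B \<inter> X) B"
      if "B \<subset> A" "\<And>x y. y \<in> B \<Longrightarrow> x \<in> A \<Longrightarrow> R x y \<Longrightarrow> x \<in> B" for B
    proof (rule psubset.IH[OF that(1)])
      fix y assume y: "y \<in> B - X"
      then have "{x \<in> B \<inter> X. R x y} = {x \<in> A \<inter> X. R x y}"
        using that by blast
      then show "acyclic_over k {x \<in> B \<inter> X. R x y}"
        using psubset.prems[of y] y that(1) by auto
    qed
    show ?thesis
    proof (rule rel_acyclic_step[OF psubset.hyps q(1)])
      show "rel_acyclic k (comparables A q \<inter> X) (comparables A q)"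
        by (rule IH) (use R q(1) in \<open>auto simp: comparables\<close>)
      show "rel_acyclic k ((A - {q}) \<inter> X) (A - {q})"
        by (rule IH) (use q in auto)
      assume "q \<notin> X"
      moreover have "comparables A q \<inter> X = {x \<in> A \<inter> X. R x q}"
        by (auto simp: comparables)
      ultimately show "acyclic_over k (comparables A q \<inter> X)"
        using psubset.prems[of q] q(1) by simp
    qed
  qed
qed

lemmas rel_acyclic_if_lower_fibers_acyclic = rel_acyclic_if_fibers_acyclic[OF _ disjI1[OF refl]]
  and rel_acyclic_if_upper_fibers_acyclic = rel_acyclic_if_fibers_acyclic[OF _ disjI2[OF refl]]

lemma acyclic_over_if_comparable_to_all:
  fixes k :: "'k::field itself"
  assumes "finite A" "q \<in> A" "\<And>x. x \<in> A \<Longrightarrow> x \<le> q \<or> q \<le> x"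
  shows "acyclic_over k A"
  unfolding acyclic_over_def
proof (intro allI subsetI)
  fix i and z :: "'a set \<Rightarrow> 'k"
  assume "z \<in> ocycles A i"
  then have z: "z \<in> ochains A i" "bdry z = 0"
    by (auto simp: cycles_def)
  have "comparables A q = A - {q}"
    using assms(3) by (auto simp: comparables_def order_le_less)
  then have del: "deletion q z \<in> ochains (comparables A q) i"
    using deletion_in_ochains[OF z(1), of q] by simp
  have "bdry (deletion q z) = - link q z"
    using bdry_decompose_if_bdry_avoids[OF assms(1,2) z(1)] z(2)
    by (simp add: eq_neg_iff_add_eq_0 add.commute)
  then have "bdry (cone q (deletion q z)) = z"
    using cone_link_deletion[of q z]
    by (simp add: bdry_cone[OF assms(1,2) del] cone_minus add.commute)
  then show "z \<in> obounds A i"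
    using bdry_in_obounds[OF cone_in_ochains[OF assms(2) del]] by simp
qed

section \<open>Isomorphism invariance\<close>

definition pull :: "'b set \<Rightarrow> ('b \<Rightarrow> 'a) \<Rightarrow> ('a set \<Rightarrow> 'k::zero) \<Rightarrow> 'b set \<Rightarrow> 'k" where
  "pull B e c \<sigma> = (if \<sigma> \<subseteq> B then c (e ` \<sigma>) else 0)"

lemma poset_isoD:
  assumes "poset_iso B A e"
  shows "inj_on e B" "e ` B = A" "\<And>x y. x \<in> B \<Longrightarrow> y \<in> B \<Longrightarrow> e x \<le> e y \<longleftrightarrow> x \<le> y"
    "\<And>x y. x \<in> B \<Longrightarrow> y \<in> B \<Longrightarrow> e x < e y \<longleftrightarrow> x < y"
  using assms by (auto simp: poset_iso_def bij_betw_def less_le_not_le)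

lemma poset_iso_inv:
  assumes "poset_iso B A e"
  shows "poset_iso A B (inv_into B e)"
  unfolding poset_iso_def
proof (intro conjI ballI)
  show "bij_betw (inv_into B e) A B"
    using assms by (simp add: poset_iso_def bij_betw_inv_into)
  fix x y assume "x \<in> A" "y \<in> A"
  then show "x \<le> y \<longleftrightarrow> inv_into B e x \<le> inv_into B e y"
    using poset_isoD[OF assms] by (metis f_inv_into_f inv_into_into)
qed

lemma poset_iso_comp:
  assumes "poset_iso A B e" "poset_iso B C h"
  shows "poset_iso A C (h \<circ> e)"
  using assms unfolding poset_iso_def by (auto intro: bij_betw_trans dest: bij_betwE)

lemma poset_isomorphic_sym: "poset_isomorphic A B \<Longrightarrow> poset_isomorphic B A"
  unfolding poset_isomorphic_def using poset_iso_inv by blast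

lemma poset_isomorphic_trans: "poset_isomorphic A B \<Longrightarrow> poset_isomorphic B C \<Longrightarrow> poset_isomorphic A C"
  unfolding poset_isomorphic_def using poset_iso_comp by blast

lemma poset_iso_subset:
  assumes "poset_iso B A e" "C \<subseteq> B"
  shows "poset_iso C (e ` C) e"
  using assms by (auto simp: poset_iso_def intro: bij_betw_subset)

lemma finite_poset_iso: "poset_iso B A e \<Longrightarrow> finite B \<longleftrightarrow> finite A"
  using bij_betw_finite by (auto simp: poset_iso_def)

lemma finite_poset_isomorphic: "poset_isomorphic B A \<Longrightarrow> finite B \<longleftrightarrow> finite A"
  using finite_poset_iso by (auto simp: poset_isomorphic_def)

lemma pull_linear:
  "pull B e (c + d) = pull B e c + pull B e d"
  "pull B e (a *\<^sub>F c) = a *\<^sub>F pull B e c"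
  "pull B e 0 = (0 :: _ \<Rightarrow> 'k::field)"
  for c d :: "'a set \<Rightarrow> 'k::field"
  by (auto simp: fun_eq_iff pull_def)

lemma pull_inverse:
  assumes "e ` B \<subseteq> A" "\<And>x. x \<in> B \<Longrightarrow> h (e x) = x" "c \<in> ochains B i"
  shows "pull B e (pull A h c) = c"
proof
  fix \<sigma>
  show "pull B e (pull A h c) \<sigma> = c \<sigma>"
  proof (cases "\<sigma> \<subseteq> B")
    case True
    then have "h ` e ` \<sigma> = \<sigma>" "e ` \<sigma> \<subseteq> A"
      using assms(1,2) by (force simp: image_image)+
    then show ?thesis
      using True by (simp add: pull_def)
  next
    case False
    then show ?thesis
      using ochains_face_subset[OF assms(3), of \<sigma>] by (auto simp: pull_def)
  qed
qed

lemma image_in_order_complex: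
  assumes "poset_iso B A e" "\<sigma> \<subseteq> B" "e ` \<sigma> \<in> order_complex A"
  shows "\<sigma> \<in> order_complex B" "card (e ` \<sigma>) = card \<sigma>"
proof -
  have inj: "inj_on e \<sigma>"
    using poset_isoD(1)[OF assms(1)] assms(2) by (rule inj_on_subset)
  then show "card (e ` \<sigma>) = card \<sigma>"
    by (rule card_image)
  have "x \<le> y \<or> y \<le> x" if "x \<in> \<sigma>" "y \<in> \<sigma>" for x y
    using assms(2,3) that poset_isoD(3)[OF assms(1)] unfolding order_complex_iff
    by (metis imageI subsetD)
  then show "\<sigma> \<in> order_complex B"
    using assms(2,3) finite_imageD[OF _ inj] by (simp add: order_complex_iff)
qed

lemma pull_in_ochains:
  assumes "poset_iso B A e" "c \<in> ochains A i"
  shows "pull B e c \<in> ochains B i"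
proof (rule chainsI)
  fix \<sigma> assume "pull B e c \<sigma> \<noteq> 0"
  then have "\<sigma> \<subseteq> B" "c (e ` \<sigma>) \<noteq> 0"
    by (auto simp: pull_def split: if_splits)
  then show "\<sigma> \<in> order_complex B \<and> int (card \<sigma>) = i + 1"
    using image_in_order_complex[OF assms(1)] chainsD[OF assms(2)] by metis
qed

lemma link_pull:
  assumes "poset_iso B A e" "x \<in> B"
  shows "link x (pull B e c) = pull B e (link (e x) (c :: 'a::order set \<Rightarrow> 'k::field))"
proof
  fix \<tau>
  note iso = poset_isoD[OF assms(1)]
  show "link x (pull B e c) \<tau> = pull B e (link (e x) c) \<tau>"
  proof (cases "\<tau> \<subseteq> B")
    case True
    then have "{y \<in> e ` \<tau>. y < e x} = e ` {y \<in> \<tau>. y < x}"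
      using iso(4) assms(2) by auto
    moreover have "inj_on e {y \<in> \<tau>. y < x}"
      by (rule inj_on_subset[OF iso(1)]) (use True in auto)
    ultimately have "face_sign (e x) (e ` \<tau>) = (face_sign x \<tau> :: 'k)"
      by (simp add: face_sign_def card_image)
    then show ?thesis
      using True assms(2) inj_on_image_mem_iff[OF iso(1) assms(2) True]
      by (simp add: link_def pull_def)
  qed (simp add: link_def pull_def)
qed

lemma bdry_pull:
  assumes "finite B" "poset_iso B A e" "c \<in> ochains A i"
  shows "bdry (pull B e c) = pull B e (bdry c)"
proof
  fix \<tau>
  note iso = poset_isoD[OF assms(2)]
  have A: "finite A"
    using iso(2) assms(1) by blast
  have "bdry (pull B e c) = (\<Sum>x\<in>B. pull B e (link (e x) c))"
    unfolding bdry_eq_sum_links[OF assms(1) pull_in_ochains[OF assms(2,3)]]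
    by (rule sum.cong[OF refl]) (rule link_pull[OF assms(2)])
  then show "bdry (pull B e c) \<tau> = pull B e (bdry c) \<tau>"
    unfolding bdry_eq_sum_links[OF A assms(3)] iso(2)[symmetric] sum.reindex[OF iso(1)]
    by (simp add: pull_def sum_fun_apply)
qed

lemma pull_in_ocycles:
  assumes "finite B" "poset_iso B A e" "c \<in> ocycles A i"
  shows "pull B e c \<in> ocycles B i"
  using assms(3) pull_in_ochains[OF assms(2), of c i] bdry_pull[OF assms(1,2), of c i]
  by (simp add: cycles_def pull_linear(3))

lemma pull_in_obounds:
  assumes "finite B" "poset_iso B A e" "c \<in> obounds A i"
  shows "pull B e c \<in> obounds B i"
proof -
  obtain d where "d \<in> ochains A (i + 1)" "c = bdry d"
    using assms(3) by (auto simp: boundaries_def)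
  then show ?thesis
    using bdry_in_obounds[OF pull_in_ochains[OF assms(2)]] bdry_pull[OF assms(1,2)] by metis
qed

lemma inj_on_pull:
  assumes "poset_iso B A e"
  shows "inj_on (pull B e) (ochains A i)"
proof (rule inj_on_inverseI)
  fix c assume "c \<in> ochains A i"
  then show "pull A (inv_into B e) (pull B e c) = c"
    using poset_isoD(2)[OF assms] by (intro pull_inverse) (auto intro: inv_into_into f_inv_into_f)
qed

lemma pull_image:
  fixes A :: "'a::order set" and B :: "'b::order set" and e
  assumes "finite B" "poset_iso B A e"
  shows "pull B e ` ocycles A i = (ocycles B i :: ('b set \<Rightarrow> 'k::field) set)"
    and "pull B e ` obounds A i = (obounds B i :: ('b set \<Rightarrow> 'k) set)"
proof -
  have A: "finite A"
    using finite_poset_iso[OF assms(2)] assms(1) by blast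
  note inv = poset_iso_inv[OF assms(2)]
  have pull_pull: "pull B e (pull A (inv_into B e) c) = c" if "c \<in> ocycles B i"
    for c :: "'b set \<Rightarrow> 'k"
    using that ocycles_subset_ochains poset_isoD(1,2)[OF assms(2)]
    by (intro pull_inverse[of _ _ _ _ _ i]) auto
  show "pull B e ` ocycles A i = (ocycles B i :: ('b set \<Rightarrow> 'k) set)"
    using pull_in_ocycles[OF assms] pull_in_ocycles[OF A inv] pull_pull
    unfolding set_eq_iff image_iff by metis
  show "pull B e ` obounds A i = (obounds B i :: ('b set \<Rightarrow> 'k) set)"
    using pull_in_obounds[OF assms] pull_in_obounds[OF A inv] pull_pull
      obounds_subset_ocycles[OF assms(1)] unfolding set_eq_iff image_iff subset_iff by metis
qed

lemma acyclic_over_iso: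
  fixes k :: "'k::field itself"
  assumes "finite B" "poset_iso B A e" "acyclic_over k A"
  shows "acyclic_over k B"
  using assms(3) unfolding acyclic_over_def pull_image[OF assms(1,2), symmetric] by blast

section \<open>Dimension of homology\<close>

definition rel_basis :: "('b \<Rightarrow> 'k::field) set \<Rightarrow> ('b \<Rightarrow> 'k) set \<Rightarrow> ('b \<Rightarrow> 'k) set \<Rightarrow> bool" where
  "rel_basis V W b \<longleftrightarrow> finite b \<and> b \<subseteq> V \<and>
     (\<forall>v\<in>V. \<exists>!u. (\<forall>x. x \<notin> b \<longrightarrow> u x = 0) \<and> v - lincomb u b \<in> W)"

definition finite_dim :: "('b \<Rightarrow> 'k::field) set \<Rightarrow> bool" where
  "finite_dim V \<longleftrightarrow> (\<exists>F. finite F \<and> V \<subseteq> fun_space.span F)"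

lemma finite_dim_subset: "finite_dim V \<Longrightarrow> W \<subseteq> V \<Longrightarrow> finite_dim W"
  unfolding finite_dim_def by blast

lemma finite_dim_independent:
  assumes "finite_dim V" "B \<subseteq> V" "fun_space.independent B"
  shows "finite B"
  using assms fun_space.independent_span_bound unfolding finite_dim_def by blast

lemma finite_dim_basis:
  assumes "fun_space.subspace W" "finite_dim W"
  obtains \<beta> where "finite \<beta>" "fun_space.independent \<beta>" "fun_space.span \<beta> = W"
      "card \<beta> = fun_space.dim W"
proof -
  obtain \<beta> where \<beta>: "\<beta> \<subseteq> W" "fun_space.independent \<beta>" "W \<subseteq> fun_space.span \<beta>"
      "card \<beta> = fun_space.dim W"
    using fun_space.basis_exists[of W] by blast
  then have "fun_space.span \<beta> = W"
    using fun_space.span_minimal[OF \<beta>(1) assms(1)] by blast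
  then show thesis
    using that \<beta> finite_dim_independent[OF assms(2)] by blast
qed

lemma lincomb_eq: "lincomb u b = (\<Sum>x\<in>b. u x *\<^sub>F x)"
  by (simp add: lincomb_def fun_eq_iff sum_fun_apply)

lemma lincomb_in_subspace: "fun_space.subspace V \<Longrightarrow> b \<subseteq> V \<Longrightarrow> lincomb u b \<in> V"
  unfolding lincomb_eq by (intro fun_space.subspace_sum fun_space.subspace_scale) auto

lemma lincomb_diff: "lincomb (\<lambda>x. u x - v x) b = lincomb u b - lincomb v b"
  by (simp add: lincomb_def fun_eq_iff left_diff_distrib sum_subtractf)

lemma lincomb_cong: "(\<And>x. x \<in> b \<Longrightarrow> u x = v x) \<Longrightarrow> lincomb u b = lincomb v b"
  by (simp add: lincomb_eq)

lemma lincomb_Un: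
  assumes "finite b" "finite \<beta>" "b \<inter> \<beta> = {}"
  shows "lincomb u (b \<union> \<beta>) = lincomb u b + lincomb u \<beta>"
  unfolding lincomb_eq using assms by (rule sum.union_disjoint)

lemma lincomb_singleton: "lincomb u {x} = u x *\<^sub>F x"
  by (simp add: lincomb_eq)

lemma lincomb_single:
  assumes "finite b" "x \<in> b"
  shows "lincomb (\<lambda>y. if y = x then 1 else 0) b = x"
proof -
  have "lincomb (\<lambda>y. if y = x then 1 else 0) b = (\<Sum>y\<in>b. if y = x then x else 0)"
    unfolding lincomb_eq by (intro sum.cong) auto
  also have "\<dots> = x"
    using assms by simp
  finally show ?thesis .
qed

lemma span_eq_lincombs:
  assumes "finite b" "v \<in> fun_space.span b"
  obtains u where "v = lincomb u b"
  using assms unfolding fun_space.span_finite[OF assms(1)] lincomb_eq by blast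

lemma independent_lincomb_eq_0:
  assumes "fun_space.independent b" "finite b" "lincomb u b = 0" "x \<in> b"
  shows "u x = 0"
  using fun_space.independentD[OF assms(1,2) subset_refl _ assms(4)] assms(3)
  by (simp add: lincomb_eq)

lemma rel_basis_lincomb_eq_0:
  assumes "fun_space.subspace V" "fun_space.subspace W" "rel_basis V W b" "lincomb u b \<in> W" "x \<in> b"
  shows "u x = 0"
proof -
  define u' where "u' = (\<lambda>y. if y \<in> b then u y else 0)"
  have "\<exists>!u. (\<forall>x. x \<notin> b \<longrightarrow> u x = 0) \<and> 0 - lincomb u b \<in> W"
    using assms(3) fun_space.subspace_0[OF assms(1)] unfolding rel_basis_def by blast
  moreover have "0 - lincomb u' b \<in> W"
    using fun_space.subspace_neg[OF assms(2,4)] lincomb_cong[of b u' u] by (simp add: u'_def)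
  moreover have "0 - lincomb (\<lambda>_. 0) b \<in> W"
    using fun_space.subspace_0[OF assms(2)] by (simp add: lincomb_eq)
  ultimately have "u' = (\<lambda>_. 0)"
    by (auto simp: u'_def)
  then show ?thesis
    using assms(5) by (metis u'_def)
qed

lemma rel_basis_span:
  assumes "rel_basis V W b" "W \<subseteq> fun_space.span \<beta>"
  shows "V \<subseteq> fun_space.span (b \<union> \<beta>)"
proof
  fix v assume "v \<in> V"
  then obtain u where "v - lincomb u b \<in> W"
    using assms(1) unfolding rel_basis_def by blast
  then have "v - lincomb u b \<in> fun_space.span (b \<union> \<beta>)"
    using assms(2) fun_space.span_mono[of \<beta> "b \<union> \<beta>"] by blast
  moreover have "lincomb u b \<in> fun_space.span (b \<union> \<beta>)"
    by (rule lincomb_in_subspace[OF fun_space.subspace_span]) (use fun_space.span_superset in blast)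
  ultimately show "v \<in> fun_space.span (b \<union> \<beta>)"
    using fun_space.span_add by fastforce
qed

lemma rel_basis_disjoint:
  assumes "fun_space.subspace V" "fun_space.subspace W" "rel_basis V W b"
  shows "b \<inter> W = {}"
proof (rule equals0I)
  fix x assume x: "x \<in> b \<inter> W"
  then have "lincomb (\<lambda>y. if y = x then 1 else 0) b \<in> W"
    using assms(3) by (simp add: lincomb_single rel_basis_def)
  then show False
    using rel_basis_lincomb_eq_0[OF assms] x by fastforce
qed

lemma rel_basis_Un_independent:
  assumes V: "fun_space.subspace V" and W: "fun_space.subspace W" and b: "rel_basis V W b"
    and \<beta>: "finite \<beta>" "fun_space.independent \<beta>" "\<beta> \<subseteq> W"
  shows "fun_space.independent (b \<union> \<beta>)"
proof (rule fun_space.independent_if_scalars_zero)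
  have fb: "finite b"
    using b by (simp add: rel_basis_def)
  then show "finite (b \<union> \<beta>)"
    using \<beta>(1) by simp
  fix u x assume zero: "(\<Sum>x\<in>b \<union> \<beta>. u x *\<^sub>F x) = 0" and x: "x \<in> b \<union> \<beta>"
  have "b \<inter> \<beta> = {}"
    using rel_basis_disjoint[OF V W b] \<beta>(3) by blast
  then have sum: "lincomb u b + lincomb u \<beta> = 0"
    using zero lincomb_Un[OF fb \<beta>(1)] by (simp only: lincomb_eq)
  have "- lincomb u \<beta> \<in> W"
    by (intro fun_space.subspace_neg W lincomb_in_subspace \<beta>(3))
  then have "lincomb u b \<in> W"
    using sum by (simp only: eq_neg_iff_add_eq_0[symmetric])
  then have ub: "u y = 0" if "y \<in> b" for y
    using rel_basis_lincomb_eq_0[OF V W b _ that] by blast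
  then have "lincomb u \<beta> = 0"
    using sum lincomb_cong[of b u "\<lambda>_. 0"] by (simp add: lincomb_eq)
  then show "u x = 0"
    using x ub independent_lincomb_eq_0[OF \<beta>(2,1)] by blast
qed

lemma rel_basis_if_independent:
  assumes fin: "finite b" "finite \<beta>" and disj: "b \<inter> \<beta> = {}"
    and ind: "fun_space.independent (b \<union> \<beta>)" and V: "b \<subseteq> V" "V \<subseteq> fun_space.span (b \<union> \<beta>)"
  shows "rel_basis V (fun_space.span \<beta>) b"
  unfolding rel_basis_def
proof (intro conjI ballI ex_ex1I fin(1) V(1))
  have lincomb_in_span: "lincomb a \<beta> \<in> fun_space.span \<beta>" for a
    by (rule lincomb_in_subspace[OF fun_space.subspace_span fun_space.span_superset])
  fix v assume "v \<in> V"
  then obtain a where "v = lincomb a (b \<union> \<beta>)"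
    using span_eq_lincombs[of "b \<union> \<beta>" v] fin V(2) by blast
  then have "v - lincomb (\<lambda>x. if x \<in> b then a x else 0) b = lincomb a \<beta>"
    using lincomb_Un[OF fin disj, of a] lincomb_cong[of b "\<lambda>x. if x \<in> b then a x else 0" a] by simp
  then show "\<exists>u. (\<forall>x. x \<notin> b \<longrightarrow> u x = 0) \<and> v - lincomb u b \<in> fun_space.span \<beta>"
    using lincomb_in_span by (intro exI[of _ "\<lambda>x. if x \<in> b then a x else 0"]) auto
next
  fix v u u'
  assume u: "(\<forall>x. x \<notin> b \<longrightarrow> u x = 0) \<and> v - lincomb u b \<in> fun_space.span \<beta>"
    and u': "(\<forall>x. x \<notin> b \<longrightarrow> u' x = 0) \<and> v - lincomb u' b \<in> fun_space.span \<beta>"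
  have "(v - lincomb u' b) - (v - lincomb u b) \<in> fun_space.span \<beta>"
    by (rule fun_space.span_diff[OF conjunct2[OF u'] conjunct2[OF u]])
  then obtain a where a: "lincomb (\<lambda>x. u x - u' x) b = lincomb a \<beta>"
    using span_eq_lincombs[OF fin(2)] by (auto simp: lincomb_diff)
  define c where "c = (\<lambda>x. if x \<in> b then u x - u' x else - a x)"
  have "lincomb c \<beta> = - lincomb a \<beta>"
    using disj unfolding lincomb_eq sum_negf[symmetric] by (intro sum.cong) (auto simp: c_def)
  then have "lincomb c (b \<union> \<beta>) = 0"
    using a lincomb_cong[of b c "\<lambda>x. u x - u' x"] by (simp add: lincomb_Un[OF fin disj] c_def)
  then have "c x = 0" if "x \<in> b" for x
    using independent_lincomb_eq_0[OF ind] fin that by simp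
  then have "u x = u' x" for x
    using u u' by (cases "x \<in> b") (auto simp: c_def)
  then show "u = u'" ..
qed

lemma rel_basis_dim:
  assumes V: "fun_space.subspace V" and W: "fun_space.subspace W" "W \<subseteq> V" "finite_dim W"
    and b: "rel_basis V W b"
  shows "fun_space.dim V = fun_space.dim W + card b"
proof -
  obtain \<beta> where \<beta>: "finite \<beta>" "fun_space.independent \<beta>" "fun_space.span \<beta> = W"
      "card \<beta> = fun_space.dim W"
    using finite_dim_basis[OF W(1,3)] .
  have \<beta>W: "\<beta> \<subseteq> W"
    using \<beta>(3) fun_space.span_superset by blast
  have "b \<union> \<beta> \<subseteq> V"
    using b \<beta>W W(2) by (auto simp: rel_basis_def)
  then have "card (b \<union> \<beta>) = fun_space.dim V"
    by (intro fun_space.basis_card_eq_dim rel_basis_span[OF b]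
        rel_basis_Un_independent[OF V W(1) b \<beta>(1,2) \<beta>W]) (use \<beta>(3) in simp_all)
  moreover have "b \<inter> \<beta> = {}" "finite b"
    using rel_basis_disjoint[OF V W(1) b] \<beta>W b by (auto simp: rel_basis_def)
  ultimately show ?thesis
    using card_Un_disjoint[OF _ \<beta>(1)] \<beta>(4) by simp
qed

lemma rel_basis_exists:
  assumes V: "finite_dim V" and W: "fun_space.subspace W" "W \<subseteq> V"
  obtains b where "rel_basis V W b"
proof -
  obtain \<beta> where \<beta>: "finite \<beta>" "fun_space.independent \<beta>" "fun_space.span \<beta> = W"
    using finite_dim_basis[OF W(1) finite_dim_subset[OF V W(2)]] by blast
  have "\<beta> \<subseteq> V"
    using \<beta>(3) fun_space.span_superset W(2) by blast
  then obtain B where B: "\<beta> \<subseteq> B" "B \<subseteq> V" "fun_space.independent B" "V \<subseteq> fun_space.span B"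
    using fun_space.maximal_independent_subset_extend[OF _ \<beta>(2)] by metis
  have "B - \<beta> \<union> \<beta> = B"
    using B(1) by blast
  then have "rel_basis V (fun_space.span \<beta>) (B - \<beta>)"
    using B \<beta>(1) finite_dim_independent[OF V B(2,3)] by (intro rel_basis_if_independent) auto
  then show thesis
    using that \<beta>(3) by simp
qed

lemma dim_mono_subspace:
  assumes "fun_space.subspace V" "finite_dim V" "fun_space.subspace W" "W \<subseteq> V"
  shows "fun_space.dim W \<le> fun_space.dim V"
proof -
  obtain b where "rel_basis V W b"
    using rel_basis_exists[OF assms(2-4)] .
  then show ?thesis
    using rel_basis_dim[OF assms(1,3,4) finite_dim_subset[OF assms(2,4)]] by simp
qed

lemma subset_sums:
  fixes V W :: "'a::monoid_add set"
  shows "0 \<in> W \<Longrightarrow> V \<subseteq> {v + w | v w. v \<in> V \<and> w \<in> W}" "0 \<in> V \<Longrightarrow> W \<subseteq> {v + w | v w. v \<in> V \<and> w \<in> W}"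
  by (metis (mono_tags, lifting) add.right_neutral mem_Collect_eq subsetI)
    (metis (mono_tags, lifting) add.left_neutral mem_Collect_eq subsetI)

lemma rel_basis_sum:
  assumes V: "fun_space.subspace V" and W: "fun_space.subspace W" and b: "rel_basis V (V \<inter> W) b"
  shows "rel_basis {v + w | v w. v \<in> V \<and> w \<in> W} W b"
  unfolding rel_basis_def
proof (intro conjI ballI)
  have bV: "b \<subseteq> V"
    using b by (simp add: rel_basis_def)
  show "b \<subseteq> {v + w | v w. v \<in> V \<and> w \<in> W}"
    using bV subset_sums(1)[OF fun_space.subspace_0[OF W], of V] by (rule subset_trans)
  show "finite b"
    using b by (simp add: rel_basis_def)
  fix s assume "s \<in> {v + w | v w. v \<in> V \<and> w \<in> W}"
  then obtain v w where s: "s = v + w" "v \<in> V" "w \<in> W" by blast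
  have "s - lincomb u b \<in> W \<longleftrightarrow> v - lincomb u b \<in> V \<inter> W" for u
  proof -
    have "s - lincomb u b = (v - lincomb u b) + w" "v - lincomb u b = (s - lincomb u b) - w"
      by (simp_all add: s(1))
    moreover have "v - lincomb u b \<in> V"
      by (intro fun_space.subspace_diff[OF V] s(2) lincomb_in_subspace[OF V bV])
    ultimately show ?thesis
      using fun_space.subspace_add[OF W _ s(3)] fun_space.subspace_diff[OF W _ s(3)]
      by (metis Int_iff)
  qed
  then show "\<exists>!u. (\<forall>x. x \<notin> b \<longrightarrow> u x = 0) \<and> s - lincomb u b \<in> W"
    using b s(2) by (simp only: rel_basis_def)
qed

lemma dim_sum_Int:
  assumes V: "fun_space.subspace V" "finite_dim V" and W: "fun_space.subspace W" "finite_dim W"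
  shows "fun_space.dim {v + w | v w. v \<in> V \<and> w \<in> W} + fun_space.dim (V \<inter> W) =
    fun_space.dim V + fun_space.dim W"
proof -
  have Int: "fun_space.subspace (V \<inter> W)"
    using V(1) W(1) by (rule fun_space.subspace_inter)
  obtain b where b: "rel_basis V (V \<inter> W) b"
    using rel_basis_exists[OF V(2) Int] by blast
  have "W \<subseteq> {v + w | v w. v \<in> V \<and> w \<in> W}"
    by (rule subset_sums(2)[OF fun_space.subspace_0[OF V(1)]])
  then have "fun_space.dim {v + w | v w. v \<in> V \<and> w \<in> W} = fun_space.dim W + card b"
    by (rule rel_basis_dim[OF fun_space.subspace_sums[OF V(1) W(1)] W(1) _ W(2)
          rel_basis_sum[OF V(1) W(1) b]])
  moreover have "fun_space.dim V = fun_space.dim (V \<inter> W) + card b"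
    by (rule rel_basis_dim[OF V(1) Int _ finite_dim_subset[OF V(2)] b]) auto
  ultimately show ?thesis by simp
qed

lemma dim_linear_image:
  fixes T :: "('b \<Rightarrow> 'k::field) \<Rightarrow> 'c \<Rightarrow> 'k"
  assumes T: "Vector_Spaces.linear (*\<^sub>F) (*\<^sub>F) T" and V: "fun_space.subspace V"
    and inj: "inj_on T V"
  shows "fun_space.dim (T ` V) = fun_space.dim V"
proof -
  interpret pair: vector_space_pair "(*\<^sub>F) :: 'k \<Rightarrow> ('b \<Rightarrow> 'k) \<Rightarrow> _" "(*\<^sub>F) :: 'k \<Rightarrow> ('c \<Rightarrow> 'k) \<Rightarrow> _"
    by unfold_locales
  obtain B where B: "B \<subseteq> V" "fun_space.independent B" "V \<subseteq> fun_space.span B"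
      "card B = fun_space.dim V"
    using fun_space.basis_exists[of V] by blast
  have span: "fun_space.span B = V"
    using B(1,3) fun_space.span_minimal[OF B(1) V] by blast
  have "fun_space.independent (T ` B)"
    by (rule pair.linear_independent_injective_image[OF T B(2)]) (simp add: span inj)
  moreover have "T ` V \<subseteq> fun_space.span (T ` B)"
    using pair.linear_span_image[OF T, of B] span by simp
  ultimately have "card (T ` B) = fun_space.dim (T ` V)"
    using B(1) by (intro fun_space.basis_card_eq_dim) auto
  then show ?thesis
    using card_image[OF inj_on_subset[OF inj B(1)]] B(4) by simp
qed

abbreviation ohdim :: "'k::field itself \<Rightarrow> 'a::order set \<Rightarrow> int \<Rightarrow> nat" where
  "ohdim k A i \<equiv> hdim k (order_complex A) i"

lemma finite_dim_ochains:
  assumes "finite A"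
  shows "finite_dim (ochains A i :: ('a::order set \<Rightarrow> 'k::field) set)"
  unfolding finite_dim_def
proof (intro exI conjI subsetI)
  let ?d = "\<lambda>\<sigma> \<tau>. if \<tau> = \<sigma> then 1 else 0 :: 'k"
  show "finite (?d ` Pow A)"
    using assms by simp
  fix c :: "'a set \<Rightarrow> 'k" assume c: "c \<in> ochains A i"
  have "c = (\<Sum>\<sigma>\<in>Pow A. c \<sigma> *\<^sub>F ?d \<sigma>)"
  proof
    fix \<tau>
    have "(\<Sum>\<sigma>\<in>Pow A. c \<sigma> *\<^sub>F ?d \<sigma>) \<tau> = (\<Sum>\<sigma>\<in>Pow A. if \<sigma> = \<tau> then c \<tau> else 0)"
      unfolding sum_fun_apply by (intro sum.cong) auto
    also have "\<dots> = c \<tau>"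
      using assms ochains_face_subset[OF c, of \<tau>] by auto
    finally show "c \<tau> = (\<Sum>\<sigma>\<in>Pow A. c \<sigma> *\<^sub>F ?d \<sigma>) \<tau>" ..
  qed
  also have "\<dots> \<in> fun_space.span (?d ` Pow A)"
    by (intro fun_space.span_sum fun_space.span_scale fun_space.span_base) auto
  finally show "c \<in> fun_space.span (?d ` Pow A)" .
qed

lemma finite_dim_ocycles: "finite A \<Longrightarrow> finite_dim (ocycles A i :: ('a::order set \<Rightarrow> 'k::field) set)"
  by (rule finite_dim_subset[OF finite_dim_ochains ocycles_subset_ochains])

lemma finite_dim_obounds: "finite A \<Longrightarrow> finite_dim (obounds A i :: ('a::order set \<Rightarrow> 'k::field) set)"
  by (rule finite_dim_subset[OF finite_dim_ocycles obounds_subset_ocycles])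

lemma hclass_eq_iff:
  assumes "finite A"
  shows "hclass (order_complex A) i z = hclass (order_complex A) i z' \<longleftrightarrow>
    z - (z' :: 'a::order set \<Rightarrow> 'k::field) \<in> obounds A i"
proof -
  note B = obounds_subspace[OF assms, of i, where 'k='k]
  have mem: "x \<in> hclass (order_complex A) i y \<longleftrightarrow> x - y \<in> obounds A i" for x y :: "'a set \<Rightarrow> 'k"
    unfolding hclass_def by (auto intro: image_eqI[of _ _ "x - y"])
  show ?thesis
  proof
    assume "hclass (order_complex A) i z = hclass (order_complex A) i z'"
    moreover have "z \<in> hclass (order_complex A) i z"
      using fun_space.subspace_0[OF B] by (simp add: mem)
    ultimately show "z - z' \<in> obounds A i"
      by (simp add: mem)
  next
    assume diff: "z - z' \<in> obounds A i"
    have "x - z \<in> obounds A i \<longleftrightarrow> x - z' \<in> obounds A i" for x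
      using fun_space.subspace_add[OF B _ diff, of "x - z"]
        fun_space.subspace_diff[OF B _ diff, of "x - z'"] by auto
    then show "hclass (order_complex A) i z = hclass (order_complex A) i z'"
      by (simp add: set_eq_iff mem)
  qed
qed

lemma homology_basis_iff:
  assumes "finite A"
  shows "homology_basis (order_complex A) i (b :: ('a::order set \<Rightarrow> 'k::field) set) \<longleftrightarrow>
    rel_basis (ocycles A i) (obounds A i) b"
  unfolding homology_basis_def rel_basis_def homology_def
  by (simp add: hclass_eq_iff[OF assms])

lemma rel_basis_hbasis:
  assumes "finite A"
  shows "rel_basis (ocycles A i) (obounds A i)
    (hbasis (order_complex A) i :: ('a::order set \<Rightarrow> 'k::field) set)"
proof -
  obtain b :: "('a set \<Rightarrow> 'k) set" where "rel_basis (ocycles A i) (obounds A i) b"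
    using rel_basis_exists[OF finite_dim_ocycles[OF assms] obounds_subspace[OF assms]
        obounds_subset_ocycles[OF assms]]
    by blast
  then show ?thesis
    unfolding hbasis_def homology_basis_iff[OF assms] by (rule someI)
qed

lemma dim_ocycles:
  fixes k :: "'k::field itself"
  assumes "finite A"
  shows "fun_space.dim (ocycles A i :: ('a::order set \<Rightarrow> 'k::field) set) =
    fun_space.dim (obounds A i :: ('a set \<Rightarrow> 'k) set) + ohdim k A i"
  unfolding hdim_def
  by (rule rel_basis_dim[OF ocycles_subspace obounds_subspace obounds_subset_ocycles finite_dim_obounds
        rel_basis_hbasis]) (rule assms)+

lemma ohdim_rel_acyclic:
  fixes k :: "'k::field itself"
  assumes "finite A" "rel_acyclic k X A"
  shows "ohdim k X i = ohdim k A i"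
proof -
  have X: "finite X"
    using assms finite_subset by (auto simp: rel_acyclic_def)
  have "fun_space.dim {v + w | v w. v \<in> (ocycles X i :: ('a set \<Rightarrow> 'k) set) \<and> w \<in> obounds A i} +
      fun_space.dim (ocycles X i \<inter> (obounds A i :: ('a set \<Rightarrow> 'k) set)) =
      fun_space.dim (ocycles X i :: ('a set \<Rightarrow> 'k) set) +
      fun_space.dim (obounds A i :: ('a set \<Rightarrow> 'k) set)"
    by (intro dim_sum_Int ocycles_subspace obounds_subspace finite_dim_ocycles finite_dim_obounds X
        assms(1))
  then show ?thesis
    unfolding ocycles_rel_acyclic[OF assms, symmetric] obounds_rel_acyclic[OF assms, symmetric]
    using dim_ocycles[OF X, of i, where k=k] dim_ocycles[OF assms(1), of i, where k=k] by linarith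
qed

lemma ohdim_iso:
  fixes k :: "'k::field itself" and A :: "'a::order set" and B :: "'b::order set"
  assumes "finite B" "poset_iso B A e"
  shows "ohdim k B i = ohdim k A i"
proof -
  have A: "finite A"
    using finite_poset_iso[OF assms(2)] assms(1) by blast
  have "Vector_Spaces.linear (*\<^sub>F) (*\<^sub>F) (pull B e :: ('a set \<Rightarrow> 'k) \<Rightarrow> _)"
    unfolding Vector_Spaces.linear_iff
    by (intro conjI allI fun_space.vector_space_axioms pull_linear)
  then have dim: "fun_space.dim (pull B e ` V) = fun_space.dim V"
    if "fun_space.subspace V" "V \<subseteq> ocycles A i" for V :: "('a set \<Rightarrow> 'k) set"
    using that ocycles_subset_ochains
    by (intro dim_linear_image inj_on_subset[OF inj_on_pull[OF assms(2)]]) auto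
  show ?thesis
    using dim[OF ocycles_subspace[OF A]] dim[OF obounds_subspace[OF A] obounds_subset_ocycles[OF A]]
      dim_ocycles[OF A, of i, where k=k] dim_ocycles[OF assms(1), of i, where k=k]
    by (simp add: pull_image[OF assms])
qed

lemma ohdim_eq_0_iff:
  fixes k :: "'k::field itself"
  assumes "finite A"
  shows "ohdim k A i = 0 \<longleftrightarrow> (ocycles A i :: ('a::order set \<Rightarrow> 'k) set) \<subseteq> obounds A i"
proof
  assume "ohdim k A i = 0"
  moreover note basis = rel_basis_hbasis[OF assms, of i, where 'k='k]
  ultimately have "hbasis (order_complex A) i = ({} :: ('a set \<Rightarrow> 'k) set)"
    by (simp add: hdim_def rel_basis_def)
  with basis show "(ocycles A i :: ('a set \<Rightarrow> 'k) set) \<subseteq> obounds A i"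
    by (auto simp: rel_basis_def lincomb_eq)
next
  assume "(ocycles A i :: ('a set \<Rightarrow> 'k) set) \<subseteq> obounds A i"
  then have "(ocycles A i :: ('a set \<Rightarrow> 'k) set) = obounds A i"
    using obounds_subset_ocycles[OF assms] by blast
  then show "ohdim k A i = 0"
    using dim_ocycles[OF assms, of i, where k=k] by simp
qed

lemma acyclic_over_iff_ohdim:
  "finite A \<Longrightarrow> acyclic_over k A \<longleftrightarrow> (\<forall>i. ohdim k A i = 0)"
  for k :: "'k::field itself"
  by (simp add: acyclic_over_def ohdim_eq_0_iff)

lemma ohdim_below_minus_one:
  fixes k :: "'k::field itself"
  assumes "finite A" "i < -1"
  shows "ohdim k A i = 0"
proof -
  have "(ocycles A i :: ('a set \<Rightarrow> 'k) set) \<subseteq> {0}"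
    using assms(2) by (fastforce simp: cycles_def chains_def fun_eq_iff)
  then show ?thesis
    unfolding ohdim_eq_0_iff[OF assms(1)]
    using fun_space.subspace_0[OF obounds_subspace[OF assms(1)]] by blast
qed

lemma order_complex_empty: "order_complex {} = {{}}"
  by (auto simp: order_complex_iff)

lemma ochains_empty_iff: "c \<in> ochains {} i \<longleftrightarrow> (\<forall>\<sigma>. c \<sigma> \<noteq> 0 \<longrightarrow> \<sigma> = {} \<and> i = -1)"
  by (auto simp: chains_def order_complex_empty)

lemma obounds_empty: "obounds {} i = {0 :: 'a::order set \<Rightarrow> 'k::field}"
proof -
  have "bdry c = 0" if "c \<in> ochains {} (i + 1)" for c :: "'a set \<Rightarrow> 'k"
    using bdry_eq_sum_links[OF finite.emptyI that] by simp
  then show ?thesis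
    using fun_space.subspace_0[OF obounds_subspace[OF finite.emptyI]] unfolding boundaries_def
    by blast
qed

lemma bounding_cycle_split:
  fixes z :: "'a::order set \<Rightarrow> 'k::field"
  assumes "finite A" "x \<in> A" "z \<in> ocycles (A - {x}) j" "z \<in> obounds A j"
  obtains b w where "b \<in> obounds (A - {x}) j" "w \<in> ocycles (comparables A x) j" "z = b + w"
proof -
  obtain d where d: "d \<in> ochains A (j + 1)" "bdry d = z"
    using assms(4) by (auto simp: boundaries_def)
  have w: "link x d \<in> ocycles (comparables A x) j"
    using link_in_ocycles[OF assms(1) d(1)] assms(3) d(2) by (auto simp: cycles_def)
  have "z = bdry (deletion x d) + link x d"
    using bdry_decompose_if_bdry_avoids[OF assms(1,2) d(1), of j] assms(3)
    by (simp add: cycles_def d(2) add.commute)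
  then show thesis
    using that w bdry_in_obounds[OF deletion_in_ochains[OF d(1)]] by blast
qed

text \<open>The difference of the two dimensions of spaces of cycles is the rank of the map from the
  homology of the link to the homology of the deletion.\<close>

lemma ohdim_remove_le_rank:
  fixes k :: "'k::field itself"
  assumes "finite A" "x \<in> A"
  shows "ohdim k (A - {x}) j +
      fun_space.dim (obounds (A - {x}) j \<inter> (ocycles (comparables A x) j :: ('a::order set \<Rightarrow> 'k) set))
    \<le> ohdim k A j + fun_space.dim (ocycles (comparables A x) j :: ('a set \<Rightarrow> 'k) set)"
proof -
  let ?Z = "ocycles (A - {x}) j :: ('a set \<Rightarrow> 'k) set"
    and ?B = "obounds (A - {x}) j :: ('a set \<Rightarrow> 'k) set"
  let ?Z' = "ocycles A j :: ('a set \<Rightarrow> 'k) set" and ?B' = "obounds A j :: ('a set \<Rightarrow> 'k) set"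
  let ?S = "ocycles (comparables A x) j :: ('a set \<Rightarrow> 'k) set"
  have fin: "finite (A - {x})" "finite (comparables A x)"
    using assms(1) finite_comparables by auto
  note sub = ocycles_subspace obounds_subspace finite_dim_ocycles finite_dim_obounds fin assms(1)
  have "{v + w | v w. v \<in> ?Z \<and> w \<in> ?B'} \<subseteq> ?Z'"
    by (intro fun_space.subspace_sums_subset ocycles_mono obounds_subset_ocycles sub) auto
  then have "fun_space.dim {v + w | v w. v \<in> ?Z \<and> w \<in> ?B'} \<le> fun_space.dim ?Z'"
    by (intro dim_mono_subspace fun_space.subspace_sums sub)
  moreover have "?Z \<inter> ?B' \<subseteq> {v + w | v w. v \<in> ?B \<and> w \<in> ?S}"
    using bounding_cycle_split[OF assms] by blast
  moreover have "{v + w | v w. v \<in> ?B \<and> w \<in> ?S} \<subseteq> ?Z"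
    by (intro fun_space.subspace_sums_subset ocycles_mono obounds_subset_ocycles comparables_subset sub)
  then have "finite_dim {v + w | v w. v \<in> ?B \<and> w \<in> ?S}"
    by (rule finite_dim_subset[OF finite_dim_ocycles[OF fin(1)]])
  ultimately have "fun_space.dim (?Z \<inter> ?B') \<le> fun_space.dim {v + w | v w. v \<in> ?B \<and> w \<in> ?S}"
    by (intro dim_mono_subspace fun_space.subspace_sums fun_space.subspace_inter sub)
  moreover have "fun_space.dim {v + w | v w. v \<in> ?Z \<and> w \<in> ?B'} + fun_space.dim (?Z \<inter> ?B') =
      fun_space.dim ?Z + fun_space.dim ?B'"
    by (intro dim_sum_Int sub)
  moreover have "fun_space.dim {v + w | v w. v \<in> ?B \<and> w \<in> ?S} + fun_space.dim (?B \<inter> ?S) =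
      fun_space.dim ?B + fun_space.dim ?S"
    by (intro dim_sum_Int sub)
  ultimately show ?thesis
    using dim_ocycles[OF fin(1), of j, where k=k] dim_ocycles[OF assms(1), of j, where k=k]
      \<open>fun_space.dim {v + w | v w. v \<in> ?Z \<and> w \<in> ?B'} \<le> fun_space.dim ?Z'\<close> by linarith
qed

lemma ohdim_remove_le:
  fixes k :: "'k::field itself"
  assumes "finite A" "x \<in> A"
  shows "ohdim k (A - {x}) j \<le> ohdim k A j + ohdim k (comparables A x) j"
proof -
  let ?S = "ocycles (comparables A x) j :: ('a set \<Rightarrow> 'k) set"
  let ?B = "obounds (comparables A x) j :: ('a set \<Rightarrow> 'k) set"
  have fin: "finite (A - {x})" "finite (comparables A x)"
    using assms(1) finite_comparables by auto
  have "?B \<subseteq> obounds (A - {x}) j \<inter> ?S"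
    using obounds_subset_ocycles[OF fin(2)] obounds_mono[OF comparables_subset] by blast
  then have "fun_space.dim ?B \<le> fun_space.dim (obounds (A - {x}) j \<inter> ?S)"
    by (intro dim_mono_subspace fun_space.subspace_inter
        finite_dim_subset[OF finite_dim_ocycles[OF fin(2)]]
        ocycles_subspace obounds_subspace fin) auto
  then show ?thesis
    using ohdim_remove_le_rank[OF assms, where k=k and j=j] dim_ocycles[OF fin(2), of j, where k=k]
    by linarith
qed

lemma ohdim_remove_le_if_link_bounds:
  fixes k :: "'k::field itself"
  assumes "finite A" "x \<in> A"
    and "(ocycles (comparables A x) j :: ('a::order set \<Rightarrow> 'k::field) set) \<subseteq> obounds (A - {x}) j"
  shows "ohdim k (A - {x}) j \<le> ohdim k A j"
  using ohdim_remove_le_rank[OF assms(1,2), where k=k and j=j] Int_absorb1[OF assms(3)] by simp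

section \<open>Betti posets\<close>

definition finite_pointed :: "'a::order set \<Rightarrow> bool" where
  "finite_pointed Q \<longleftrightarrow> finite Q \<and> (\<exists>m\<in>Q. \<forall>x\<in>Q. m \<le> x)"

definition below :: "'a::order set \<Rightarrow> 'a \<Rightarrow> 'a set" where
  "below Q p = {x \<in> Q. pbot Q < x \<and> x < p}"

definition proper :: "'a::order set \<Rightarrow> 'a set" where
  "proper Q = {x \<in> Q. pbot Q < x}"

definition down_closed :: "'a::order set \<Rightarrow> 'a set \<Rightarrow> bool" where
  "down_closed Q A \<longleftrightarrow> A \<subseteq> Q \<and> (\<forall>x\<in>A. \<forall>y\<in>Q. y \<le> x \<longrightarrow> y \<in> A)"

lemma Delta_below: "Delta Q p = order_complex (below Q p)"
  by (simp add: Delta_def below_def)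

lemma below_eq: "below Q p = {x \<in> proper Q. x < p}"
  by (auto simp: below_def proper_def)

lemma properD: "x \<in> proper Q \<Longrightarrow> x \<in> Q"
  by (simp add: proper_def)

lemma pbot_eqI: "m \<in> Q \<Longrightarrow> (\<And>x. x \<in> Q \<Longrightarrow> m \<le> x) \<Longrightarrow> pbot Q = m"
  unfolding pbot_def by (rule Least_equality)

lemma finite_pointedD:
  assumes "finite_pointed Q"
  shows "finite Q" "pbot Q \<in> Q" "\<And>x. x \<in> Q \<Longrightarrow> pbot Q \<le> x"
  using assms pbot_eqI unfolding finite_pointed_def by blast+

lemma proper_eq: "finite_pointed Q \<Longrightarrow> proper Q = Q - {pbot Q}"
  using finite_pointedD[of Q] by (auto simp: proper_def order_le_less)

lemma finite_below: "finite_pointed Q \<Longrightarrow> finite (below Q p)"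
  and finite_proper: "finite_pointed Q \<Longrightarrow> finite (proper Q)"
  using finite_pointedD(1)[of Q] by (auto simp: below_def proper_def)

lemma down_closed_finite: "finite_pointed Q \<Longrightarrow> down_closed (proper Q) A \<Longrightarrow> finite A"
  unfolding down_closed_def using finite_proper finite_subset by blast

lemma down_closed_below: "down_closed (proper Q) (below Q p)"
  by (auto simp: down_closed_def below_eq)

lemma below_subset_down_closed: "down_closed (proper Q) A \<Longrightarrow> q \<in> A \<Longrightarrow> below Q q \<subseteq> A"
  by (auto simp: down_closed_def below_eq dest: less_imp_le)

lemma comparables_maximal:
  assumes "down_closed R A" "x \<in> A" "\<And>y. y \<in> A \<Longrightarrow> \<not> x < y"
  shows "comparables A x = {y \<in> R. y < x}"
  using assms by (auto simp: comparables_def down_closed_def dest: less_imp_le)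

lemma down_closed_remove_maximal:
  assumes "down_closed R A" "\<And>y. y \<in> A \<Longrightarrow> \<not> x < y"
  shows "down_closed R (A - {x})"
  using assms by (auto simp: down_closed_def order_le_less)

lemma ohdim_down_closed_le:
  fixes k :: "'k::field itself"
  assumes "finite R" "down_closed R A" "down_closed R A'" "A \<subseteq> A'"
  shows "ohdim k A j \<le>
    ohdim k A' j + (\<Sum>x\<in>A' - A. ohdim k {y \<in> R. y < x} j)"
proof -
  have "finite A'"
    using assms(1,3) finite_subset by (auto simp: down_closed_def)
  then show ?thesis
    using assms(3,4)
  proof (induction A' rule: finite_psubset_induct)
    case (psubset A')
    show ?case
    proof (cases "A' = A")
      case False
      then have "finite (A' - A)" "A' - A \<noteq> {}"
        using psubset.hyps psubset.prems(2) by auto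
      then obtain x where x: "x \<in> A' - A" "\<not> (\<exists>y\<in>A' - A. x < y)"
        using ex_max_if_finite[of "A' - A"] by blast
      have "x \<in> R"
        using x(1) psubset.prems(1) by (auto simp: down_closed_def)
      then have max: "\<not> x < y" if "y \<in> A'" for y
        using x that assms(2) by (metis DiffD2 DiffI down_closed_def less_imp_le)
      have "ohdim k A j \<le> ohdim k (A' - {x}) j
          + (\<Sum>x\<in>A' - {x} - A. ohdim k {y \<in> R. y < x} j)"
        by (rule psubset.IH)
          (use x(1) psubset.prems down_closed_remove_maximal[OF psubset.prems(1) max] in auto)
      moreover have "ohdim k (A' - {x}) j \<le>
          ohdim k A' j + ohdim k {y \<in> R. y < x} j"
        using ohdim_remove_le[OF psubset.hyps, of x k j] x(1)
          comparables_maximal[OF psubset.prems(1) _ max] by simp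
      moreover have "A' - {x} - A = A' - A - {x}"
        by blast
      ultimately show ?thesis
        using x(1) psubset.hyps by (simp add: sum.remove[of "A' - A" x])
    qed simp
  qed
qed

lemma ohdim_empty:
  "ohdim k ({} :: 'a::order set) i = (if i = -1 then 1 else 0)"
  for k :: "'k::field itself"
proof (cases "i = -1")
  case True
  define e :: "'a set \<Rightarrow> 'k" where "e = (\<lambda>\<sigma>. if \<sigma> = {} then 1 else 0)"
  have iff: "c \<in> ocycles {} (-1) \<longleftrightarrow> c = c {} *\<^sub>F e" for c :: "'a set \<Rightarrow> 'k"
    using bdry_eq_sum_links[OF finite.emptyI, of c "-1"]
    by (auto simp: cycles_def ochains_empty_iff fun_eq_iff e_def)
  have "a *\<^sub>F e \<in> ocycles {} (-1)" for a
    unfolding iff by (simp add: e_def)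
  then have "ocycles {} (-1) = fun_space.span {e}"
    unfolding fun_space.span_singleton using iff by (intro equalityI subsetI) (metis rangeI, blast)
  moreover have "e \<noteq> 0"
    by (auto simp: e_def fun_eq_iff)
  ultimately have "fun_space.dim (ocycles {} (-1) :: ('a set \<Rightarrow> 'k) set) = 1"
    using fun_space.dim_span_eq_card_independent[of "{e}"] by simp
  moreover have "fun_space.dim {0 :: 'a set \<Rightarrow> 'k} = 0"
    using fun_space.dim_span_eq_card_independent[of "{}"] fun_space.independent_empty by simp
  ultimately show ?thesis
    using dim_ocycles[OF finite.emptyI, of "-1", where k=k and 'a='a] True
    by (simp add: obounds_empty)
next
  case False
  then have "(ocycles {} i :: ('a set \<Rightarrow> 'k) set) \<subseteq> {0}"
    by (auto simp: cycles_def ochains_empty_iff fun_eq_iff)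
  then show ?thesis
    using False ohdim_eq_0_iff[OF finite.emptyI, of k i, where 'a='a] by (simp add: obounds_empty)
qed

lemma betti_poset_iff: "p \<in> betti_poset k P \<longleftrightarrow> p \<in> P \<and> (\<exists>i. ohdim k (below P p) i \<noteq> 0)"
  for k :: "'k::field itself"
  by (simp add: betti_poset_def Delta_below)

lemma betti_poset_subset: "betti_poset k P \<subseteq> P" for k :: "'k::field itself"
  by (auto simp: betti_poset_def)

lemma in_betti_poset_if_below_empty:
  fixes k :: "'k::field itself"
  assumes "p \<in> P" "below P p = {}"
  shows "p \<in> betti_poset k P"
  unfolding betti_poset_iff using assms by (auto simp: ohdim_empty intro!: exI[of _ "-1"])

lemma pbot_in_betti_poset: "finite_pointed P \<Longrightarrow> pbot P \<in> betti_poset k P"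
  for k :: "'k::field itself"
  using finite_pointedD(2) by (intro in_betti_poset_if_below_empty) (auto simp: below_def)

lemma betti_poset_pointed:
  fixes k :: "'k::field itself"
  assumes "finite_pointed P"
  shows "finite_pointed (betti_poset k P)"
proof -
  note P = finite_pointedD[OF assms] and sub = betti_poset_subset[of k P]
  show ?thesis
    unfolding finite_pointed_def
    using finite_subset[OF sub P(1)] sub P(3) pbot_in_betti_poset[OF assms, where k=k] by auto
qed

lemma pbot_betti_poset: "finite_pointed P \<Longrightarrow> pbot (betti_poset k P) = pbot P"
  for k :: "'k::field itself"
  using pbot_in_betti_poset betti_poset_subset[of k P] finite_pointedD[of P]
  by (intro pbot_eqI) auto

lemma below_betti_poset:
  "finite_pointed P \<Longrightarrow> below (betti_poset k P) p = below P p \<inter> betti_poset k P"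
  for k :: "'k::field itself"
  using betti_poset_subset[of k P] by (auto simp: below_def pbot_betti_poset)

lemma proper_betti_poset:
  "finite_pointed P \<Longrightarrow> proper (betti_poset k P) = proper P \<inter> betti_poset k P"
  for k :: "'k::field itself"
  using betti_poset_subset[of k P] by (auto simp: proper_def pbot_betti_poset)

lemma betti_poset_proper_nonempty:
  fixes k :: "'k::field itself"
  assumes P: "finite_pointed P" and "proper P \<noteq> {}"
  shows "proper (betti_poset k P) \<noteq> {}"
proof -
  obtain x where x: "x \<in> proper P" "\<not> (\<exists>z\<in>proper P. z < x)"
    using ex_min_if_finite[OF finite_proper[OF P] assms(2)] by blast
  then have "x \<in> betti_poset k P"
    by (intro in_betti_poset_if_below_empty) (auto simp: below_eq dest: properD)
  then show ?thesis
    using x(1) proper_betti_poset[OF P] by blast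
qed

lemma acyclic_below_betti_poset:
  fixes k :: "'k::field itself"
  assumes P: "finite_pointed P" and "y \<in> proper P" "y \<notin> betti_poset k P"
  shows "acyclic_over k (below (betti_poset k P) y)"
  using assms(2,3)
proof (induction "card (below P y)" arbitrary: y rule: less_induct)
  case less
  let ?Q = "betti_poset k P"
  have fin: "finite (below P y)"
    by (rule finite_below[OF P])
  have "rel_acyclic k (below P y \<inter> ?Q) (below P y)"
  proof (rule rel_acyclic_if_lower_fibers_acyclic[OF fin])
    fix x assume x: "x \<in> below P y - ?Q"
    then have "{z \<in> below P y \<inter> ?Q. z < x} = below ?Q x"
      unfolding below_betti_poset[OF P] by (auto simp: below_def)
    moreover have "card (below P x) < card (below P y)"
      using x by (intro psubset_card_mono[OF fin]) (auto simp: below_def)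
    ultimately show "acyclic_over k {z \<in> below P y \<inter> ?Q. z < x}"
      using less.hyps[of x] x by (simp add: below_def proper_def)
  qed
  moreover have "\<forall>i. ohdim k (below P y) i = 0"
    using less.prems properD[OF less.prems(1)] unfolding betti_poset_iff by blast
  then have "acyclic_over k (below P y)"
    by (simp add: acyclic_over_iff_ohdim[OF fin])
  ultimately show ?case
    unfolding below_betti_poset[OF P] using acyclic_over_iff_rel_acyclic[OF fin] by blast
qed

lemma rel_acyclic_betti_poset:
  fixes k :: "'k::field itself"
  assumes P: "finite_pointed P" and "down_closed (proper P) A"
  shows "rel_acyclic k (A \<inter> betti_poset k P) A"
proof (rule rel_acyclic_if_lower_fibers_acyclic)
  let ?Q = "betti_poset k P"
  show "finite A"
    using down_closed_finite[OF assms] .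
  fix y assume y: "y \<in> A - ?Q"
  then have "{x \<in> A \<inter> ?Q. x < y} = below ?Q y"
    using assms(2)
    by (auto simp: down_closed_def below_eq proper_betti_poset[OF P] dest: less_imp_le)
  then show "acyclic_over k {x \<in> A \<inter> ?Q. x < y}"
    using acyclic_below_betti_poset[OF P, of y] y assms(2) by (auto simp: down_closed_def)
qed

lemma hdim_Delta_betti_poset:
  fixes k :: "'k::field itself"
  assumes P: "finite_pointed P"
  shows "hdim k (Delta (betti_poset k P) p) i = hdim k (Delta P p) i"
  unfolding Delta_below below_betti_poset[OF P]
  by (intro ohdim_rel_acyclic[OF finite_below[OF P]] rel_acyclic_betti_poset[OF P] down_closed_below)

lemma acyclic_betti_poset_le:
  fixes k :: "'k::field itself"
  assumes P: "finite_pointed P" and "x \<in> proper P"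
  shows "acyclic_over k {y \<in> proper (betti_poset k P). y \<le> x}"
proof -
  let ?A = "{y \<in> proper P. y \<le> x}"
  have fin: "finite ?A"
    using finite_proper[OF P] by simp
  have "acyclic_over k ?A"
    by (rule acyclic_over_if_comparable_to_all[of _ x]) (use fin assms(2) in auto)
  moreover have "down_closed (proper P) ?A"
    by (auto simp: down_closed_def)
  ultimately have "acyclic_over k (?A \<inter> betti_poset k P)"
    using acyclic_over_iff_rel_acyclic[OF fin rel_acyclic_betti_poset[OF P]] by blast
  moreover have "?A \<inter> betti_poset k P = {y \<in> proper (betti_poset k P). y \<le> x}"
    unfolding proper_betti_poset[OF P] by auto
  ultimately show ?thesis by simp
qed

section \<open>Rigid Betti posets\<close>

lemma strict_mono_rank_on_chain:
  fixes rank :: "'a::order \<Rightarrow> nat"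
  assumes "\<sigma> \<in> order_complex A"
    and "\<And>x y. x \<in> \<sigma> \<Longrightarrow> y \<in> \<sigma> \<Longrightarrow> x < y \<Longrightarrow> rank x < rank y"
    and "\<And>x. x \<in> \<sigma> \<Longrightarrow> 1 \<le> rank x \<and> rank x \<le> n"
  shows "inj_on rank \<sigma>" "card \<sigma> \<le> n" "card \<sigma> = n \<Longrightarrow> 1 \<le> n \<Longrightarrow> \<exists>x\<in>\<sigma>. rank x = n"
proof -
  show inj: "inj_on rank \<sigma>"
    using assms(1,2) unfolding order_complex_iff
    by (intro inj_onI) (metis less_irrefl order_le_less)
  have sub: "rank ` \<sigma> \<subseteq> {1..n}"
    using assms(3) by auto
  then show "card \<sigma> \<le> n"
    using card_mono[of "{1..n}" "rank ` \<sigma>"] card_image[OF inj] by simp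
  assume "card \<sigma> = n" "1 \<le> n"
  then have "n \<in> rank ` \<sigma>"
    using card_subset_eq[OF _ sub] card_image[OF inj] by simp
  then show "\<exists>x\<in>\<sigma>. rank x = n" by auto
qed

locale rigid_poset =
  fixes k :: "'k::field itself" and Q :: "'a::order set" and rank :: "'a \<Rightarrow> nat"
  assumes pointed: "finite_pointed Q"
    and rank_pbot: "rank (pbot Q) = 0"
    and rank_pos: "\<And>q. q \<in> proper Q \<Longrightarrow> 1 \<le> rank q"
    and rank_neq: "\<And>p q. p \<in> proper Q \<Longrightarrow> q \<in> proper Q \<Longrightarrow> p < q \<Longrightarrow> rank p \<noteq> rank q"
    and ohdim_below_proper: "\<And>q j. q \<in> proper Q \<Longrightarrow>
      ohdim k (below Q q) j = (if j = int (rank q) - 2 then 1 else 0)"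
begin

lemma finite_below_Q [simp]: "finite (below Q q)"
  by (rule finite_below[OF pointed])

lemma finite_proper_Q [simp]: "finite (proper Q)"
  by (rule finite_proper[OF pointed])

lemma long_chain_below:
  assumes "q \<in> proper Q"
  obtains \<sigma> where "\<sigma> \<in> order_complex (below Q q)" "card \<sigma> = rank q - 1"
proof -
  have "ohdim k (below Q q) (int (rank q) - 2) \<noteq> 0"
    using ohdim_below_proper[OF assms] by simp
  then obtain c :: "'a set \<Rightarrow> 'k" where c: "c \<in> ochains (below Q q) (int (rank q) - 2)"
    and "c \<notin> obounds (below Q q) (int (rank q) - 2)"
    unfolding ohdim_eq_0_iff[OF finite_below_Q] cycles_def by blast
  then have "c \<noteq> 0"
    using fun_space.subspace_0[OF obounds_subspace[OF finite_below_Q]] by metis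
  then obtain \<sigma> where "c \<sigma> \<noteq> 0"
    by (auto simp: fun_eq_iff)
  then have "\<sigma> \<in> order_complex (below Q q)" "int (card \<sigma>) = int (rank q) - 2 + 1"
    using chainsD[OF c] by auto
  then show thesis
    using that by auto
qed

lemma rank_strict_mono_proper:
  assumes "p \<in> proper Q" "q \<in> proper Q" "p < q"
  shows "rank p < rank q"
  using assms
proof (induction "card (below Q q)" arbitrary: p q rule: less_induct)
  case less
  show ?case
  proof (rule ccontr)
    assume nless: "\<not> rank p < rank q"
    define S where "S = {p \<in> proper Q. p < q \<and> rank q < rank p}"
    have "finite S" "S \<noteq> {}"
      using less.prems rank_neq[of p q] nless by (auto simp: S_def)
    then obtain p0 where p0: "p0 \<in> S" "\<not> (\<exists>x\<in>S. x < p0)"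
      using ex_min_if_finite[of S] by blast
    then have p0': "p0 \<in> proper Q" "p0 < q" "rank q < rank p0"
      by (auto simp: S_def)
    obtain \<sigma> where \<sigma>: "\<sigma> \<in> order_complex (below Q p0)" "card \<sigma> = rank p0 - 1"
      using long_chain_below[OF p0'(1)] .
    have mem: "x \<in> proper Q" "x < p0" if "x \<in> \<sigma>" for x
      using \<sigma>(1) that by (auto simp: order_complex_iff below_eq)
    have "card \<sigma> \<le> rank q - 1"
    proof (rule strict_mono_rank_on_chain(2)[OF \<sigma>(1)])
      fix x y assume xy: "x \<in> \<sigma>" "y \<in> \<sigma>" "x < y"
      have "y < q"
        using mem(2)[OF xy(2)] p0'(2) by simp
      then have "card (below Q y) < card (below Q q)"
        using mem(1)[OF xy(2)] by (intro psubset_card_mono) (auto simp: below_eq)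
      then show "rank x < rank y"
        using less.hyps[of y x] mem(1) xy by blast
    next
      fix x assume x: "x \<in> \<sigma>"
      then have "x < q" "\<not> rank q < rank x"
        using p0(2) p0'(2) mem[OF x] by (auto simp: S_def)
      then show "1 \<le> rank x \<and> rank x \<le> rank q - 1"
        using rank_pos[OF mem(1)[OF x]] rank_neq[OF mem(1)[OF x] less.prems(2)] by auto
    qed
    then show False
      using \<sigma>(2) p0'(3) rank_pos[OF less.prems(2)] by linarith
  qed
qed

lemma properI: "p \<in> Q \<Longrightarrow> q \<in> Q \<Longrightarrow> p < q \<Longrightarrow> q \<in> proper Q"
  using finite_pointedD(3)[OF pointed] by (auto simp: proper_def dest: order_le_less_trans)

lemma rank_eq_0_iff: "q \<in> Q \<Longrightarrow> rank q = 0 \<longleftrightarrow> q = pbot Q"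
  using rank_pbot rank_pos[of q] by (cases "q = pbot Q") (auto simp: proper_eq[OF pointed])

lemma rank_strict_mono:
  assumes "p \<in> Q" "q \<in> Q" "p < q"
  shows "rank p < rank q"
  using rank_strict_mono_proper[of p q] rank_pos[OF properI[OF assms]] properI[OF assms] assms
  by (cases "p = pbot Q") (auto simp: rank_pbot proper_eq[OF pointed])

lemma rank_mono: "p \<in> Q \<Longrightarrow> q \<in> Q \<Longrightarrow> p \<le> q \<Longrightarrow> rank p \<le> rank q"
  using rank_strict_mono by (auto simp: order_le_less)

lemma below_memD:
  assumes "q \<in> Q" "x \<in> below Q q"
  shows "x \<in> proper Q" "x < q" "rank x \<le> rank q - 1"
  using assms rank_strict_mono[OF _ assms(1), of x] by (auto simp: below_eq dest: properD)

lemma rank_on_face: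
  assumes "\<sigma> \<in> order_complex A" "A \<subseteq> proper Q" "\<And>x. x \<in> \<sigma> \<Longrightarrow> rank x \<le> n"
  shows "inj_on rank \<sigma>" "card \<sigma> \<le> n" "card \<sigma> = n \<Longrightarrow> 1 \<le> n \<Longrightarrow> \<exists>x\<in>\<sigma>. rank x = n"
proof -
  have mem: "x \<in> proper Q" if "x \<in> \<sigma>" for x
    using assms(1,2) that by (auto simp: order_complex_iff)
  have mono: "rank x < rank y" if "x \<in> \<sigma>" "y \<in> \<sigma>" "x < y" for x y
    using rank_strict_mono_proper mem that by blast
  have bounds: "1 \<le> rank x \<and> rank x \<le> n" if "x \<in> \<sigma>" for x
    using assms(3) rank_pos mem that by blast
  show "inj_on rank \<sigma>" "card \<sigma> \<le> n" "card \<sigma> = n \<Longrightarrow> 1 \<le> n \<Longrightarrow> \<exists>x\<in>\<sigma>. rank x = n"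
    by (rule strict_mono_rank_on_chain[OF assms(1) mono bounds]; assumption)+
qed

lemma ochains_above_rank_eq_0:
  assumes "c \<in> ochains A i" "A \<subseteq> proper Q" "\<And>x. x \<in> A \<Longrightarrow> rank x \<le> n" "int n < i + 1"
  shows "c = 0"
proof -
  have "c \<sigma> = 0" for \<sigma>
  proof (rule ccontr)
    assume nz: "c \<sigma> \<noteq> 0"
    have "card \<sigma> \<le> n"
      by (rule rank_on_face(2)[OF chainsD(1)[OF assms(1) nz] assms(2)])
        (use ochains_face_subset[OF assms(1) nz] assms(3) in blast)
    then show False
      using chainsD(2)[OF assms(1) nz] assms(4) by simp
  qed
  then show ?thesis
    by (simp add: fun_eq_iff)
qed

text \<open>The unique degree of the homology below \<open>q\<close>. At the minimum, nothing lies below and the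
  homology is that of the empty face.\<close>

definition top_dim :: "'a \<Rightarrow> int" where
  "top_dim q = int (max 1 (rank q)) - 2"

lemma top_dim_proper: "q \<in> proper Q \<Longrightarrow> top_dim q = int (rank q) - 2"
  using rank_pos[of q] by (simp add: top_dim_def)

lemma below_pbot: "below Q (pbot Q) = {}"
  by (auto simp: below_def)

lemma ohdim_below:
  assumes "q \<in> Q"
  shows "ohdim k (below Q q) j = (if j = top_dim q then 1 else 0)"
proof (cases "q = pbot Q")
  case True
  then show ?thesis
    by (simp add: below_pbot ohdim_empty top_dim_def rank_pbot)
next
  case False
  then have "q \<in> proper Q"
    using assms by (simp add: proper_eq[OF pointed])
  then show ?thesis
    by (simp add: ohdim_below_proper top_dim_proper)
qed

lemma obounds_top_dim:
  assumes "q \<in> Q"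
  shows "obounds (below Q q) (top_dim q) = {0 :: 'a set \<Rightarrow> 'k}"
proof -
  have "c = 0" if "c \<in> ochains (below Q q) (top_dim q + 1)" for c :: "'a set \<Rightarrow> 'k"
    by (rule ochains_above_rank_eq_0[OF that, of "rank q - 1"])
      (use below_memD[OF assms] in \<open>auto simp: top_dim_def\<close>)
  then have "ochains (below Q q) (top_dim q + 1) = {0 :: 'a set \<Rightarrow> 'k}"
    using chains_zero by blast
  then show ?thesis
    by (simp add: boundaries_def)
qed

definition fund_cycle :: "'a \<Rightarrow> 'a set \<Rightarrow> 'k" where
  "fund_cycle q = (THE z. \<exists>j. hbasis (order_complex (below Q q)) j = {z})"

lemma hbasis_below:
  assumes "q \<in> Q"
  shows "(hbasis (order_complex (below Q q)) j :: ('a set \<Rightarrow> 'k) set) =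
    (if j = top_dim q then {fund_cycle q} else {})"
proof -
  let ?b = "\<lambda>j. hbasis (order_complex (below Q q)) j :: ('a set \<Rightarrow> 'k) set"
  have card: "card (?b j) = (if j = top_dim q then 1 else 0)" for j
    using ohdim_below[OF assms, of j] by (simp add: hdim_def)
  have "finite (?b j)" for j
    using rel_basis_hbasis[OF finite_below_Q, of q j, where 'k='k] by (simp add: rel_basis_def)
  then have empty: "?b j = {}" if "j \<noteq> top_dim q" for j
    using card[of j] that by simp
  obtain z where z: "?b (top_dim q) = {z}"
    using card[of "top_dim q"] by (auto simp: card_1_singleton_iff)
  then have "fund_cycle q = z"
    unfolding fund_cycle_def
    by (intro the_equality) (use empty in blast, metis empty singleton_inject insert_not_empty)
  then show ?thesis
    using z empty by simp
qed

lemma rel_basis_fund_cycle: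
  assumes "q \<in> Q"
  shows "rel_basis (ocycles (below Q q) (top_dim q)) {0} {fund_cycle q}"
  using rel_basis_hbasis[OF finite_below_Q, of q "top_dim q", where 'k='k]
  by (simp add: hbasis_below[OF assms] obounds_top_dim[OF assms])

lemma fund_cycle_nonzero:
  assumes "q \<in> Q"
  shows "fund_cycle q \<noteq> 0"
  using rel_basis_disjoint[OF ocycles_subspace[OF finite_below_Q] fun_space.subspace_single_0
      rel_basis_fund_cycle[OF assms]]
  by blast

lemma scale_fund_cycle_eq_iff: "q \<in> Q \<Longrightarrow> a *\<^sub>F fund_cycle q = b *\<^sub>F fund_cycle q \<longleftrightarrow> a = b"
  using fund_cycle_nonzero by (simp add: fun_space.scale_cancel_right)

lemma fund_cycle_in_ocycles:
  assumes "q \<in> proper Q"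
  shows "fund_cycle q \<in> ocycles (below Q q) (int (rank q) - 2)"
  using rel_basis_fund_cycle[OF properD[OF assms]] top_dim_proper[OF assms]
  by (simp add: rel_basis_def)

lemma fund_cycle_in_ochains:
  assumes "q \<in> proper Q"
  shows "fund_cycle q \<in> ochains (below Q q) (int (rank q) - 2)" "bdry (fund_cycle q) = 0"
  using fund_cycle_in_ocycles[OF assms] by (auto simp: cycles_def)

lemma ocycle_multiple_of_fund_cycle:
  assumes "q \<in> proper Q" "c \<in> ocycles (below Q q) (int (rank q) - 2)"
  obtains a where "c = a *\<^sub>F fund_cycle q"
proof -
  have "c \<in> ocycles (below Q q) (top_dim q)"
    using assms by (simp add: top_dim_proper)
  then obtain u where "c - lincomb u {fund_cycle q} \<in> {0}"
    using rel_basis_fund_cycle[OF properD[OF assms(1)]] unfolding rel_basis_def by blast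
  then have "c = u (fund_cycle q) *\<^sub>F fund_cycle q"
    by (simp add: lincomb_singleton)
  then show thesis by (rule that)
qed

lemma hcoord_fund_cycle:
  assumes "q \<in> Q" "j = top_dim q"
  shows "hcoord (order_complex (below Q q)) j
    (hclass (order_complex (below Q q)) j (a *\<^sub>F fund_cycle q)) (fund_cycle q) = a"
proof -
  let ?K = "order_complex (below Q q)"
  let ?P = "\<lambda>u. (\<forall>x. x \<notin> {fund_cycle q} \<longrightarrow> u x = 0) \<and>
    hclass ?K j (a *\<^sub>F fund_cycle q) = hclass ?K j (lincomb u {fund_cycle q})"
  have "?P u \<longleftrightarrow> u = (\<lambda>x. if x = fund_cycle q then a else 0)" for u
  proof -
    have "?P u \<longleftrightarrow> (\<forall>x. x \<noteq> fund_cycle q \<longrightarrow> u x = 0) \<and> a = u (fund_cycle q)"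
      unfolding hclass_eq_iff[OF finite_below_Q] assms(2) obounds_top_dim[OF assms(1)]
        lincomb_singleton
      by (simp add: fund_cycle_nonzero[OF assms(1)])
    then show ?thesis
      by (auto simp: fun_eq_iff[of u])
  qed
  then have "(THE u. ?P u) = (\<lambda>x. if x = fund_cycle q then a else 0)"
    by simp
  then show ?thesis
    unfolding hcoord_def by (simp add: hbasis_below[OF assms(1)] assms(2))
qed

text \<open>A face with as many vertices as possible contains exactly one element of the top rank.\<close>

lemma top_rank_decompose:
  assumes "c \<in> ochains A i" "A \<subseteq> proper Q" "\<And>x. x \<in> A \<Longrightarrow> rank x \<le> n" "i + 1 = int n" "1 \<le> n"
  shows "c = (\<Sum>q | q \<in> A \<and> rank q = n. cone q (link q c))"
proof
  fix \<sigma>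
  have cone_link: "cone q (link q c) \<sigma> = (if q \<in> \<sigma> then c \<sigma> else 0)" for q
    by (simp add: cone_def link_def insert_absorb)
  show "c \<sigma> = (\<Sum>q | q \<in> A \<and> rank q = n. cone q (link q c)) \<sigma>"
  proof (cases "c \<sigma> = 0")
    case True
    then show ?thesis
      by (simp add: sum_fun_apply cone_link sum.neutral)
  next
    case False
    note face = chainsD[OF assms(1) False] and sub = ochains_face_subset[OF assms(1) False]
    have inj: "inj_on rank \<sigma>" and "\<exists>x\<in>\<sigma>. rank x = n"
      using rank_on_face[OF face(1) assms(2), of n] face(2) assms(3-5) sub by auto
    then obtain q0 where q0: "q0 \<in> \<sigma>" "rank q0 = n" by blast
    have "(\<Sum>q | q \<in> A \<and> rank q = n. cone q (link q c)) \<sigma> =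
        (\<Sum>q | q \<in> A \<and> rank q = n. if q = q0 then c \<sigma> else 0)"
      unfolding sum_fun_apply cone_link using q0 inj by (intro sum.cong) (auto dest: inj_onD)
    also have "\<dots> = c \<sigma>"
      using q0 subsetD[OF sub q0(1)] finite_subset[OF assms(2) finite_proper_Q] by simp
    finally show ?thesis ..
  qed
qed

end

section \<open>Incidence coefficients and exactness\<close>

context rigid_poset
begin

definition incidence :: "'a \<Rightarrow> 'a \<Rightarrow> 'k" where
  "incidence q p = (if p = pbot Q then 1 else THE a. link p (fund_cycle q) = a *\<^sub>F fund_cycle p)"

definition level :: "nat \<Rightarrow> 'a set" where
  "level i = {q \<in> Q. rank q = i}"

lemma level_0: "level 0 = {pbot Q}"
  using finite_pointedD(2)[OF pointed] rank_eq_0_iff rank_pbot by (auto simp: level_def)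

lemma level_Suc: "level (Suc i) = {q \<in> proper Q. rank q = Suc i}"
  using rank_pbot by (auto simp: level_def proper_eq[OF pointed])

lemma finite_level [simp]: "finite (level i)"
  using finite_pointedD(1)[OF pointed] by (simp add: level_def)

lemma level_SucD: "q \<in> level (Suc i) \<Longrightarrow> q \<in> proper Q" "q \<in> level (Suc i) \<Longrightarrow> rank q = Suc i"
  by (simp_all add: level_Suc)

lemma fund_cycle_minimal:
  assumes "q \<in> level (Suc 0)"
  shows "fund_cycle q = fund_cycle (pbot Q)"
proof -
  have "below Q q = {}"
    using assms below_memD[of q] rank_pos by (fastforce simp: level_def)
  then show ?thesis
    by (simp add: fund_cycle_def below_pbot)
qed

lemma comparables_below:
  assumes "p \<in> proper Q" "q \<in> proper Q" "rank q = Suc (rank p)"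
  shows "comparables (below Q q) p \<subseteq> below Q p"
proof
  fix x assume x: "x \<in> comparables (below Q q) p"
  then have "x \<in> proper Q" "x < q" "x < p \<or> p < x"
    by (auto simp: comparables_def below_eq)
  moreover have "\<not> p < x"
    using rank_strict_mono_proper[of p x] rank_strict_mono_proper[of x q] assms calculation by auto
  ultimately show "x \<in> below Q p"
    by (simp add: below_eq)
qed

lemma link_fund_cycle:
  assumes "p \<in> proper Q" "q \<in> proper Q" "rank q = Suc (rank p)"
  shows "link p (fund_cycle q) = incidence q p *\<^sub>F fund_cycle p"
proof -
  have "link p (fund_cycle q) \<in> ocycles (comparables (below Q q) p) (int (rank q) - 2 - 1)"
    using link_in_ocycles[OF finite_below_Q fund_cycle_in_ochains(1)[OF assms(2)], of p]
    by (simp add: fund_cycle_in_ochains(2)[OF assms(2)])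
  then have "link p (fund_cycle q) \<in> ocycles (below Q p) (int (rank p) - 2)"
    using ocycles_mono[OF comparables_below[OF assms]] assms(3) by auto
  then obtain a where a: "link p (fund_cycle q) = a *\<^sub>F fund_cycle p"
    using ocycle_multiple_of_fund_cycle[OF assms(1)] by metis
  then have "incidence q p = a"
    using assms(1) fund_cycle_nonzero[OF properD[OF assms(1)]]
    by (simp add: incidence_def proper_eq[OF pointed])
  with a show ?thesis by simp
qed

lemma incidence_eq_0:
  assumes "p \<in> proper Q" "q \<in> proper Q" "rank q = Suc (rank p)" "\<not> p < q"
  shows "incidence q p = 0"
proof -
  have "link p (fund_cycle q) = 0"
    by (rule link_eq_0[OF fund_cycle_in_ochains(1)[OF assms(2)]])
      (use assms(4) in \<open>simp add: below_eq\<close>)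
  then show ?thesis
    using link_fund_cycle[OF assms(1-3)] fund_cycle_nonzero[OF properD[OF assms(1)]]
    by (simp add: fun_space.scale_eq_0_iff)
qed

lemma comparables_insert_below: "comparables (insert q (below Q q)) q = below Q q"
  by (auto simp: comparables_def below_eq)

lemma cone_fund_cycle_in_ochains:
  assumes "q \<in> proper Q"
  shows "cone q (a *\<^sub>F fund_cycle q) \<in> ochains (insert q (below Q q)) (int (rank q) - 1)"
  using cone_in_ochains[of q "insert q (below Q q)" "a *\<^sub>F fund_cycle q" "int (rank q) - 2"]
    chains_scale[OF fund_cycle_in_ochains(1)[OF assms]] by (simp add: comparables_insert_below)

lemma bdry_cone_fund_cycle:
  assumes "q \<in> proper Q"
  shows "bdry (cone q (a *\<^sub>F fund_cycle q)) = a *\<^sub>F fund_cycle q"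
proof -
  have "bdry (cone q (a *\<^sub>F fund_cycle q)) = a *\<^sub>F fund_cycle q - cone q (bdry (a *\<^sub>F fund_cycle q))"
    using bdry_cone[of "insert q (below Q q)" q "a *\<^sub>F fund_cycle q" "int (rank q) - 2"]
      chains_scale[OF fund_cycle_in_ochains(1)[OF assms]] by (simp add: comparables_insert_below)
  also have "bdry (a *\<^sub>F fund_cycle q) = 0"
    using bdry_scale[OF finite_below_Q fund_cycle_in_ochains(1)[OF assms]]
      fund_cycle_in_ochains(2)[OF assms]
    by simp
  finally show ?thesis
    by (simp only: cone_zero diff_zero)
qed

lemma bdry_sum_cones:
  assumes "S \<subseteq> level (Suc i)"
  shows "bdry (\<Sum>q\<in>S. cone q (x q *\<^sub>F fund_cycle q)) = (\<Sum>q\<in>S. x q *\<^sub>F fund_cycle q)"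
proof -
  have proper: "q \<in> proper Q" "rank q = Suc i" if "q \<in> S" for q
    using assms that level_SucD by blast+
  have "cone q (x q *\<^sub>F fund_cycle q) \<in> ochains (proper Q) (int i)" if "q \<in> S" for q
    using ochains_mono[OF cone_fund_cycle_in_ochains, of q "proper Q" "x q"] proper[OF that]
    by (auto simp: below_eq)
  then have "bdry (\<Sum>q\<in>S. cone q (x q *\<^sub>F fund_cycle q)) =
      (\<Sum>q\<in>S. bdry (cone q (x q *\<^sub>F fund_cycle q)))"
    by (intro bdry_sum[OF finite_proper_Q])
  also have "\<dots> = (\<Sum>q\<in>S. x q *\<^sub>F fund_cycle q)"
    by (intro sum.cong refl bdry_cone_fund_cycle proper(1))
  finally show ?thesis .
qed

lemma link_sum_cones:
  assumes "S \<subseteq> level (Suc i)" "q \<in> S"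
  shows "link q (\<Sum>p\<in>S. cone p (x p *\<^sub>F fund_cycle p)) = x q *\<^sub>F fund_cycle q"
proof -
  have proper: "p \<in> proper Q" "rank p = Suc i" if "p \<in> S" for p
    using assms(1) that level_SucD by blast+
  have "link q (cone p (x p *\<^sub>F fund_cycle p)) = (if p = q then x q *\<^sub>F fund_cycle q else 0)"
    if p: "p \<in> S" for p
  proof (cases "p = q")
    case True
    then show ?thesis
      using link_cone[OF chains_scale[OF fund_cycle_in_ochains(1)[OF proper(1)[OF assms(2)]]]]
      by (simp add: below_def)
  next
    case False
    have "q \<notin> insert p (below Q p)"
      using False rank_neq[of q p] proper[OF p] proper[OF assms(2)] by (auto simp: below_eq)
    then show ?thesis
      using link_eq_0[OF cone_fund_cycle_in_ochains[OF proper(1)[OF p]]] False by simp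
  qed
  then have "link q (\<Sum>p\<in>S. cone p (x p *\<^sub>F fund_cycle p)) =
      (\<Sum>p\<in>S. if p = q then x q *\<^sub>F fund_cycle q else 0)"
    unfolding link_sum by (rule sum.cong[OF refl])
  also have "\<dots> = x q *\<^sub>F fund_cycle q"
    using assms(2) finite_subset[OF assms(1) finite_level] by simp
  finally show ?thesis .
qed

text \<open>If \<open>incidence q p \<noteq> 0\<close>, the cycle below \<open>p\<close> bounds already before \<open>p\<close> is attached: up to a
  factor, it is the boundary of the part of \<open>fund_cycle q\<close> avoiding \<open>p\<close>.\<close>

lemma ohdim_remove_le_if_incidence:
  assumes A: "down_closed (proper Q) A" "p \<in> A" "\<And>x. x \<in> A \<Longrightarrow> \<not> p < x"
    and q: "q \<in> proper Q" "rank q = Suc (rank p)" "below Q q \<subseteq> A" and inc: "incidence q p \<noteq> 0"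
  shows "ohdim k (A - {p}) (int (rank p) - 2) \<le> ohdim k A (int (rank p) - 2)"
proof (rule ohdim_remove_le_if_link_bounds)
  let ?j = "int (rank p) - 2"
  have p: "p \<in> proper Q"
    using A(1,2) by (auto simp: down_closed_def)
  show fin: "finite A" and "p \<in> A"
    using down_closed_finite[OF pointed A(1)] A(2) by auto
  have z: "fund_cycle q \<in> ochains A (?j + 1)"
    using ochains_mono[OF fund_cycle_in_ochains(1)[OF q(1)] q(3)] q(2) by simp
  have "bdry (deletion p (fund_cycle q)) = - link p (fund_cycle q)"
    using bdry_decompose_if_bdry_avoids[OF fin A(2) z] fund_cycle_in_ochains(2)[OF q(1)]
    by (simp add: eq_neg_iff_add_eq_0 add.commute)
  then have "bdry (deletion p (fund_cycle q)) = - incidence q p *\<^sub>F fund_cycle p"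
    using link_fund_cycle[OF p q(1,2)] by simp
  then have "- incidence q p *\<^sub>F fund_cycle p \<in> obounds (A - {p}) ?j"
    using bdry_in_obounds[OF deletion_in_ochains[OF z]] by metis
  then have "(- a / incidence q p) *\<^sub>F (- incidence q p *\<^sub>F fund_cycle p) \<in> obounds (A - {p}) ?j"
    for a
    by (rule fun_space.subspace_scale[OF obounds_subspace, rotated]) (use fin in simp)
  then have multiples: "a *\<^sub>F fund_cycle p \<in> obounds (A - {p}) ?j" for a
    using inc by simp
  have "comparables A p = below Q p"
    unfolding below_eq by (rule comparables_maximal[OF A])
  then show "(ocycles (comparables A p) ?j :: ('a set \<Rightarrow> 'k) set) \<subseteq> obounds (A - {p}) ?j"
    using ocycle_multiple_of_fund_cycle[OF p] multiples by (metis subsetI)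
qed

lemma link_sum_fund_cycles:
  assumes "S \<subseteq> level (Suc (rank p))" "p \<in> proper Q"
  shows "link p (\<Sum>q\<in>S. x q *\<^sub>F fund_cycle q) = (\<Sum>q\<in>S. x q * incidence q p) *\<^sub>F fund_cycle p"
proof -
  have "x q *\<^sub>F link p (fund_cycle q) = (x q * incidence q p) *\<^sub>F fund_cycle p" if "q \<in> S" for q
    using link_fund_cycle[OF assms(2), of q] assms(1) that level_SucD by fastforce
  then show ?thesis
    unfolding link_sum link_scale fun_space.scale_sum_left by (rule sum.cong[OF refl])
qed

lemma sum_incidence_fund_cycle:
  assumes "q \<in> level (Suc (Suc i))"
  shows "(\<Sum>p\<in>level (Suc i). incidence q p *\<^sub>F fund_cycle p) = 0"
proof -
  note q = level_SucD[OF assms]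
  let ?S = "{p \<in> below Q q. rank p = Suc i}"
  have S: "?S \<subseteq> level (Suc i)"
    by (auto simp: level_Suc below_eq)
  have "fund_cycle q = (\<Sum>p\<in>?S. cone p (link p (fund_cycle q)))"
    using q below_memD[OF properD[OF q(1)]]
    by (intro top_rank_decompose[OF fund_cycle_in_ochains(1)[OF q(1)]]) auto
  also have "\<dots> = (\<Sum>p\<in>?S. cone p (incidence q p *\<^sub>F fund_cycle p))"
  proof (rule sum.cong[OF refl])
    fix p assume "p \<in> ?S"
    then have "link p (fund_cycle q) = incidence q p *\<^sub>F fund_cycle p"
      using q by (intro link_fund_cycle) (auto simp: below_eq)
    then show "cone p (link p (fund_cycle q)) = cone p (incidence q p *\<^sub>F fund_cycle p)"
      by (rule arg_cong)
  qed
  finally have "bdry (fund_cycle q) = bdry (\<Sum>p\<in>?S. cone p (incidence q p *\<^sub>F fund_cycle p))"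
    by (rule arg_cong)
  also have "\<dots> = (\<Sum>p\<in>?S. incidence q p *\<^sub>F fund_cycle p)"
    by (rule bdry_sum_cones[OF S])
  finally have "(\<Sum>p\<in>?S. incidence q p *\<^sub>F fund_cycle p) = 0"
    using fund_cycle_in_ochains(2)[OF q(1)] by simp
  moreover have "(\<Sum>p\<in>level (Suc i). incidence q p *\<^sub>F fund_cycle p) =
      (\<Sum>p\<in>?S. incidence q p *\<^sub>F fund_cycle p)"
    by (rule sum.mono_neutral_right)
      (use S incidence_eq_0[OF _ q(1)] q(2) in \<open>auto simp: level_Suc below_eq\<close>)
  ultimately show ?thesis by simp
qed

lemma sum_incidence_eq_0_if_sum_fund_cycles_eq_0:
  assumes "S \<subseteq> level (Suc i)" "(\<Sum>q\<in>S. x q *\<^sub>F fund_cycle q) = 0" "p \<in> level i"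
  shows "(\<Sum>q\<in>S. x q * incidence q p) = 0"
proof (cases i)
  case 0
  then have p: "p = pbot Q"
    using assms(3) by (simp add: level_0)
  have "(\<Sum>q\<in>S. x q) *\<^sub>F fund_cycle (pbot Q) = (\<Sum>q\<in>S. x q *\<^sub>F fund_cycle q)"
    unfolding fun_space.scale_sum_left using assms(1) fund_cycle_minimal 0 by (intro sum.cong) auto
  then have "(\<Sum>q\<in>S. x q) = 0"
    using assms(2) fund_cycle_nonzero[OF finite_pointedD(2)[OF pointed]]
    by (simp add: fun_space.scale_eq_0_iff)
  then show ?thesis
    by (simp add: p incidence_def)
next
  case (Suc j)
  have p: "p \<in> proper Q" "S \<subseteq> level (Suc (rank p))"
    using assms(1,3) level_SucD Suc by auto
  have "(\<Sum>q\<in>S. x q * incidence q p) *\<^sub>F fund_cycle p = 0"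
    using link_sum_fund_cycles[OF p(2,1), of x] assms(2) by simp
  then show ?thesis
    using fund_cycle_nonzero[OF properD[OF p(1)]] by (simp add: fun_space.scale_eq_0_iff)
qed

lemma incidence_incidence:
  assumes "q \<in> level (Suc (Suc i))" "p \<in> level i"
  shows "(\<Sum>m\<in>level (Suc i). incidence q m * incidence m p) = 0"
  by (rule sum_incidence_eq_0_if_sum_fund_cycles_eq_0[OF subset_refl
        sum_incidence_fund_cycle[OF assms(1)] assms(2)])

lemma sum_fund_cycles_eq_0_if_sum_incidence_eq_0:
  assumes U: "down_closed (proper Q) U"
    and x: "\<And>p. p \<in> insert (pbot Q) U \<Longrightarrow> rank p = i \<Longrightarrow> (\<Sum>q\<in>U \<inter> level (Suc i). x q * incidence q p) = 0"
  shows "(\<Sum>q\<in>U \<inter> level (Suc i). x q *\<^sub>F fund_cycle q) = 0"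
proof (cases i)
  case 0
  then have "(\<Sum>q\<in>U \<inter> level (Suc i). x q *\<^sub>F fund_cycle q) =
      (\<Sum>q\<in>U \<inter> level (Suc i). x q * incidence q (pbot Q)) *\<^sub>F fund_cycle (pbot Q)"
    unfolding fun_space.scale_sum_left
    by (intro sum.cong) (auto simp: fund_cycle_minimal incidence_def)
  then show ?thesis
    using x[of "pbot Q"] 0 by (simp add: rank_pbot)
next
  case (Suc j)
  have UQ: "U \<subseteq> proper Q"
    using U by (simp add: down_closed_def)
  let ?S = "U \<inter> level (Suc i)" and ?A = "{p \<in> U. rank p \<le> i}"
  define c where "c = (\<Sum>q\<in>?S. x q *\<^sub>F fund_cycle q)"
  have c: "c \<in> ochains ?A (int i - 1)"
    unfolding c_def
  proof (rule chains_sum)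
    fix q assume q: "q \<in> ?S"
    then have qQ: "q \<in> proper Q" "rank q = Suc i"
      using level_SucD by auto
    have "below Q q \<subseteq> ?A"
      using q qQ below_subset_down_closed[OF U, of q] below_memD(3)[OF properD[OF qQ(1)]] by force
    then show "x q *\<^sub>F fund_cycle q \<in> ochains ?A (int i - 1)"
      using ochains_mono[OF chains_scale[OF fund_cycle_in_ochains(1)[OF qQ(1)]]] qQ(2) by simp
  qed
  have "link p c = 0" if "p \<in> ?A" "rank p = i" for p
    using link_sum_fund_cycles[of ?S p x] x[of p] UQ that unfolding c_def by auto
  moreover have "c = (\<Sum>p | p \<in> ?A \<and> rank p = i. cone p (link p c))"
    by (rule top_rank_decompose[OF c]) (use UQ Suc in auto)
  ultimately show ?thesis
    unfolding c_def[symmetric] by (metis (mono_tags, lifting) cone_zero mem_Collect_eq sum.neutral)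
qed

lemma push_off_maximal:
  fixes e :: "'a set \<Rightarrow> 'k"
  assumes U: "down_closed (proper Q) U" and q: "q \<in> U" "\<And>x. x \<in> U \<Longrightarrow> \<not> q < x"
    and e: "e \<in> ochains U i" "bdry e \<in> ochains (U - {q}) (i - 1)" and i: "i < int (rank q) - 1"
  obtains d where "d \<in> ochains U (i + 1)" "e - bdry d \<in> ochains (U - {q}) i"
proof -
  note fin = down_closed_finite[OF pointed U]
  have comparables: "comparables U q = below Q q"
    unfolding below_eq by (rule comparables_maximal[OF U q])
  have "q \<in> proper Q"
    using U q(1) by (auto simp: down_closed_def)
  then have "ohdim k (below Q q) (i - 1) = 0"
    using ohdim_below_proper[of q "i - 1"] i by simp
  then have "link q e \<in> obounds (comparables U q) (i - 1)"
    using link_in_ocycles[OF fin e] ohdim_eq_0_iff[OF finite_below_Q] unfolding comparables by blast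
  then show thesis
    by (rule push_off_vertex[OF fin q(1) e(1) _ that])
qed

lemma push_below_rank:
  fixes e :: "'a set \<Rightarrow> 'k"
  assumes "down_closed (proper Q) U" "e \<in> ochains U i"
    "bdry e \<in> ochains {q \<in> U. rank q \<le> n} (i - 1)" "i < int n"
  shows "\<exists>d\<in>ochains U (i + 1). e - bdry d \<in> ochains {q \<in> U. rank q \<le> n} i"
  using down_closed_finite[OF pointed assms(1)] assms(1-3)
proof (induction U arbitrary: e rule: finite_psubset_induct)
  case (psubset U)
  note U = psubset.hyps and down = psubset.prems(1) and e = psubset.prems(2,3)
  show ?case
  proof (cases "\<forall>q\<in>U. rank q \<le> n")
    case True
    then have "e - bdry 0 \<in> ochains {q \<in> U. rank q \<le> n} i"
      using e(1) by (simp add: Collect_mem_eq conj_absorb cong: conj_cong)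
    then show ?thesis
      using chains_zero by blast
  next
    case False
    then obtain q where q: "q \<in> U" "n < rank q" "\<not> (\<exists>x\<in>{q \<in> U. n < rank q}. q < x)"
      using ex_max_if_finite[of "{q \<in> U. n < rank q}"] U by (auto simp: not_le)
    have UQ: "U \<subseteq> proper Q"
      using down by (simp add: down_closed_def)
    have max: "\<not> q < x" if "x \<in> U" for x
      using that q rank_strict_mono_proper[OF subsetD[OF UQ q(1)] subsetD[OF UQ that]] by auto
    have low: "{x \<in> U - {q}. rank x \<le> n} = {x \<in> U. rank x \<le> n}"
      using q(2) by auto
    have "bdry e \<in> ochains (U - {q}) (i - 1)"
      by (rule ochains_mono[OF e(2)]) (use q(2) in auto)
    then obtain d where d: "d \<in> ochains U (i + 1)" "e - bdry d \<in> ochains (U - {q}) i"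
      using push_off_maximal[OF down q(1) max e(1)] q(2) assms(4) by auto
    have "bdry (e - bdry d) \<in> ochains {x \<in> U - {q}. rank x \<le> n} (i - 1)"
      unfolding low bdry_diff_bdry[OF U e(1) d(1)] by (rule e(2))
    then obtain d' where d': "d' \<in> ochains (U - {q}) (i + 1)"
        "e - bdry d - bdry d' \<in> ochains {x \<in> U. rank x \<le> n} i"
      using psubset.IH[OF _ down_closed_remove_maximal[OF down max] d(2)] q(1) unfolding low
      by blast
    have d'U: "d' \<in> ochains U (i + 1)"
      by (rule ochains_mono[OF d'(1)]) auto
    then show ?thesis
      using d'(2) chains_add[OF d(1) d'U] bdry_add[OF U d(1) d'U] by (metis diff_diff_eq)
  qed
qed

lemma top_rank_chain_eq_sum_cones:
  fixes e :: "'a set \<Rightarrow> 'k"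
  assumes U: "U \<subseteq> proper Q" and e: "e \<in> ochains {q \<in> U. rank q \<le> Suc i} (int i)"
    and be: "bdry e \<in> ochains {q \<in> U. rank q \<le> i} (int i - 1)"
  shows "\<exists>y. e = (\<Sum>q\<in>U \<inter> level (Suc i). cone q (y q *\<^sub>F fund_cycle q))"
proof -
  let ?A = "{q \<in> U. rank q \<le> Suc i}" and ?S = "U \<inter> level (Suc i)"
  have fin: "finite ?A"
    using finite_subset[OF U finite_proper_Q] by simp
  have "\<exists>a. link q e = a *\<^sub>F fund_cycle q" if q: "q \<in> ?S" for q
  proof -
    have qQ: "q \<in> proper Q" "rank q = Suc i"
      using q level_SucD by auto
    have "x \<in> below Q q" if "x \<in> comparables ?A q" for x
      using that U qQ rank_strict_mono_proper[OF qQ(1), of x]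
      by (auto simp: comparables_def below_eq)
    then have "comparables ?A q \<subseteq> below Q q" by blast
    moreover have "link q e \<in> ocycles (comparables ?A q) (int i - 1)"
      by (rule link_in_ocycles[OF fin e ochains_mono[OF be]]) (use qQ in auto)
    ultimately have "link q e \<in> ocycles (below Q q) (int (rank q) - 2)"
      using ocycles_mono[of "comparables ?A q" "below Q q"] qQ(2) by auto
    then show ?thesis
      using ocycle_multiple_of_fund_cycle[OF qQ(1)] by metis
  qed
  then obtain y where y: "\<And>q. q \<in> ?S \<Longrightarrow> link q e = y q *\<^sub>F fund_cycle q"
    by metis
  have "e = (\<Sum>q | q \<in> ?A \<and> rank q = Suc i. cone q (link q e))"
    by (rule top_rank_decompose[OF e]) (use U in auto)
  also have "{q. q \<in> ?A \<and> rank q = Suc i} = ?S"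
    using U by (auto simp: level_Suc)
  also have "(\<Sum>q\<in>?S. cone q (link q e)) = (\<Sum>q\<in>?S. cone q (y q *\<^sub>F fund_cycle q))"
    by (rule sum.cong[OF refl]) (simp only: y)
  finally show ?thesis by blast
qed

lemma bounding_cycle_eq_sum_fund_cycles:
  fixes c :: "'a set \<Rightarrow> 'k"
  assumes U: "down_closed (proper Q) U"
    and c: "c \<in> ochains {q \<in> U. rank q \<le> i} (int i - 1)" "c \<in> obounds U (int i - 1)"
  shows "\<exists>y. c = (\<Sum>q\<in>U \<inter> level (Suc i). y q *\<^sub>F fund_cycle q)"
proof -
  have finU: "finite U" and UQ: "U \<subseteq> proper Q"
    using down_closed_finite[OF pointed U] U by (auto simp: down_closed_def)
  obtain e where e: "e \<in> ochains U (int i)" "bdry e = c"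
    using c(2) by (auto simp: obounds_iff)
  have "c \<in> ochains {q \<in> U. rank q \<le> Suc i} (int i - 1)"
    by (rule ochains_mono[OF c(1)]) auto
  then obtain d where d: "d \<in> ochains U (int i + 1)"
      "e - bdry d \<in> ochains {q \<in> U. rank q \<le> Suc i} (int i)"
    using push_below_rank[OF U e(1), of "Suc i"] e(2) by auto
  then have "bdry (e - bdry d) = c"
    using bdry_diff_bdry[OF finU e(1)] e(2) by simp
  moreover from this obtain y
    where "e - bdry d = (\<Sum>q\<in>U \<inter> level (Suc i). cone q (y q *\<^sub>F fund_cycle q))"
    using top_rank_chain_eq_sum_cones[OF UQ d(2)] c(1) by auto
  ultimately show ?thesis
    using bdry_sum_cones[of "U \<inter> level (Suc i)" i y] by auto
qed

lemma sum_cones_in_ochains: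
  assumes U: "down_closed (proper Q) U"
  shows "(\<Sum>q\<in>U \<inter> level (Suc i). cone q (x q *\<^sub>F fund_cycle q)) \<in>
    ochains {q \<in> U. rank q \<le> Suc i} (int i)"
proof (rule chains_sum)
  fix q assume "q \<in> U \<inter> level (Suc i)"
  then have q: "q \<in> U" "q \<in> proper Q" "rank q = Suc i"
    using level_SucD by auto
  have "insert q (below Q q) \<subseteq> {q \<in> U. rank q \<le> Suc i}"
    using q below_subset_down_closed[OF U q(1)] below_memD(3)[OF properD[OF q(2)]] by force
  then show "cone q (x q *\<^sub>F fund_cycle q) \<in> ochains {q \<in> U. rank q \<le> Suc i} (int i)"
    using ochains_mono[OF cone_fund_cycle_in_ochains[OF q(2)]] q(3) by simp
qed

lemma sum_fund_cycles_exact: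
  assumes U: "down_closed (proper Q) U" "acyclic_over k U"
    and x: "(\<Sum>q\<in>U \<inter> level (Suc i). x q *\<^sub>F fund_cycle q) = 0"
  shows "\<exists>y. \<forall>p\<in>U \<inter> level (Suc i). x p = (\<Sum>q\<in>U \<inter> level (Suc (Suc i)). y q * incidence q p)"
proof -
  let ?S = "U \<inter> level (Suc i)" and ?A = "{q \<in> U. rank q \<le> Suc i}"
  define c where "c = (\<Sum>q\<in>?S. cone q (x q *\<^sub>F fund_cycle q))"
  have c: "c \<in> ochains ?A (int (Suc i) - 1)"
    using sum_cones_in_ochains[OF U(1)] by (simp add: c_def)
  have "bdry c = 0"
    using bdry_sum_cones[of ?S i x] x unfolding c_def by simp
  then have "c \<in> ocycles U (int (Suc i) - 1)"
    using ochains_mono[OF c, of U] by (auto simp: cycles_def)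
  then have "c \<in> obounds U (int (Suc i) - 1)"
    using U(2) unfolding acyclic_over_def by blast
  then obtain y where y: "c = (\<Sum>q\<in>U \<inter> level (Suc (Suc i)). y q *\<^sub>F fund_cycle q)"
    using bounding_cycle_eq_sum_fund_cycles[OF U(1) c] by blast
  have "x p = (\<Sum>q\<in>U \<inter> level (Suc (Suc i)). y q * incidence q p)" if p: "p \<in> ?S" for p
  proof -
    have pQ: "p \<in> proper Q" "rank p = Suc i"
      using p level_SucD by auto
    have "x p *\<^sub>F fund_cycle p = link p c"
      unfolding c_def by (rule link_sum_cones[OF _ p, symmetric]) (rule Int_lower2)
    also have "\<dots> = (\<Sum>q\<in>U \<inter> level (Suc (Suc i)). y q * incidence q p) *\<^sub>F fund_cycle p"
      unfolding y using pQ by (intro link_sum_fund_cycles) auto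
    finally show ?thesis
      by (simp only: scale_fund_cycle_eq_iff[OF properD[OF pQ(1)]])
  qed
  then show ?thesis by blast
qed

lemma incidence_exact:
  assumes U: "down_closed (proper Q) U" "U = {} \<or> acyclic_over k U"
    and x: "\<And>p. p \<in> insert (pbot Q) U \<Longrightarrow> rank p = i \<Longrightarrow> (\<Sum>q\<in>U \<inter> level (Suc i). x q * incidence q p) = 0"
  shows "\<exists>y. \<forall>p\<in>U \<inter> level (Suc i). x p = (\<Sum>q\<in>U \<inter> level (Suc (Suc i)). y q * incidence q p)"
  using U(2) sum_fund_cycles_exact[OF U(1) _ sum_fund_cycles_eq_0_if_sum_incidence_eq_0[OF U(1) x]]
  by auto

end

section \<open>The maps between the homology groups\<close>

lemma mv_connect_add:
  fixes z' z'' :: "'a::order set \<Rightarrow> 'k::field"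
  assumes z': "z' \<in> chains K1 i" and z'': "z'' \<in> chains K2 i"
    and no_common_face: "\<And>\<sigma>. \<sigma> \<in> K1 \<Longrightarrow> \<sigma> \<in> K2 \<Longrightarrow> int (card \<sigma>) \<noteq> i + 1"
  shows "mv_connect K1 K2 i {z' + z''} = {bdry z'}"
proof -
  have "chains (K1 \<inter> K2) i = {0 :: 'a set \<Rightarrow> 'k}"
    using no_common_face by (fastforce simp: chains_def fun_eq_iff)
  then have hclass: "hclass (K1 \<inter> K2) (i - 1) w = {w :: 'a set \<Rightarrow> 'k}" for w
    by (simp add: hclass_def boundaries_def)
  have unique: "w' = z'" if "z' + z'' = w' + w''" "w' \<in> chains K1 i" "w'' \<in> chains K2 i" for w' w''
  proof
    fix \<sigma>
    have "z' \<sigma> + z'' \<sigma> = w' \<sigma> + w'' \<sigma>"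
      using that(1) by (metis plus_fun_apply)
    moreover have "z' \<sigma> = 0 \<and> w' \<sigma> = 0 \<or> z'' \<sigma> = 0 \<and> w'' \<sigma> = 0"
      using no_common_face[of \<sigma>] z' z'' that(2,3) by (auto simp: chains_def)
    ultimately show "w' \<sigma> = z' \<sigma>" by auto
  qed
  show ?thesis
    unfolding mv_connect_def hclass using z' z'' unique by (intro the_equality) blast+
qed

context rigid_poset
begin

lemma coversI:
  assumes "p \<in> Q" "q \<in> Q" "p < q" "rank q = Suc (rank p)"
  shows "covers Q q p"
proof -
  have "\<not> (p < x \<and> x < q)" if "x \<in> Q" for x
    using rank_strict_mono[OF assms(1) that] rank_strict_mono[OF that assms(2)] assms(4) by auto
  then show ?thesis
    using assms by (auto simp: covers_def)
qed

lemma Delta_closed_le: "Delta_closed Q p = order_complex {x \<in> proper Q. x \<le> p}"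
  unfolding Delta_closed_def proper_def by (rule arg_cong[of _ _ order_complex]) auto

lemma top_face_contains_vertex:
  assumes "p \<in> proper Q" "\<sigma> \<in> Delta_closed Q p" "card \<sigma> = rank p"
  shows "p \<in> \<sigma>"
proof -
  have face: "\<sigma> \<in> order_complex {x \<in> proper Q. x \<le> p}"
    using assms(2) by (simp add: Delta_closed_le)
  then have le: "x \<in> proper Q" "x \<le> p" if "x \<in> \<sigma>" for x
    using that by (auto simp: order_complex_iff)
  then have "\<exists>x\<in>\<sigma>. rank x = rank p"
    using assms rank_pos by (intro rank_on_face(3)[OF face]) (auto intro!: rank_mono dest: properD)
  then show ?thesis
    using le rank_strict_mono_proper[OF _ assms(1)] by (metis less_irrefl order_le_less)
qed

lemma vertex_notin_other_face:
  assumes "covers Q q p" "\<sigma> \<in> (\<Union>b\<in>{b. covers Q q b \<and> b \<noteq> p}. Delta_closed Q b)"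
  shows "p \<notin> \<sigma>"
proof
  assume "p \<in> \<sigma>"
  with assms(2) obtain b where "covers Q q b" "b \<noteq> p" "p \<le> b"
    by (auto simp: Delta_closed_le order_complex_iff)
  then show False
    using assms(1) by (auto simp: covers_def order_le_less)
qed

lemma deletion_fund_cycle_in_chains:
  assumes p: "p \<in> proper Q" and q: "q \<in> proper Q" and rank: "rank q = Suc (rank p)"
  shows "deletion p (fund_cycle q) \<in>
    chains (\<Union>b\<in>{b. covers Q q b \<and> b \<noteq> p}. Delta_closed Q b) (int (rank q) - 2)"
proof (rule chainsI)
  fix \<sigma> assume "deletion p (fund_cycle q) \<sigma> \<noteq> 0"
  then have p\<sigma>: "p \<notin> \<sigma>" and nz: "fund_cycle q \<sigma> \<noteq> 0"
    by (auto simp: deletion_def split: if_splits)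
  note face = chainsD[OF fund_cycle_in_ochains(1)[OF q] nz]
  have mem: "x \<in> proper Q" "x < q" "rank x \<le> rank p" if "x \<in> \<sigma>" for x
    using face(1) that below_memD[OF properD[OF q], of x] rank by (auto simp: order_complex_iff)
  have "\<exists>b\<in>\<sigma>. rank b = rank p"
    by (rule rank_on_face(3)[OF face(1)])
      (use face(2) mem rank rank_pos[OF p] in \<open>auto simp: below_eq\<close>)
  then obtain b where b: "b \<in> \<sigma>" "rank b = rank p" by blast
  have "covers Q q b"
    using mem[OF b(1)] q b(2) rank by (intro coversI) (auto dest: properD)
  moreover have "b \<noteq> p"
    using p\<sigma> b(1) by blast
  moreover have "x \<le> b" if "x \<in> \<sigma>" for x
  proof -
    have "\<not> b < x"
      using rank_strict_mono_proper[OF mem(1)[OF b(1)] mem(1)[OF that]] mem(3)[OF that] b(2) by auto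
    then show ?thesis
      using face(1) that b(1) by (auto simp: order_complex_iff order_le_less)
  qed
  then have "\<sigma> \<in> Delta_closed Q b"
    unfolding Delta_closed_le using face(1) mem by (auto simp: order_complex_iff)
  ultimately show "\<sigma> \<in> (\<Union>b\<in>{b. covers Q q b \<and> b \<noteq> p}. Delta_closed Q b) \<and>
      int (card \<sigma>) = int (rank q) - 2 + 1"
    using face(2) by blast
qed

lemma phi_fund_cycle:
  assumes p: "p \<in> proper Q" and q: "q \<in> proper Q" and "p < q" and rank: "rank q = Suc (rank p)"
  shows "phi Q (rank q) q p (hclass (Delta Q q) (int (rank q) - 2) (fund_cycle q)) =
    hclass (Delta Q p) (int (rank p) - 2) (incidence q p *\<^sub>F fund_cycle p)"
proof -
  let ?K2 = "\<Union>b\<in>{b. covers Q q b \<and> b \<noteq> p}. Delta_closed Q b" and ?j = "int (rank q) - 2"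
  define w where "w = cone p (incidence q p *\<^sub>F fund_cycle p)"
  have cov: "covers Q q p"
    by (rule coversI[OF properD[OF p] properD[OF q] assms(3) rank])
  have split: "w + deletion p (fund_cycle q) = fund_cycle q"
    unfolding w_def link_fund_cycle[OF p q rank, symmetric] by (rule cone_link_deletion)
  have "insert p (below Q p) \<subseteq> {x \<in> proper Q. x \<le> p}"
    using p by (auto simp: below_eq)
  then have "w \<in> chains (Delta_closed Q p) ?j"
    using ochains_mono[OF cone_fund_cycle_in_ochains[OF p]] rank
    by (simp add: Delta_closed_le w_def)
  moreover have "int (card \<sigma>) \<noteq> ?j + 1" if "\<sigma> \<in> Delta_closed Q p" "\<sigma> \<in> ?K2" for \<sigma>
    using top_face_contains_vertex[OF p that(1)] vertex_notin_other_face[OF cov that(2)] rank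
    by auto
  ultimately have "mv_connect (Delta_closed Q p) ?K2 ?j {w + deletion p (fund_cycle q)} = {bdry w}"
    by (intro mv_connect_add deletion_fund_cycle_in_chains[OF p q rank])
  moreover have "hclass (Delta Q q) ?j (fund_cycle q) = {fund_cycle q}"
    using obounds_top_dim[OF properD[OF q]]
    by (simp add: Delta_below hclass_def top_dim_proper[OF q])
  moreover have "bdry w = incidence q p *\<^sub>F fund_cycle p"
    unfolding w_def by (rule bdry_cone_fund_cycle[OF p])
  moreover have "int (rank q) - 3 = int (rank p) - 2"
    using rank by simp
  ultimately show ?thesis
    by (simp add: phi_def h_incl_def split)
qed

end

section \<open>Multigraded strands\<close>

lemma lookup_sum: "Poly_Mapping.lookup (\<Sum>x\<in>S. f x) u = (\<Sum>x\<in>S. Poly_Mapping.lookup (f x) u)"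
  by (induction S rule: infinite_finite_induct) (simp_all add: lookup_add)

lemma monom_diff_add: "s \<le> u \<Longrightarrow> u - s + s = u" for s u :: "'v monom"
  by (auto simp: fun_eq_iff le_fun_def)

lemma lookup_mult_single:
  fixes f :: "('v, 'k::field) mpoly"
  shows "Poly_Mapping.lookup (f * Poly_Mapping.single s c) u =
    (if s \<le> u then Poly_Mapping.lookup f (u - s) * c else 0)"
proof -
  have "(Poly_Mapping.lookup (Poly_Mapping.single s c) q when u = l + q) =
      ((c when u = l + s) when q = s)" for q l
    by (auto simp: lookup_single when_def)
  then have lookup: "Poly_Mapping.lookup (f * Poly_Mapping.single s c) u =
      (\<Sum>l. Poly_Mapping.lookup f l * (c when u = l + s))"
    by (simp add: lookup_mult)
  show ?thesis
  proof (cases "s \<le> u")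
    case True
    then have "u = l + s \<longleftrightarrow> l = u - s" for l
      by (auto simp: fun_eq_iff le_fun_def)
    then have "(Poly_Mapping.lookup f l * (c when u = l + s)) =
        ((Poly_Mapping.lookup f (u - s) * c) when l = u - s)" for l
      by (auto simp: when_def)
    then show ?thesis
      using True unfolding lookup by simp
  next
    case False
    then have "u \<noteq> l + s" for l
      by (auto simp: le_fun_def)
    then show ?thesis
      using False unfolding lookup by simp
  qed
qed

definition strand_gens :: "('e, 'v, 'k) based_complex \<Rightarrow> nat \<Rightarrow> 'v monom \<Rightarrow> 'e set" where
  "strand_gens F i t = {e \<in> gens F i. mdeg F i e \<le> t}"

definition strand_exact :: "('e, 'v, 'k::field) based_complex \<Rightarrow> nat \<Rightarrow> 'v monom \<Rightarrow> bool" where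
  "strand_exact F i t \<longleftrightarrow> (\<forall>x.
     (\<forall>e'\<in>strand_gens F i t. (\<Sum>e\<in>strand_gens F (Suc i) t. x e * coef F (Suc i) e e') = 0) \<longrightarrow>
     (\<exists>y. \<forall>e\<in>strand_gens F (Suc i) t.
        x e = (\<Sum>e'\<in>strand_gens F (Suc (Suc i)) t. y e' * coef F (Suc (Suc i)) e' e)))"

text \<open>The component of multidegree \<open>t\<close> of an element, written in the basis of the strand.\<close>

definition strand :: "('e, 'v, 'k::field) based_complex \<Rightarrow> nat \<Rightarrow> ('e \<Rightarrow> ('v, 'k) mpoly) \<Rightarrow>
    'v monom \<Rightarrow> 'e \<Rightarrow> 'k" where
  "strand F i f t e = (if mdeg F i e \<le> t then Poly_Mapping.lookup (f e) (t - mdeg F i e) else 0)"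

lemma strand_exactD:
  assumes "strand_exact F i t"
    and "\<And>e'. e' \<in> strand_gens F i t \<Longrightarrow> (\<Sum>e\<in>strand_gens F (Suc i) t. x e * coef F (Suc i) e e') = 0"
  shows "\<exists>y. \<forall>e\<in>strand_gens F (Suc i) t.
    x e = (\<Sum>e'\<in>strand_gens F (Suc (Suc i)) t. y e' * coef F (Suc (Suc i)) e' e)"
  using assms unfolding strand_exact_def by blast

lemma lookup_eq_strand: "Poly_Mapping.lookup (f e) u = strand F i f (u + mdeg F i e) e"
proof -
  have "mdeg F i e \<le> u + mdeg F i e" "u + mdeg F i e - mdeg F i e = u"
    by (auto simp: le_fun_def fun_eq_iff)
  then show ?thesis
    by (simp add: strand_def)
qed

lemma strand_zero: "strand F i 0 t e = 0"
  by (simp add: strand_def)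

lemma free_mod_eqI:
  assumes "f \<in> free_mod F i" "g \<in> free_mod F i"
    and "\<And>t e. e \<in> gens F i \<Longrightarrow> strand F i f t e = strand F i g t e"
  shows "f = g"
proof
  fix e
  show "f e = g e"
  proof (cases "e \<in> gens F i")
    case True
    show ?thesis
      by (rule poly_mapping_eqI) (simp add: lookup_eq_strand[of _ e _ F i] assms(3)[OF True])
  qed (use assms in \<open>simp add: free_mod_def\<close>)
qed

lemma free_mod_zero: "0 \<in> free_mod F i"
  by (simp add: free_mod_def)

lemma diffl_in_free_mod: "diffl F (Suc i) f \<in> free_mod F i"
  by (simp add: diffl_def free_mod_def)

lemma ex_free_mod_strands:
  fixes F :: "('e, 'v, 'k::field) based_complex"
  assumes "finite T"
  shows "\<exists>g\<in>free_mod F i. \<forall>t. \<forall>e\<in>gens F i.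
    strand F i g t e = (if t \<in> T \<and> mdeg F i e \<le> t then y t e else 0)"
proof (intro bexI allI ballI)
  define g where "g = (\<lambda>e. if e \<in> gens F i then
    \<Sum>t\<in>{t \<in> T. mdeg F i e \<le> t}. Poly_Mapping.single (t - mdeg F i e) (y t e) else 0)"
  show "g \<in> free_mod F i"
    by (simp add: free_mod_def g_def)
  fix t e assume e: "e \<in> gens F i"
  show "strand F i g t e = (if t \<in> T \<and> mdeg F i e \<le> t then y t e else 0)"
  proof (cases "mdeg F i e \<le> t")
    case True
    have inj: "s - mdeg F i e = t - mdeg F i e \<longleftrightarrow> s = t" if "mdeg F i e \<le> s" for s
      using that True monom_diff_add by metis
    have "strand F i g t e = (\<Sum>s\<in>{t \<in> T. mdeg F i e \<le> t}. if s = t then y t e else 0)"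
      using True e inj
      by (auto simp: strand_def g_def lookup_sum lookup_single when_def intro!: sum.cong)
    also have "\<dots> = (if t \<in> T then y t e else 0)"
      using assms True by simp
    finally show ?thesis
      using True by simp
  qed (simp add: strand_def)
qed

lemma finite_strand_support:
  assumes "finite (gens F i)"
  shows "finite {t. \<exists>e\<in>gens F i. strand F i f t e \<noteq> 0}"
proof (rule finite_subset)
  show "{t. \<exists>e\<in>gens F i. strand F i f t e \<noteq> 0} \<subseteq>
    (\<Union>e\<in>gens F i. (\<lambda>s. s + mdeg F i e) ` Poly_Mapping.keys (f e))"
  proof
    fix t assume "t \<in> {t. \<exists>e\<in>gens F i. strand F i f t e \<noteq> 0}"
    then obtain e where e: "e \<in> gens F i" "strand F i f t e \<noteq> 0" by blast
    then have "mdeg F i e \<le> t" "t - mdeg F i e \<in> Poly_Mapping.keys (f e)"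
      by (auto simp: strand_def in_keys_iff split: if_splits)
    then show "t \<in> (\<Union>e\<in>gens F i. (\<lambda>s. s + mdeg F i e) ` Poly_Mapping.keys (f e))"
      using e(1) by (intro UN_I image_eqI[of _ _ "t - mdeg F i e"]) (simp_all add: monom_diff_add)
  qed
qed (use assms in simp)

locale multigraded_complex =
  fixes F :: "('e, 'v, 'k::field) based_complex"
  assumes finite_gens: "\<And>i. finite (gens F i)"
    and mdeg_less: "\<And>i e e'. e \<in> gens F (Suc i) \<Longrightarrow> e' \<in> gens F i \<Longrightarrow> coef F (Suc i) e e' \<noteq> 0 \<Longrightarrow>
      mdeg F i e' < mdeg F (Suc i) e"
    and coef_coef: "\<And>i e e''. e \<in> gens F (Suc (Suc i)) \<Longrightarrow> e'' \<in> gens F i \<Longrightarrow>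
      (\<Sum>e'\<in>gens F (Suc i). coef F (Suc (Suc i)) e e' * coef F (Suc i) e' e'') = 0"
begin

lemma strand_diffl:
  assumes e': "e' \<in> gens F i"
  shows "strand F i (diffl F (Suc i) f) t e' =
    (\<Sum>e\<in>gens F (Suc i). coef F (Suc i) e e' * strand F (Suc i) f t e)"
proof (cases "mdeg F i e' \<le> t")
  case True
  have "strand F i (diffl F (Suc i) f) t e' = (\<Sum>e\<in>gens F (Suc i).
      Poly_Mapping.lookup
        (f e * Poly_Mapping.single (mdeg F (Suc i) e - mdeg F i e') (coef F (Suc i) e e'))
        (t - mdeg F i e'))"
    using True e' by (simp add: strand_def diffl_def lookup_sum)
  also have "\<dots> = (\<Sum>e\<in>gens F (Suc i). coef F (Suc i) e e' * strand F (Suc i) f t e)"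
  proof (rule sum.cong[OF refl])
    fix e assume e: "e \<in> gens F (Suc i)"
    let ?a = "mdeg F (Suc i) e" and ?b = "mdeg F i e'"
    show "Poly_Mapping.lookup (f e * Poly_Mapping.single (?a - ?b) (coef F (Suc i) e e')) (t - ?b) =
      coef F (Suc i) e e' * strand F (Suc i) f t e"
    proof (cases "coef F (Suc i) e e' = 0")
      case False
      then have "?b \<le> ?a"
        using mdeg_less[OF e e'] by simp
      then have "?a - ?b \<le> t - ?b \<longleftrightarrow> ?a \<le> t" "t - ?b - (?a - ?b) = t - ?a"
        using True by (simp_all add: le_fun_def fun_eq_iff le_diff_iff)
      then show ?thesis
        by (simp add: lookup_mult_single strand_def)
    qed (simp add: lookup_mult_single)
  qed
  finally show ?thesis .
next
  case False
  have "coef F (Suc i) e e' * strand F (Suc i) f t e = 0" if "e \<in> gens F (Suc i)" for e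
    using mdeg_less[OF that e'] False by (auto simp: strand_def dest: order_trans less_imp_le)
  then have "(\<Sum>e\<in>gens F (Suc i). coef F (Suc i) e e' * strand F (Suc i) f t e) = 0"
    by (rule sum.neutral[rule_format])
  then show ?thesis
    using False by (simp only: strand_def if_False)
qed

lemma strand_diffl_eq_sum_strand_gens:
  assumes "e' \<in> gens F i"
  shows "strand F i (diffl F (Suc i) f) t e' =
    (\<Sum>e\<in>strand_gens F (Suc i) t. strand F (Suc i) f t e * coef F (Suc i) e e')"
  unfolding strand_diffl[OF assms]
  by (rule sum.mono_neutral_cong_right[OF finite_gens]) (auto simp: strand_def strand_gens_def)

lemma diffl_diffl: "diffl F (Suc i) (diffl F (Suc (Suc i)) f) = 0"
proof (rule free_mod_eqI[OF diffl_in_free_mod free_mod_zero])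
  fix t e'' assume e'': "e'' \<in> gens F i"
  let ?G = "gens F (Suc (Suc i))" and ?c = "coef F (Suc i)" and ?c' = "coef F (Suc (Suc i))"
  let ?s = "strand F (Suc (Suc i)) f t"
  have "strand F i (diffl F (Suc i) (diffl F (Suc (Suc i)) f)) t e'' =
      (\<Sum>e'\<in>gens F (Suc i). \<Sum>e\<in>?G. ?c e' e'' * (?c' e e' * ?s e))"
    by (simp add: strand_diffl[OF e''] strand_diffl sum_distrib_left)
  also have "\<dots> = (\<Sum>e\<in>?G. \<Sum>e'\<in>gens F (Suc i). ?c e' e'' * (?c' e e' * ?s e))"
    by (rule sum.swap)
  also have "\<dots> = (\<Sum>e\<in>?G. (\<Sum>e'\<in>gens F (Suc i). ?c' e e' * ?c e' e'') * ?s e)"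
    by (simp add: sum_distrib_left mult_ac)
  also have "\<dots> = 0"
    using coef_coef e'' by simp
  finally show "strand F i (diffl F (Suc i) (diffl F (Suc (Suc i)) f)) t e'' = strand F i 0 t e''"
    by (simp only: strand_zero)
qed

lemma strand_preimage:
  assumes "strand_exact F i t" "diffl F (Suc i) f = 0"
  shows "\<exists>y. \<forall>e\<in>strand_gens F (Suc i) t. strand F (Suc i) f t e =
    (\<Sum>e'\<in>strand_gens F (Suc (Suc i)) t. y e' * coef F (Suc (Suc i)) e' e)"
proof (rule strand_exactD[OF assms(1)])
  fix e' assume "e' \<in> strand_gens F i t"
  then show "(\<Sum>e\<in>strand_gens F (Suc i) t. strand F (Suc i) f t e * coef F (Suc i) e e') = 0"
    using strand_diffl_eq_sum_strand_gens[of e' i f t] assms(2)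
    by (simp add: strand_gens_def strand_zero)
qed

lemma diffl_preimage:
  assumes exact: "\<And>t. strand_exact F i t"
    and f: "f \<in> free_mod F (Suc i)" "diffl F (Suc i) f = 0"
  obtains g where "g \<in> free_mod F (Suc (Suc i))" "diffl F (Suc (Suc i)) g = f"
proof -
  let ?G = "\<lambda>t. strand_gens F (Suc (Suc i)) t" and ?c = "coef F (Suc (Suc i))"
  define T where "T = {t. \<exists>e\<in>gens F (Suc i). strand F (Suc i) f t e \<noteq> 0}"
  have T: "finite T"
    unfolding T_def by (rule finite_strand_support[OF finite_gens])
  obtain y where y: "\<And>t e. e \<in> strand_gens F (Suc i) t \<Longrightarrow>
      strand F (Suc i) f t e = (\<Sum>e'\<in>?G t. y t e' * ?c e' e)"
    using strand_preimage[OF exact f(2)] by metis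
  obtain g where g: "g \<in> free_mod F (Suc (Suc i))" "\<And>t e. e \<in> gens F (Suc (Suc i)) \<Longrightarrow>
      strand F (Suc (Suc i)) g t e = (if t \<in> T \<and> mdeg F (Suc (Suc i)) e \<le> t then y t e else 0)"
    using ex_free_mod_strands[OF T] by metis
  have "diffl F (Suc (Suc i)) g = f"
  proof (rule free_mod_eqI[OF diffl_in_free_mod f(1)])
    fix t e assume e: "e \<in> gens F (Suc i)"
    have sum: "strand F (Suc i) (diffl F (Suc (Suc i)) g) t e =
        (\<Sum>e'\<in>?G t. (if t \<in> T then y t e' else 0) * ?c e' e)"
      unfolding strand_diffl_eq_sum_strand_gens[OF e]
      by (intro sum.cong refl) (simp add: g(2) strand_gens_def)
    show "strand F (Suc i) (diffl F (Suc (Suc i)) g) t e = strand F (Suc i) f t e"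
    proof (cases "t \<in> T \<and> mdeg F (Suc i) e \<le> t")
      case True
      then show ?thesis
        using sum y e by (simp add: strand_gens_def)
    next
      case False
      then have "strand F (Suc i) f t e = 0"
        using e by (auto simp: T_def strand_def)
      moreover have "strand F (Suc i) (diffl F (Suc (Suc i)) g) t e = 0"
        using False sum by (cases "t \<in> T") (simp_all add: strand_def)
      ultimately show ?thesis by simp
    qed
  qed
  with g(1) show thesis
    by (rule that)
qed

lemma lookup_diffl_0: "Poly_Mapping.lookup (diffl F (Suc i) f e) 0 = 0"
proof (cases "e \<in> gens F i")
  case True
  have "coef F (Suc i) e' e * strand F (Suc i) f (mdeg F i e) e' = 0" if "e' \<in> gens F (Suc i)"
    for e'
    using mdeg_less[OF that True] by (cases "coef F (Suc i) e' e = 0") (auto simp: strand_def)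
  then have "strand F i (diffl F (Suc i) f) (mdeg F i e) e = 0"
    unfolding strand_diffl[OF True] by (intro sum.neutral) blast
  then show ?thesis
    using lookup_eq_strand[of "diffl F (Suc i) f" e 0 F i] by simp
qed (simp add: diffl_def)

lemma lookup_diffl_1:
  assumes "gens F 0 = {e0}" "mdeg F 0 e0 = 0"
  shows "Poly_Mapping.lookup (diffl F (Suc 0) f e0) u =
    (\<Sum>e\<in>gens F (Suc 0). coef F (Suc 0) e e0 * strand F (Suc 0) f u e)"
  using strand_diffl[of e0 0 f u] assms lookup_eq_strand[of "diffl F (Suc 0) f" e0 u F 0] by simp

lemma keys_diffl_1_subset:
  assumes "gens F 0 = {e0}" "mdeg F 0 e0 = 0"
    and above: "\<And>e t. e \<in> gens F (Suc 0) \<Longrightarrow> mdeg F (Suc 0) e \<le> t \<Longrightarrow> t \<in> M"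
  shows "Poly_Mapping.keys (diffl F (Suc 0) f e0) \<subseteq> M"
proof
  fix t assume "t \<in> Poly_Mapping.keys (diffl F (Suc 0) f e0)"
  then have "(\<Sum>e\<in>gens F (Suc 0). coef F (Suc 0) e e0 * strand F (Suc 0) f t e) \<noteq> 0"
    unfolding in_keys_iff lookup_diffl_1[OF assms(1,2)] .
  then obtain e where "e \<in> gens F (Suc 0)" "coef F (Suc 0) e e0 * strand F (Suc 0) f t e \<noteq> 0"
    by (rule sum.not_neutral_contains_not_neutral)
  then show "t \<in> M"
    using above by (auto simp: strand_def split: if_splits)
qed

lemma diffl_1_preimage:
  assumes e0: "gens F 0 = {e0}" "mdeg F 0 e0 = 0"
    and hit: "\<And>t. t \<in> Poly_Mapping.keys h \<Longrightarrow> \<exists>e\<in>strand_gens F (Suc 0) t. coef F (Suc 0) e e0 \<noteq> 0"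
  obtains g where "g \<in> free_mod F (Suc 0)" "diffl F (Suc 0) g e0 = h"
proof -
  obtain E where E: "\<And>t. t \<in> Poly_Mapping.keys h \<Longrightarrow>
      E t \<in> strand_gens F (Suc 0) t \<and> coef F (Suc 0) (E t) e0 \<noteq> 0"
    using hit by metis
  define y
    where "y = (\<lambda>t e. if e = E t then Poly_Mapping.lookup h t / coef F (Suc 0) (E t) e0 else 0)"
  obtain g where g: "g \<in> free_mod F (Suc 0)" "\<And>t e. e \<in> gens F (Suc 0) \<Longrightarrow>
      strand F (Suc 0) g t e = (if t \<in> Poly_Mapping.keys h \<and> mdeg F (Suc 0) e \<le> t then y t e else 0)"
    using ex_free_mod_strands[OF finite_keys[of h], of F "Suc 0" y] by metis
  have "diffl F (Suc 0) g e0 = h"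
  proof (rule poly_mapping_eqI)
    fix u
    have "Poly_Mapping.lookup (diffl F (Suc 0) g e0) u =
        (\<Sum>e\<in>gens F (Suc 0). if e = E u
          then (if u \<in> Poly_Mapping.keys h then Poly_Mapping.lookup h u else 0) else 0)"
      unfolding lookup_diffl_1[OF e0]
      using g(2) E[of u] by (intro sum.cong) (auto simp: y_def strand_gens_def)
    also have "\<dots> = Poly_Mapping.lookup h u"
      using finite_gens E[of u] by (auto simp: in_keys_iff strand_gens_def)
    finally show "Poly_Mapping.lookup (diffl F (Suc 0) g e0) u = Poly_Mapping.lookup h u" .
  qed
  with g(1) show thesis
    by (rule that)
qed

lemma image_diffl_eq_kernel:
  assumes "\<And>t. strand_exact F i t"
  shows "diffl F (Suc (Suc i)) ` free_mod F (Suc (Suc i)) =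
    {f \<in> free_mod F (Suc i). diffl F (Suc i) f = 0}"
proof (intro equalityI subsetI)
  fix f assume "f \<in> {f \<in> free_mod F (Suc i). diffl F (Suc i) f = 0}"
  then obtain g where "g \<in> free_mod F (Suc (Suc i))" "diffl F (Suc (Suc i)) g = f"
    using diffl_preimage[OF assms, of f] by blast
  then show "f \<in> diffl F (Suc (Suc i)) ` free_mod F (Suc (Suc i))"
    by blast
qed (auto simp: diffl_diffl diffl_in_free_mod)

lemma image_diffl_1:
  assumes e0: "gens F 0 = {e0}" "mdeg F 0 e0 = 0"
    and "\<And>e t. e \<in> gens F (Suc 0) \<Longrightarrow> mdeg F (Suc 0) e \<le> t \<Longrightarrow> t \<in> M"
    and "\<And>t. t \<in> M \<Longrightarrow> \<exists>e\<in>strand_gens F (Suc 0) t. coef F (Suc 0) e e0 \<noteq> 0"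
  shows "(\<lambda>f. f e0) ` diffl F 1 ` free_mod F 1 = {h. Poly_Mapping.keys h \<subseteq> M}"
proof (intro equalityI subsetI)
  fix h assume "h \<in> (\<lambda>f. f e0) ` diffl F 1 ` free_mod F 1"
  then obtain f where "h = diffl F (Suc 0) f e0"
    by auto
  then show "h \<in> {h. Poly_Mapping.keys h \<subseteq> M}"
    using keys_diffl_1_subset[OF e0, of M f] assms(3) by blast
next
  fix h :: "('v, 'k) mpoly" assume "h \<in> {h. Poly_Mapping.keys h \<subseteq> M}"
  then obtain g where "g \<in> free_mod F (Suc 0)" "diffl F (Suc 0) g e0 = h"
    using diffl_1_preimage[OF e0, of h] assms(4) by blast
  then show "h \<in> (\<lambda>f. f e0) ` diffl F 1 ` free_mod F 1"
    by auto
qed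

lemma minimal_free_resolutionI:
  assumes e0: "gens F 0 = {e0}" "mdeg F 0 e0 = 0"
    and "\<And>e t. e \<in> gens F (Suc 0) \<Longrightarrow> mdeg F (Suc 0) e \<le> t \<Longrightarrow> t \<in> M"
    and "\<And>t. t \<in> M \<Longrightarrow> \<exists>e\<in>strand_gens F (Suc 0) t. coef F (Suc 0) e e0 \<noteq> 0"
    and exact: "\<And>i t. strand_exact F i t"
  shows "minimal_free_resolution F {h. Poly_Mapping.keys h \<subseteq> M}"
  unfolding minimal_free_resolution_def
proof (intro conjI allI impI ballI)
  fix i :: nat assume "1 \<le> i"
  then obtain j where j: "i = Suc j" by (cases i) auto
  show "mdeg F (i - 1) e' \<le> mdeg F i e"
    if "e \<in> gens F i" "e' \<in> gens F (i - 1)" "coef F i e e' \<noteq> 0" for e e'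
    using mdeg_less[of e j e'] that j by simp
  show "diffl F (i + 1) ` free_mod F (i + 1) = {f \<in> free_mod F i. diffl F i f = 0}"
    using image_diffl_eq_kernel[OF exact, of j] j by simp
  show "Poly_Mapping.lookup (diffl F i f e) 0 = 0" for f e
    using lookup_diffl_0[of j] j by simp
next
  have "(\<lambda>f. f e0) ` diffl F 1 ` free_mod F 1 = {h. Poly_Mapping.keys h \<subseteq> M}"
    by (rule image_diffl_1) (fact assms)+
  then show "\<exists>e0. gens F 0 = {e0} \<and> mdeg F 0 e0 = 0 \<and>
      (\<lambda>f. f e0) ` diffl F 1 ` free_mod F 1 = {h. Poly_Mapping.keys h \<subseteq> M}"
    using e0 by blast
qed (rule finite_gens)

end

section \<open>Monomial ideals\<close>

interpretation mpoly: module "(*) :: ('v, 'k::field) mpoly \<Rightarrow> ('v, 'k) mpoly \<Rightarrow> ('v, 'k) mpoly"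
  by unfold_locales (auto simp: algebra_simps)

definition monoms :: "('v, 'k::field) mpoly set \<Rightarrow> 'v monom set" where
  "monoms N = {t. Poly_Mapping.single t 1 \<in> N}"

lemma mpoly_eq_sum_monomials:
  fixes f :: "('v, 'k::field) mpoly"
  shows "f = (\<Sum>t\<in>Poly_Mapping.keys f. Poly_Mapping.single t (Poly_Mapping.lookup f t))"
  by (rule poly_mapping_eqI) (simp add: lookup_sum lookup_single when_def in_keys_iff)

lemma subspace_keys_in_up_set:
  assumes up: "\<And>s t. s \<in> U \<Longrightarrow> s \<le> t \<Longrightarrow> t \<in> U"
  shows "mpoly.subspace {f :: ('v, 'k::field) mpoly. Poly_Mapping.keys f \<subseteq> U}"
proof (rule mpoly.subspaceI)
  fix f g :: "('v, 'k) mpoly"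
  assume "f \<in> {f. Poly_Mapping.keys f \<subseteq> U}" "g \<in> {f. Poly_Mapping.keys f \<subseteq> U}"
  then show "f + g \<in> {f. Poly_Mapping.keys f \<subseteq> U}"
    using Poly_Mapping.keys_add[of f g] by blast
next
  fix c f :: "('v, 'k) mpoly" assume f: "f \<in> {f. Poly_Mapping.keys f \<subseteq> U}"
  show "c * f \<in> {f. Poly_Mapping.keys f \<subseteq> U}"
  proof (intro CollectI subsetI)
    fix t assume "t \<in> Poly_Mapping.keys (c * f)"
    then obtain a b where "t = a + b" "b \<in> Poly_Mapping.keys f"
      using keys_mult[of c f] by blast
    then show "t \<in> U"
      using f up[of b t] by (auto simp: le_fun_def)
  qed
qed simp

lemma span_monomials:
  fixes M :: "'v monom set"
  shows "mpoly.span ((\<lambda>m. Poly_Mapping.single m 1) ` M) =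
    {f :: ('v, 'k::field) mpoly. Poly_Mapping.keys f \<subseteq> {t. \<exists>m\<in>M. m \<le> t}}" (is "?S = ?T")
proof (rule antisym)
  show "?S \<subseteq> ?T"
    by (intro mpoly.span_minimal subspace_keys_in_up_set) (auto intro: order_trans)
  show "?T \<subseteq> ?S"
  proof
    fix f assume f: "f \<in> ?T"
    have "Poly_Mapping.single t (Poly_Mapping.lookup f t) \<in> ?S" if "t \<in> Poly_Mapping.keys f" for t
    proof -
      obtain m where m: "m \<in> M" "m \<le> t"
        using f \<open>t \<in> _\<close> by blast
      have "Poly_Mapping.single t (Poly_Mapping.lookup f t) =
          Poly_Mapping.single (t - m) (Poly_Mapping.lookup f t) * Poly_Mapping.single m 1"
        by (simp add: mult_single monom_diff_add[OF m(2)])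
      also have "\<dots> \<in> ?S"
        by (intro mpoly.span_scale mpoly.span_base) (use m in auto)
      finally show ?thesis .
    qed
    then have "(\<Sum>t\<in>Poly_Mapping.keys f. Poly_Mapping.single t (Poly_Mapping.lookup f t)) \<in> ?S"
      by (rule mpoly.span_sum)
    then show "f \<in> ?S"
      using mpoly_eq_sum_monomials[of f] by simp
  qed
qed

lemma monomial_idealD:
  fixes N :: "('v, 'k::field) mpoly set"
  assumes "monomial_ideal N"
  shows "N = {f. Poly_Mapping.keys f \<subseteq> monoms N}"
    and "\<And>s t. s \<in> monoms N \<Longrightarrow> s \<le> t \<Longrightarrow> t \<in> monoms N"
proof -
  obtain M where M: "N = {f. Poly_Mapping.keys f \<subseteq> {t. \<exists>m\<in>M. m \<le> t}}"
    using assms unfolding monomial_ideal_def span_monomials by blast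
  have "monoms N = {t. \<exists>m\<in>M. m \<le> t}"
    by (simp add: monoms_def M)
  then show "N = {f. Poly_Mapping.keys f \<subseteq> monoms N}"
    and "\<And>s t. s \<in> monoms N \<Longrightarrow> s \<le> t \<Longrightarrow> t \<in> monoms N"
    using M by (auto intro: order_trans)
qed

lemma min_gens_monoms: "min_gens N \<subseteq> monoms N"
  by (auto simp: min_gens_def monoms_def)

lemma min_gens_below:
  fixes N :: "('v::finite, 'k::field) mpoly set"
  assumes "t \<in> monoms N"
  obtains m where "m \<in> min_gens N" "m \<le> t"
proof -
  let ?d = "\<lambda>m::'v monom. \<Sum>v\<in>UNIV. m v"
  obtain m where m: "m \<in> monoms N \<and> m \<le> t" "\<forall>m'. m' \<in> monoms N \<and> m' \<le> t \<longrightarrow> ?d m \<le> ?d m'"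
    using ex_has_least_nat[of "\<lambda>m. m \<in> monoms N \<and> m \<le> t" t ?d] assms by blast
  have "m' = m" if m': "Poly_Mapping.single m' 1 \<in> N" "m' \<le> m" for m'
  proof -
    have "m' \<in> monoms N \<and> m' \<le> t"
      using m' m(1) order_trans by (auto simp: monoms_def)
    moreover have "?d m' \<le> ?d m"
      using m'(2) by (intro sum_mono) (auto simp: le_fun_def)
    ultimately have "?d m' = ?d m"
      using m(2) order_antisym by blast
    then have "m' v = m v" for v
      using m'(2) by (intro sum_mono_inv[of m' UNIV m]) (auto simp: le_fun_def)
    then show ?thesis by blast
  qed
  then have "m \<in> min_gens N"
    using m(1) by (auto simp: min_gens_def monoms_def)
  then show thesis
    using that m(1) by blast
qed

lemma zero_le_monom [simp]: "(0 :: 'v monom) \<le> m"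
  by (simp add: le_fun_def)

lemma Sup_monom_upper: "finite X \<Longrightarrow> m \<in> X \<Longrightarrow> m \<le> (Sup X :: 'v monom)"
  by (auto simp: le_fun_def Sup_nat_def)

lemma Sup_monom_least:
  assumes "\<And>m. m \<in> X \<Longrightarrow> m \<le> t"
  shows "(Sup X :: 'v monom) \<le> t"
proof (rule le_funI)
  fix v
  show "Sup X v \<le> t v"
  proof (cases "X = {}")
    case False
    then show ?thesis
      unfolding Sup_apply using assms by (intro cSup_least) (auto simp: le_fun_def)
  qed (simp add: Sup_nat_def)
qed

lemma Sup_monom_empty: "(Sup {} :: 'v monom) = 0"
  by (simp add: fun_eq_iff Sup_nat_def)

lemma Sup_monom_singleton: "(Sup {m} :: 'v monom) = m"
  by (simp add: fun_eq_iff)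

lemma lcm_latticeI: "X \<subseteq> min_gens N \<Longrightarrow> Sup X \<in> lcm_lattice N"
  by (auto simp: lcm_lattice_def)

context
  fixes N :: "('v::finite, 'k::field) mpoly set"
  assumes N: "monomial_ideal N" and finite_lcm_lattice: "finite (lcm_lattice N)"
begin

lemma min_gens_in_lcm_lattice: "min_gens N \<subseteq> lcm_lattice N"
  using lcm_latticeI[of "{_}" N] Sup_monom_singleton by (metis empty_subsetI insert_subset subsetI)

lemma finite_min_gens: "finite (min_gens N)"
  using min_gens_in_lcm_lattice finite_lcm_lattice finite_subset by blast

lemma lcm_lattice_pointed: "finite_pointed (lcm_lattice N)" "pbot (lcm_lattice N) = 0"
proof -
  have zero: "0 \<in> lcm_lattice N"
    using lcm_latticeI[of "{}" N] by (simp add: Sup_monom_empty)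
  then show "finite_pointed (lcm_lattice N)"
    unfolding finite_pointed_def using finite_lcm_lattice zero_le_monom by blast
  show "pbot (lcm_lattice N) = 0"
    using zero zero_le_monom by (rule pbot_eqI)
qed

lemma proper_lcm_lattice: "proper (lcm_lattice N) = lcm_lattice N - {0}"
  using proper_eq[OF lcm_lattice_pointed(1)] lcm_lattice_pointed(2) by simp

lemma above_lcm_in_monoms:
  assumes "u \<in> proper (lcm_lattice N)" "u \<le> t"
  shows "t \<in> monoms N"
proof -
  obtain X where X: "X \<subseteq> min_gens N" "u = Sup X"
    using assms(1) unfolding proper_def lcm_lattice_def by auto
  have "X \<noteq> {}"
    using assms(1) X(2) by (auto simp: proper_lcm_lattice Sup_monom_empty)
  then obtain m where m: "m \<in> X" by blast
  then have "m \<le> t"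
    using Sup_monom_upper[OF finite_subset[OF X(1) finite_min_gens]] X(2) assms(2) order_trans
    by blast
  then show ?thesis
    using m X(1) min_gens_monoms[of N] monomial_idealD(2)[OF N] by blast
qed

lemma zero_notin_monoms:
  assumes "proper (lcm_lattice N) \<noteq> {}"
  shows "0 \<notin> monoms N"
proof
  assume "0 \<in> monoms N"
  then have "m = 0" if "m \<in> min_gens N" for m
    using that unfolding min_gens_def monoms_def
    by (metis (mono_tags, lifting) mem_Collect_eq zero_le_monom)
  then have "Sup X = 0" if "X \<subseteq> min_gens N" for X
    using that Sup_monom_least[of X 0] by auto
  then have "lcm_lattice N \<subseteq> {0}"
    unfolding lcm_lattice_def by blast
  then show False
    using assms unfolding proper_lcm_lattice by blast
qed

lemma le_lcm_of_divisors:
  assumes "u \<in> lcm_lattice N" "u \<le> t"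
  shows "u \<le> Sup {m \<in> min_gens N. m \<le> t}"
proof -
  obtain Y where Y: "Y \<subseteq> min_gens N" "u = Sup Y"
    using assms(1) unfolding lcm_lattice_def by auto
  have "finite {m \<in> min_gens N. m \<le> t}"
    using finite_min_gens by simp
  moreover have "m \<le> t" if "m \<in> Y" for m
    using Sup_monom_upper[OF finite_subset[OF Y(1) finite_min_gens] that] Y(2) assms(2) by simp
  ultimately show ?thesis
    unfolding Y(2) using Y(1) by (intro Sup_monom_least Sup_monom_upper) auto
qed

lemma lcm_below_monomial:
  assumes "t \<in> monoms N" "proper (lcm_lattice N) \<noteq> {}"
  obtains x where "x \<in> proper (lcm_lattice N)" "\<And>u. u \<in> lcm_lattice N \<Longrightarrow> u \<le> t \<longleftrightarrow> u \<le> x"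
proof
  let ?X = "{m \<in> min_gens N. m \<le> t}"
  obtain m where m: "m \<in> min_gens N" "m \<le> t"
    using min_gens_below[OF assms(1)] .
  then have "m \<noteq> 0"
    using zero_notin_monoms[OF assms(2)] min_gens_monoms[of N] by blast
  then have "Sup ?X \<noteq> 0"
    using m Sup_monom_upper[of ?X m] finite_min_gens by auto
  then show "Sup ?X \<in> proper (lcm_lattice N)"
    unfolding proper_lcm_lattice using lcm_latticeI[of ?X N] by auto
  have "Sup ?X \<le> t"
    by (rule Sup_monom_least) simp
  then show "\<And>u. u \<in> lcm_lattice N \<Longrightarrow> u \<le> t \<longleftrightarrow> u \<le> Sup ?X"
    using le_lcm_of_divisors order_trans by blast
qed

end

section \<open>The complex of a labelled rigid poset\<close>

context rigid_poset
begin

definition realizes :: "('a \<Rightarrow> 'e) \<Rightarrow> ('a \<Rightarrow> 'v monom) \<Rightarrow> ('e, 'v, 'k) based_complex \<Rightarrow> bool" where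
  "realizes \<iota> \<eta> F \<longleftrightarrow> inj_on \<iota> Q \<and> (\<forall>i. gens F i = \<iota> ` level i) \<and>
     (\<forall>i. \<forall>q\<in>level i. mdeg F i (\<iota> q) = \<eta> q) \<and>
     (\<forall>i. \<forall>q\<in>level (Suc i). \<forall>p\<in>level i. coef F (Suc i) (\<iota> q) (\<iota> p) = incidence q p)"

lemma gens_poset_complex:
  "gens (poset_complex Q \<eta> :: (_, 'v, 'k) based_complex) i = (\<lambda>q. (q, fund_cycle q)) ` level i"
proof (cases i)
  case 0
  have "hbasis {{}} (-1) = {fund_cycle (pbot Q)}"
    using hbasis_below[OF finite_pointedD(2)[OF pointed], of "-1"]
    by (simp add: below_pbot order_complex_empty top_dim_def rank_pbot)
  then show ?thesis
    by (simp add: poset_complex_def 0 level_0)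
next
  case (Suc j)
  have "hbasis (Delta Q q) (int (Suc j) - 2) = (if rank q = Suc j then {fund_cycle q} else {})"
    if "q \<in> proper Q" for q
    using hbasis_below[OF properD[OF that]] top_dim_proper[OF that] by (auto simp: Delta_below)
  then have "(SIGMA q : proper Q. hbasis (Delta Q q) (int (Suc j) - 2)) =
      (SIGMA q : proper Q. if rank q = Suc j then {fund_cycle q} else {})"
    by (rule Sigma_cong[OF refl])
  then show ?thesis
    by (auto simp: poset_complex_def Suc level_Suc proper_eq[OF pointed] split: if_splits)
qed

lemma coef_poset_complex_atom:
  assumes "q \<in> level (Suc 0)"
  shows "coef (poset_complex Q \<eta> :: (_, 'v, 'k) based_complex) (Suc 0)
    (q, fund_cycle q) (pbot Q, fund_cycle (pbot Q)) = incidence q (pbot Q)"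
proof -
  have pbot: "pbot Q \<in> Q"
    by (rule finite_pointedD(2)[OF pointed])
  have "covers Q q (pbot Q)"
    using assms pbot by (intro coversI) (auto simp: level_Suc proper_def rank_pbot)
  moreover have "hcoord {{}} (-1) (hclass {{}} (-1) (fund_cycle (pbot Q))) (fund_cycle (pbot Q)) = 1"
    using hcoord_fund_cycle[OF pbot, of "-1" 1]
    by (simp add: below_pbot order_complex_empty top_dim_def rank_pbot)
  ultimately show ?thesis
    by (simp add: poset_complex_def incidence_def fund_cycle_minimal[OF assms])
qed

lemma coef_poset_complex_proper:
  assumes p: "p \<in> proper Q" and q: "q \<in> proper Q" and rank: "rank q = Suc (rank p)"
  shows "coef (poset_complex Q \<eta> :: (_, 'v, 'k) based_complex) (rank q)
    (q, fund_cycle q) (p, fund_cycle p) = incidence q p"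
proof (cases "p < q")
  case True
  have "covers Q q p"
    by (rule coversI[OF properD[OF p] properD[OF q] True rank])
  moreover have "rank q \<noteq> 1" "int (rank q) - 3 = int (rank p) - 2"
    using rank rank_pos[OF p] by auto
  ultimately have "coef (poset_complex Q \<eta> :: (_, 'v, 'k) based_complex) (rank q)
      (q, fund_cycle q) (p, fund_cycle p) = hcoord (Delta Q p) (int (rank p) - 2)
      (phi Q (rank q) q p (hclass (Delta Q q) (int (rank q) - 2) (fund_cycle q))) (fund_cycle p)"
    by (simp add: poset_complex_def)
  also have "\<dots> = incidence q p"
    unfolding phi_fund_cycle[OF p q True rank] unfolding Delta_below
    by (rule hcoord_fund_cycle[OF properD[OF p] top_dim_proper[OF p, symmetric]])
  finally show ?thesis .
next
  case False
  then show ?thesis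
    using incidence_eq_0[OF p q rank] by (simp add: poset_complex_def covers_def)
qed

lemma poset_complex_realizes:
  "realizes (\<lambda>q. (q, fund_cycle q)) \<eta> (poset_complex Q \<eta> :: (_, 'v, 'k) based_complex)"
proof -
  have "coef (poset_complex Q \<eta> :: (_, 'v, 'k) based_complex) (Suc i)
      (q, fund_cycle q) (p, fund_cycle p) = incidence q p"
    if "q \<in> level (Suc i)" "p \<in> level i" for i q p
  proof (cases i)
    case 0
    then show ?thesis
      using coef_poset_complex_atom[of q \<eta>] that by (simp add: level_0)
  next
    case (Suc j)
    then show ?thesis
      using coef_poset_complex_proper[of p q \<eta>] that by (auto simp: level_Suc)
  qed
  then show ?thesis
    unfolding realizes_def gens_poset_complex by (auto simp: poset_complex_def inj_on_def)
qed

definition rank_complex :: "('a \<Rightarrow> 'e) \<Rightarrow> ('a \<Rightarrow> 'v monom) \<Rightarrow> ('e, 'v, 'k) based_complex" where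
  "rank_complex \<iota> \<eta> = \<lparr>gens = (\<lambda>i. \<iota> ` level i), mdeg = (\<lambda>i e. \<eta> (inv_into Q \<iota> e)),
     coef = (\<lambda>i e e'. incidence (inv_into Q \<iota> e) (inv_into Q \<iota> e'))\<rparr>"

lemma rank_complex_realizes: "inj_on \<iota> Q \<Longrightarrow> realizes \<iota> \<eta> (rank_complex \<iota> \<eta>)"
  by (simp add: realizes_def rank_complex_def level_def)

lemma relabel_rank_complex: "relabel g (rank_complex \<iota> \<eta>) = rank_complex \<iota> (g \<circ> \<eta>)"
  by (simp add: relabel_def rank_complex_def)

lemma rank_one_if_minimal:
  assumes "q \<in> proper Q" "below Q q = {}"
  shows "rank q = 1"
proof (rule ccontr)
  assume "rank q \<noteq> 1"
  then have "ohdim k (below Q q) (-1) = 0"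
    by (simp add: ohdim_below_proper[OF assms(1)])
  then show False
    unfolding assms(2) by (simp add: ohdim_empty)
qed

end

locale resolving_labelling = rigid_poset k Q rank
  for k :: "'k::field itself" and Q :: "'a::order set" and rank :: "'a \<Rightarrow> nat" +
  fixes N :: "('v, 'k) mpoly set" and \<eta> :: "'a \<Rightarrow> 'v monom"
  assumes monomial_ideal: "monomial_ideal N"
    and label_mono: "mono_on Q \<eta>"
    and label_pbot: "\<eta> (pbot Q) = 0"
    and label_neq: "\<And>i p q. q \<in> level (Suc i) \<Longrightarrow> p \<in> level i \<Longrightarrow> incidence q p \<noteq> 0 \<Longrightarrow> \<eta> p \<noteq> \<eta> q"
    and label_in_monoms: "\<And>q t. q \<in> proper Q \<Longrightarrow> \<eta> q \<le> t \<Longrightarrow> t \<in> monoms N"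
    and acyclic_labels_le: "\<And>t. t \<in> monoms N \<Longrightarrow> acyclic_over k {q \<in> proper Q. \<eta> q \<le> t}"
begin

lemma down_closed_labels_le: "down_closed (proper Q) {q \<in> proper Q. \<eta> q \<le> t}"
  unfolding down_closed_def using mono_onD[OF label_mono] properD by (blast intro: order_trans)

lemma incidence_nonzero_imp_less:
  assumes "q \<in> level (Suc i)" "p \<in> level i" "incidence q p \<noteq> 0"
  shows "p < q"
proof (cases i)
  case 0
  then show ?thesis
    using assms by (auto simp: level_0 level_Suc proper_def)
next
  case (Suc j)
  then show ?thesis
    using assms incidence_eq_0[of p q] by (auto simp: level_Suc)
qed

lemma ex_minimal_label_le:
  assumes "t \<in> monoms N"
  obtains q where "q \<in> level (Suc 0)" "\<eta> q \<le> t"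
proof -
  let ?U = "{q \<in> proper Q. \<eta> q \<le> t}"
  have "?U \<noteq> {}"
    using acyclic_labels_le[OF assms] ohdim_empty[where k=k and 'a='a]
    by (metis acyclic_over_iff_ohdim finite.emptyI zero_neq_one)
  then obtain q where q: "q \<in> ?U" "\<not> (\<exists>x\<in>?U. x < q)"
    using ex_min_if_finite[of ?U] by auto
  then have "below Q q = {}"
    using below_subset_down_closed[OF down_closed_labels_le q(1)] by (auto simp: below_eq)
  then show thesis
    using that[of q] q(1) rank_one_if_minimal by (simp add: level_Suc)
qed

context
  fixes \<iota> :: "'a \<Rightarrow> 'e" and F :: "('e, 'v, 'k) based_complex"
  assumes realizes: "realizes \<iota> \<eta> F"
begin

lemma inj_on_level: "A \<subseteq> level i \<Longrightarrow> inj_on \<iota> A"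
  by (rule inj_on_subset[of \<iota> Q]) (use realizes in \<open>auto simp: realizes_def level_def\<close>)

lemma gens_eq: "gens F i = \<iota> ` level i"
  using realizes by (simp add: realizes_def)

lemma mdeg_eq: "q \<in> level i \<Longrightarrow> mdeg F i (\<iota> q) = \<eta> q"
  using realizes by (simp add: realizes_def)

lemma coef_eq: "q \<in> level (Suc i) \<Longrightarrow> p \<in> level i \<Longrightarrow> coef F (Suc i) (\<iota> q) (\<iota> p) = incidence q p"
  using realizes by (simp add: realizes_def)

lemma strand_gens_Suc: "strand_gens F (Suc i) t = \<iota> ` ({q \<in> proper Q. \<eta> q \<le> t} \<inter> level (Suc i))"
  unfolding strand_gens_def gens_eq by (auto simp: mdeg_eq dest: level_SucD)

lemma sum_gens: "(\<Sum>e\<in>gens F i. u e) = (\<Sum>q\<in>level i. u (\<iota> q))"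
  unfolding gens_eq by (simp add: sum.reindex[OF inj_on_level[OF subset_refl]])

lemma sum_strand_gens_Suc:
  "(\<Sum>e\<in>strand_gens F (Suc i) t. u e) = (\<Sum>q\<in>{q \<in> proper Q. \<eta> q \<le> t} \<inter> level (Suc i). u (\<iota> q))"
  unfolding strand_gens_Suc by (simp add: sum.reindex[OF inj_on_level[OF Int_lower2]])

lemma multigraded_complex: "multigraded_complex F"
proof
  show "finite (gens F i)" for i
    by (simp add: gens_eq)
  show "mdeg F i e' < mdeg F (Suc i) e"
    if e: "e \<in> gens F (Suc i)" "e' \<in> gens F i" "coef F (Suc i) e e' \<noteq> 0" for i e e'
  proof -
    obtain q p where qp: "e = \<iota> q" "q \<in> level (Suc i)" "e' = \<iota> p" "p \<in> level i"
      using e(1,2) unfolding gens_eq by blast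
    then have "incidence q p \<noteq> 0"
      using e(3) coef_eq by simp
    then have "\<eta> p \<noteq> \<eta> q" "p \<le> q"
      using label_neq incidence_nonzero_imp_less qp by (auto intro: less_imp_le)
    then have "\<eta> p < \<eta> q"
      using mono_onD[OF label_mono, of p q] qp by (simp add: level_def less_le)
    then show ?thesis
      using qp by (simp add: mdeg_eq)
  qed
  show "(\<Sum>e'\<in>gens F (Suc i). coef F (Suc (Suc i)) e e' * coef F (Suc i) e' e'') = 0"
    if e: "e \<in> gens F (Suc (Suc i))" "e'' \<in> gens F i" for i e e''
  proof -
    obtain q p where qp: "e = \<iota> q" "q \<in> level (Suc (Suc i))" "e'' = \<iota> p" "p \<in> level i"
      using e unfolding gens_eq by blast
    show ?thesis
      unfolding sum_gens using incidence_incidence[OF qp(2,4)] qp by (simp add: coef_eq)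
  qed
qed

lemma strand_exact: "strand_exact F i t"
  unfolding strand_exact_def
proof (intro allI impI)
  let ?U = "{q \<in> proper Q. \<eta> q \<le> t}"
  fix x assume x: "\<forall>e'\<in>strand_gens F i t. (\<Sum>e\<in>strand_gens F (Suc i) t. x e * coef F (Suc i) e e') = 0"
  have "(\<Sum>q\<in>?U \<inter> level (Suc i). x (\<iota> q) * incidence q p) = 0"
    if p: "p \<in> insert (pbot Q) ?U" "rank p = i" for p
  proof -
    have pi: "p \<in> level i" "\<eta> p \<le> t"
      using p finite_pointedD(2)[OF pointed] label_pbot
      by (auto simp: level_def le_fun_def dest: properD)
    then have "\<iota> p \<in> strand_gens F i t"
      by (simp add: strand_gens_def gens_eq mdeg_eq)
    then have "(\<Sum>q\<in>?U \<inter> level (Suc i). x (\<iota> q) * coef F (Suc i) (\<iota> q) (\<iota> p)) = 0"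
      using x unfolding sum_strand_gens_Suc by blast
    then show ?thesis
      using pi(1) by (simp add: coef_eq)
  qed
  moreover have "?U = {} \<or> acyclic_over k ?U"
    using acyclic_labels_le label_in_monoms by blast
  ultimately obtain y where y: "\<forall>p\<in>?U \<inter> level (Suc i).
      x (\<iota> p) = (\<Sum>q\<in>?U \<inter> level (Suc (Suc i)). y q * incidence q p)"
    using incidence_exact[OF down_closed_labels_le, of t i "\<lambda>q. x (\<iota> q)"] by blast
  define y' where "y' = y \<circ> inv_into (level (Suc (Suc i))) \<iota>"
  have y': "y' (\<iota> q) = y q" if "q \<in> level (Suc (Suc i))" for q
    using inv_into_f_f[OF inj_on_level[OF subset_refl] that] by (simp add: y'_def)
  have "x e = (\<Sum>e'\<in>strand_gens F (Suc (Suc i)) t. y' e' * coef F (Suc (Suc i)) e' e)"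
    if e: "e \<in> strand_gens F (Suc i) t" for e
  proof -
    obtain p where "e = \<iota> p" "p \<in> ?U \<inter> level (Suc i)"
      using e unfolding strand_gens_Suc by blast
    then show ?thesis
      using y unfolding sum_strand_gens_Suc by (simp add: coef_eq y')
  qed
  then show "\<exists>y. \<forall>e\<in>strand_gens F (Suc i) t.
      x e = (\<Sum>e'\<in>strand_gens F (Suc (Suc i)) t. y e' * coef F (Suc (Suc i)) e' e)"
    by (intro exI[of _ y']) blast
qed

lemma minimal_free_resolution: "minimal_free_resolution F N"
proof -
  interpret multigraded_complex F
    by (rule multigraded_complex)
  have "minimal_free_resolution F {h. Poly_Mapping.keys h \<subseteq> monoms N}"
  proof (rule minimal_free_resolutionI[OF _ _ _ _ strand_exact])
    show "gens F 0 = {\<iota> (pbot Q)}" "mdeg F 0 (\<iota> (pbot Q)) = 0"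
      using mdeg_eq[of "pbot Q" 0] by (simp_all add: gens_eq level_0 label_pbot)
    show "t \<in> monoms N" if "e \<in> gens F (Suc 0)" "mdeg F (Suc 0) e \<le> t" for e t
      using that label_in_monoms[OF level_SucD(1)] by (auto simp: gens_eq mdeg_eq)
    show "\<exists>e\<in>strand_gens F (Suc 0) t. coef F (Suc 0) e (\<iota> (pbot Q)) \<noteq> 0" if t: "t \<in> monoms N" for t
    proof -
      obtain q where q: "q \<in> level (Suc 0)" "\<eta> q \<le> t"
        by (rule ex_minimal_label_le[OF t])
      then have "coef F (Suc 0) (\<iota> q) (\<iota> (pbot Q)) = 1"
        using coef_eq[of q 0 "pbot Q"] by (simp add: level_0 incidence_def)
      then show ?thesis
        using q by (intro bexI[of _ "\<iota> q"]) (auto simp: strand_gens_Suc dest: level_SucD)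
    qed
  qed
  then show ?thesis
    using monomial_idealD(1)[OF monomial_ideal] by simp
qed

end

lemma supported_on: "supported_on N Q"
  unfolding supported_on_def
  using label_mono label_pbot minimal_free_resolution[OF poset_complex_realizes] by blast

end

lemma rigid_deformationI:
  fixes J :: "('w, 'k::field) mpoly set" and I :: "('v, 'k) mpoly set"
  assumes rigid: "rigid TYPE('k) (lcm_lattice J)"
    and J: "resolving_labelling TYPE('k) (betti_poset TYPE('k) (lcm_lattice J)) rank J id"
    and I: "resolving_labelling TYPE('k) (betti_poset TYPE('k) (lcm_lattice J)) rank I g"
  shows "rigid_deformation J I"
proof -
  let ?Q = "betti_poset TYPE('k) (lcm_lattice J)"
  interpret J: resolving_labelling "TYPE('k)" ?Q rank J id
    by (rule J)
  interpret I: resolving_labelling "TYPE('k)" ?Q rank I g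
    by (rule I)
  let ?F = "J.rank_complex (to_nat_on ?Q) id"
  have inj: "inj_on (to_nat_on ?Q) ?Q"
    by (rule inj_on_to_nat_on[OF countable_finite[OF finite_pointedD(1)[OF J.pointed]]])
  have "minimal_free_resolution ?F J"
    by (rule J.minimal_free_resolution[OF J.rank_complex_realizes[OF inj]])
  moreover have "minimal_free_resolution (relabel g ?F) I"
    unfolding J.relabel_rank_complex comp_id
    by (rule I.minimal_free_resolution[OF J.rank_complex_realizes[OF inj]])
  ultimately show ?thesis
    unfolding rigid_deformation_def using rigid I.label_mono by blast
qed

section \<open>Invariance of Betti posets and rigidity\<close>

lemma finite_pointed_iso:
  assumes "finite_pointed A" "poset_iso A B e"
  shows "finite_pointed B" "pbot B = e (pbot A)"
proof -
  note iso = poset_isoD[OF assms(2)] and A = finite_pointedD[OF assms(1)]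
  have min: "e (pbot A) \<in> B" "\<And>y. y \<in> B \<Longrightarrow> e (pbot A) \<le> y"
    using iso(2,3) A(2,3) by auto
  then show "finite_pointed B"
    unfolding finite_pointed_def using iso(2) A(1) by blast
  show "pbot B = e (pbot A)"
    using min by (rule pbot_eqI)
qed

lemma proper_iso: "finite_pointed A \<Longrightarrow> poset_iso A B e \<Longrightarrow> e ` proper A = proper B"
  using poset_isoD[of A B e] finite_pointedD(2)[of A]
  by (auto simp: proper_def finite_pointed_iso(2))

lemma below_iso: "finite_pointed A \<Longrightarrow> poset_iso A B e \<Longrightarrow> p \<in> A \<Longrightarrow> e ` below A p = below B (e p)"
  using poset_isoD[of A B e] finite_pointedD(2)[of A]
  by (auto simp: below_def finite_pointed_iso(2))

lemma hdim_Delta_iso: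
  fixes k :: "'k::field itself"
  assumes "finite_pointed A" "poset_iso A B e" "p \<in> A"
  shows "hdim k (Delta B (e p)) i = hdim k (Delta A p) i"
proof -
  have "poset_iso (below A p) (below B (e p)) e"
    using poset_iso_subset[OF assms(2), of "below A p"] below_iso[OF assms]
    by (auto simp: below_def)
  then show ?thesis
    unfolding Delta_below using ohdim_iso[OF finite_below[OF assms(1)]] by metis
qed

lemma betti_poset_iso:
  fixes k :: "'k::field itself"
  assumes "finite_pointed A" "poset_iso A B e"
  shows "poset_iso (betti_poset k A) (betti_poset k B) e"
proof -
  have "e ` betti_poset k A = betti_poset k B"
    using hdim_Delta_iso[OF assms, where k=k] poset_isoD(2)[OF assms(2)]
    unfolding betti_poset_def by force
  then show ?thesis
    using poset_iso_subset[OF assms(2) betti_poset_subset[of k]] by simp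
qed

lemma betti_poset_isomorphic:
  fixes k :: "'k::field itself"
  assumes "finite_pointed A" "poset_isomorphic A B"
  shows "poset_isomorphic (betti_poset k A) (betti_poset k B)"
  using assms betti_poset_iso unfolding poset_isomorphic_def by blast

lemma betti_iso:
  fixes k :: "'k::field itself"
  assumes "finite_pointed A" "poset_iso A B e"
  shows "betti k B i = betti k A i"
proof -
  note B = finite_pointed_iso(1)[OF assms]
  have inj: "inj_on e (proper A)"
    by (rule inj_on_subset[OF poset_isoD(1)[OF assms(2)]]) (auto dest: properD)
  have "(\<Sum>p\<in>proper B. hdim k (Delta B p) j) = (\<Sum>p\<in>proper A. hdim k (Delta B (e p)) j)" for j
    unfolding proper_iso[OF assms, symmetric] by (simp add: sum.reindex[OF inj])
  then show ?thesis
    by (simp add: betti_def proper_eq[OF B, symmetric] proper_eq[OF assms(1), symmetric]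
        hdim_Delta_iso[OF assms properD])
qed

lemma rigid_iso:
  fixes k :: "'k::field itself"
  assumes "finite_pointed A" "poset_iso A B e" "rigid k A"
  shows "rigid k B"
proof -
  note iso = poset_isoD[OF assms(2)] and hdim = hdim_Delta_iso[OF assms(1,2), where k=k]
  have ball: "(\<forall>x\<in>B. R x) \<longleftrightarrow> (\<forall>p\<in>A. R (e p))" for R
    unfolding iso(2)[symmetric] by simp
  have "B - {pbot B} = e ` (A - {pbot A})"
    using iso(1,2) finite_pointedD(2)[OF assms(1)] finite_pointed_iso(2)[OF assms(1,2)]
    by (auto dest: inj_onD)
  then have ball_nonbot: "(\<forall>x\<in>B - {pbot B}. R x) \<longleftrightarrow> (\<forall>p\<in>A - {pbot A}. R (e p))" for R
    by simp
  have "e p = e q \<longleftrightarrow> p = q" if "p \<in> A" "q \<in> A" for p q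
    using iso(1) that by (auto dest: inj_onD)
  then show ?thesis
    using assms(3) unfolding rigid_def ball ball_nonbot by (simp add: hdim iso(3))
qed

lemma rigid_imp_rigid_poset:
  fixes k :: "'k::field itself"
  assumes P: "finite_pointed P" and rigid: "rigid k P"
  obtains rank where "rigid_poset k (betti_poset k P) rank"
proof
  let ?Q = "betti_poset k P"
  define deg where "deg q = (SOME j. hdim k (Delta P q) j \<noteq> 0)" for q
  define rank where "rank q = (if q = pbot P then 0 else nat (deg q + 2))" for q
  have deg: "hdim k (Delta P q) (deg q) \<noteq> 0" if "q \<in> ?Q" for q
    unfolding deg_def using that by (auto simp: betti_poset_def intro: someI)
  have proper: "q \<in> ?Q" "q \<in> P - {pbot P}" if "q \<in> proper ?Q" for q
    using that by (auto simp: proper_betti_poset[OF P] proper_eq[OF P])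
  have rank: "deg q = int (rank q) - 2" "1 \<le> rank q" if "q \<in> proper ?Q" for q
    using deg[OF proper(1)[OF that]] proper(2)[OF that]
      ohdim_below_minus_one[OF finite_below[OF P], of "deg q" k q]
    unfolding Delta_below rank_def by (cases "deg q < -1"; auto)+
  have hdim: "hdim k (Delta P q) i = (if i = int (rank q) - 2 then 1 else 0)"
    if q: "q \<in> proper ?Q" for q i
    using rigid deg[OF proper(1)[OF q]] proper(2)[OF q] unfolding rigid_def rank(1)[OF q, symmetric]
    by auto
  show "rigid_poset k ?Q rank"
  proof
    show "finite_pointed ?Q"
      by (rule betti_poset_pointed[OF P])
    show "rank (pbot ?Q) = 0"
      by (simp add: pbot_betti_poset[OF P] rank_def)
    show "1 \<le> rank q" if "q \<in> proper ?Q" for q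
      by (rule rank(2)[OF that])
    show "ohdim k (below ?Q q) i = (if i = int (rank q) - 2 then 1 else 0)"
      if "q \<in> proper ?Q" for q i
      using hdim[OF that] hdim_Delta_betti_poset[OF P, of k q i] by (simp add: Delta_below)
    show "rank p \<noteq> rank q" if "p \<in> proper ?Q" "q \<in> proper ?Q" "p < q" for p q
    proof
      assume "rank p = rank q"
      then have "hdim k (Delta P p) (deg p) = 1" "hdim k (Delta P q) (deg p) = 1"
        using hdim that rank(1) by auto
      then show False
        using rigid proper(2)[OF that(1)] proper(2)[OF that(2)] that(3) unfolding rigid_def
        by (metis less_imp_le less_irrefl)
    qed
  qed
qed

section \<open>Retractions between posets\<close>

text \<open>A join-preserving map between finite lattices that is a bijection on atoms is a retraction
  with an upper adjoint: \<open>g y\<close> is the largest element mapped below \<open>y\<close>.\<close>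

locale retraction =
  fixes P :: "'b::order set" and L :: "'a::order set" and f :: "'b \<Rightarrow> 'a" and g :: "'a \<Rightarrow> 'b"
  assumes P: "finite_pointed P" and L: "finite_pointed L"
    and f_mem: "\<And>x. x \<in> P \<Longrightarrow> f x \<in> L" and g_mem: "\<And>y. y \<in> L \<Longrightarrow> g y \<in> P"
    and adjoint: "\<And>x y. x \<in> P \<Longrightarrow> y \<in> L \<Longrightarrow> x \<le> g y \<longleftrightarrow> f x \<le> y"
    and f_g: "\<And>y. y \<in> L \<Longrightarrow> f (g y) = y"
    and f_eq_pbot: "\<And>x. x \<in> P \<Longrightarrow> f x = pbot L \<Longrightarrow> x = pbot P"
begin

lemma le_g_f: "x \<in> P \<Longrightarrow> x \<le> g (f x)"
  using adjoint f_mem by blast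

lemma f_mono: "x \<in> P \<Longrightarrow> x' \<in> P \<Longrightarrow> x \<le> x' \<Longrightarrow> f x \<le> f x'"
  using adjoint[of x "f x'"] f_mem le_g_f by (meson order_trans)

lemma g_le_iff: "y \<in> L \<Longrightarrow> y' \<in> L \<Longrightarrow> g y \<le> g y' \<longleftrightarrow> y \<le> y'"
  using adjoint[of "g y" y'] g_mem f_g by simp

lemma f_pbot: "f (pbot P) = pbot L"
  using adjoint[of "pbot P" "pbot L"] finite_pointedD[OF P] finite_pointedD[OF L] g_mem f_mem
  by (meson order_antisym)

lemma f_proper: "x \<in> P \<Longrightarrow> f x \<in> proper L \<longleftrightarrow> x \<in> proper P"
  using f_pbot f_eq_pbot f_mem by (auto simp: proper_eq[OF P] proper_eq[OF L])

lemma g_proper: "y \<in> proper L \<Longrightarrow> g y \<in> proper P"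
  using f_proper[of "g y"] g_mem[of y] f_g[of y] properD[of y L] by simp

lemma g_iso: "S \<subseteq> L \<Longrightarrow> poset_iso S (g ` S) g"
  unfolding poset_iso_def bij_betw_def
  using g_le_iff f_g by (auto simp: inj_on_def) (metis subsetD)+

lemma upper_fiber_acyclic:
  fixes k :: "'k::field itself"
  assumes "finite M" "S \<subseteq> L" "g ` S \<subseteq> M" "x \<in> P" "f x \<in> S" "x \<notin> g ` S"
  shows "acyclic_over k {z \<in> M \<inter> g ` S. x < z}"
proof (rule acyclic_over_if_comparable_to_all[of _ "g (f x)"])
  show "g (f x) \<in> {z \<in> M \<inter> g ` S. x < z}"
    using assms le_g_f[OF assms(4)] by (auto simp: less_le)
  show "z \<le> g (f x) \<or> g (f x) \<le> z" if z: "z \<in> {z \<in> M \<inter> g ` S. x < z}" for z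
  proof -
    obtain s where s: "z = g s" "s \<in> S" "s \<in> L"
      using z assms(2) by auto
    then have "f x \<le> s"
      using z adjoint[OF assms(4), of s] by auto
    then show ?thesis
      using g_le_iff[of "f x" s] s assms(2,5) by auto
  qed
qed (use assms(1) in auto)

lemma hdim_Delta_eq_preimage:
  fixes k :: "'k::field itself"
  assumes "y \<in> L"
  shows "hdim k (Delta L y) j = ohdim k {x \<in> proper P. f x < y} j"
proof -
  let ?A = "{x \<in> proper P. f x < y}" and ?X = "g ` below L y"
  have A: "finite ?A"
    using finite_proper[OF P] by simp
  have sub: "below L y \<subseteq> L" "?X \<subseteq> ?A"
    using g_proper f_g by (auto simp: below_eq dest: properD)
  have rel: "rel_acyclic k (?A \<inter> ?X) ?A"
  proof (rule rel_acyclic_if_upper_fibers_acyclic[OF A])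
    fix x assume x: "x \<in> ?A - ?X"
    then have "f x \<in> below L y"
      using f_proper[OF properD] by (auto simp: below_eq)
    then show "acyclic_over k {z \<in> ?A \<inter> ?X. x < z}"
      using x by (intro upper_fiber_acyclic A sub) (auto dest: properD)
  qed
  have "?A \<inter> ?X = ?X"
    using sub(2) by auto
  then have "ohdim k ?X j = ohdim k ?A j"
    using ohdim_rel_acyclic[OF A rel, of j] by simp
  moreover have "ohdim k (below L y) j = ohdim k ?X j"
    by (rule ohdim_iso[OF finite_below[OF L] g_iso[OF sub(1)]])
  ultimately show ?thesis
    by (simp add: Delta_below)
qed

end

lemma retraction_id: "finite_pointed A \<Longrightarrow> retraction A A id id"
  by unfold_locales auto

lemma retraction_comp_iso:
  assumes "retraction P L f g" "finite_pointed A" "poset_iso A P e"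
  shows "retraction A L (f \<circ> e) (inv_into A e \<circ> g)"
proof -
  interpret retraction P L f g by fact
  note iso = poset_isoD[OF assms(3)]
  have inv: "inv_into A e y \<in> A" "e (inv_into A e y) = y" if "y \<in> P" for y
    using that iso(2) by (auto intro: inv_into_into f_inv_into_f)
  have eP: "e x \<in> P" if "x \<in> A" for x
    using that iso(2) by blast
  show ?thesis
  proof
    show "x \<le> (inv_into A e \<circ> g) y \<longleftrightarrow> (f \<circ> e) x \<le> y" if "x \<in> A" "y \<in> L" for x y
      using iso(3)[OF that(1) inv(1)[OF g_mem[OF that(2)]]] inv(2)[OF g_mem[OF that(2)]]
        adjoint[OF eP[OF that(1)] that(2)] by simp
    show "x = pbot A" if "x \<in> A" "(f \<circ> e) x = pbot L" for x
      using f_eq_pbot[OF eP[OF that(1)]] that finite_pointed_iso(2)[OF assms(2,3)] iso(1)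
        finite_pointedD(2)[OF assms(2)] by (auto dest: inj_onD)
  qed (use assms(2) L f_mem g_mem eP inv f_g in auto)
qed

section \<open>Retractions preserving Betti numbers\<close>

locale betti_retraction =
  retraction P L f g + rigid_poset k "betti_poset k P" rank
  for P :: "'b::order set" and L :: "'a::order set" and f g
    and k :: "'k::field itself" and rank +
  assumes betti_eq: "\<And>i. betti k P i = betti k L i"
begin

abbreviation Q :: "'b set" where
  "Q \<equiv> betti_poset k P"

lemma proper_Q_subset: "proper Q \<subseteq> proper P"
  using proper_betti_poset[OF P] by blast

lemma proper_Q_memD: "q \<in> proper Q \<Longrightarrow> q \<in> P"
  using proper_Q_subset properD by blast

lemma f_proper_Q: "q \<in> proper Q \<Longrightarrow> f q \<in> proper L"
  using f_proper[of q] proper_Q_subset properD by blast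

lemma f_mono_Q: "x \<in> proper Q \<Longrightarrow> x' \<in> proper Q \<Longrightarrow> x \<le> x' \<Longrightarrow> f x \<le> f x'"
  using f_mono proper_Q_memD by blast

lemma down_closed_preimage:
  "down_closed (proper Q) {x \<in> proper Q. f x < y}" "down_closed (proper Q) {x \<in> proper Q. f x \<le> y}"
  unfolding down_closed_def by (blast intro: f_mono_Q order_le_less_trans order_trans)+

lemma ohdim_preimage_le:
  assumes "y \<in> proper L"
  shows "ohdim k {x \<in> proper Q. f x \<le> y} j = 0"
proof -
  have "{x \<in> proper Q. f x \<le> y} = {x \<in> proper Q. x \<le> g y}"
    using adjoint[OF proper_Q_memD properD[OF assms]] by auto
  moreover have "acyclic_over k {x \<in> proper Q. x \<le> g y}"
    by (rule acyclic_betti_poset_le[OF P g_proper[OF assms]])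
  ultimately show ?thesis
    using acyclic_over_iff_ohdim[of "{x \<in> proper Q. x \<le> g y}", where k=k] by simp
qed

lemma hdim_Delta_eq_betti_preimage:
  assumes "y \<in> L"
  shows "hdim k (Delta L y) j = ohdim k {x \<in> proper Q. f x < y} j"
proof -
  let ?A = "{x \<in> proper P. f x < y}"
  have "down_closed (proper P) ?A"
    unfolding down_closed_def by (blast intro: f_mono properD order_le_less_trans)
  then have "rel_acyclic k (?A \<inter> Q) ?A"
    by (rule rel_acyclic_betti_poset[OF P])
  moreover have "?A \<inter> Q = {x \<in> proper Q. f x < y}"
    using proper_betti_poset[OF P] by auto
  ultimately show ?thesis
    using hdim_Delta_eq_preimage[OF assms, where k=k] ohdim_rel_acyclic[of ?A, where k=k]
      finite_proper[OF P] by simp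
qed

definition fiber :: "'a \<Rightarrow> 'b set" where
  "fiber y = {x \<in> proper Q. f x = y}"

lemma ohdim_preimage_down_closed_le:
  assumes "y \<in> proper L" "down_closed (proper Q) A" "{x \<in> proper Q. f x < y} \<subseteq> A"
  shows "hdim k (Delta L y) j \<le>
    ohdim k A j + (\<Sum>x\<in>A - {x \<in> proper Q. f x < y}. ohdim k (below Q x) j)"
  using ohdim_down_closed_le[OF finite_proper_Q down_closed_preimage(1) assms(2,3), of k j]
    hdim_Delta_eq_betti_preimage[OF properD[OF assms(1)], of j] by (simp add: below_eq)

lemma ohdim_down_closed_preimage_le:
  assumes "y \<in> proper L" "down_closed (proper Q) A" "A \<subseteq> {x \<in> proper Q. f x \<le> y}"
  shows "ohdim k A j \<le> (\<Sum>x\<in>{x \<in> proper Q. f x \<le> y} - A. ohdim k (below Q x) j)"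
  using ohdim_down_closed_le[OF finite_proper_Q assms(2) down_closed_preimage(2) assms(3), of k j]
    ohdim_preimage_le[OF assms(1)] by (simp add: below_eq)

lemma hdim_Delta_le_sum_fiber:
  assumes "y \<in> proper L"
  shows "hdim k (Delta L y) j \<le> (\<Sum>x\<in>fiber y. ohdim k (below Q x) j)"
proof -
  have "hdim k (Delta L y) j = ohdim k {x \<in> proper Q. f x < y} j"
    by (rule hdim_Delta_eq_betti_preimage[OF properD[OF assms]])
  also have "\<dots> \<le> (\<Sum>x\<in>{x \<in> proper Q. f x \<le> y} - {x \<in> proper Q. f x < y}. ohdim k (below Q x) j)"
    by (rule ohdim_down_closed_preimage_le[OF assms down_closed_preimage(1)]) auto
  also have "{x \<in> proper Q. f x \<le> y} - {x \<in> proper Q. f x < y} = fiber y"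
    by (auto simp: fiber_def)
  finally show ?thesis .
qed

text \<open>Summing the preceding estimates over \<open>L\<close> gives an estimate of the total Betti numbers, in
  which equality holds by assumption.\<close>

lemma hdim_Delta_eq_sum_fiber:
  assumes "y \<in> proper L" "1 \<le> i"
  shows "hdim k (Delta L y) (int i - 2) = (\<Sum>x\<in>fiber y. ohdim k (below Q x) (int i - 2))"
proof (rule sum_mono_inv[OF _ hdim_Delta_le_sum_fiber assms(1)])
  let ?h = "\<lambda>x. ohdim k (below Q x) (int i - 2)"
  have "(\<Sum>y\<in>proper L. hdim k (Delta L y) (int i - 2)) = betti k L i"
    using assms(2) by (simp add: betti_def proper_eq[OF L])
  also have "\<dots> = (\<Sum>x\<in>proper P. hdim k (Delta P x) (int i - 2))"
    unfolding betti_eq[symmetric] using assms(2) by (simp add: betti_def proper_eq[OF P])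
  also have "\<dots> = (\<Sum>x\<in>proper Q. hdim k (Delta P x) (int i - 2))"
  proof (rule sum.mono_neutral_right[OF finite_proper[OF P] proper_Q_subset])
    show "\<forall>x\<in>proper P - proper Q. hdim k (Delta P x) (int i - 2) = 0"
      unfolding proper_betti_poset[OF P] by (auto simp: betti_poset_def dest: properD)
  qed
  also have "\<dots> = sum ?h (proper Q)"
    using hdim_Delta_betti_poset[OF P, where k=k] by (simp add: Delta_below)
  also have "\<dots> = (\<Sum>y\<in>proper L. sum ?h (fiber y))"
    unfolding fiber_def by (rule sum.group[symmetric]) (use finite_proper[OF L] f_proper_Q in auto)
  finally show "(\<Sum>y\<in>proper L. hdim k (Delta L y) (int i - 2)) = (\<Sum>y\<in>proper L. sum ?h (fiber y))" .
qed (use finite_proper[OF L] in auto)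

lemma f_betti_poset:
  assumes "q \<in> Q"
  shows "f q \<in> betti_poset k L"
proof (cases "q = pbot P")
  case True
  then show ?thesis
    using pbot_in_betti_poset[OF L] by (simp add: f_pbot)
next
  case False
  then have q: "q \<in> proper Q"
    using assms betti_poset_subset[of k P] by (auto simp: proper_betti_poset[OF P] proper_eq[OF P])
  have "ohdim k (below Q q) (int (rank q) - 2) \<le>
      (\<Sum>x\<in>fiber (f q). ohdim k (below Q x) (int (rank q) - 2))"
    by (rule member_le_sum) (use q in \<open>auto simp: fiber_def\<close>)
  moreover have "ohdim k (below Q q) (int (rank q) - 2) = 1"
    by (simp add: ohdim_below_proper[OF q])
  ultimately have "hdim k (Delta L (f q)) (int (rank q) - 2) \<noteq> 0"
    using hdim_Delta_eq_sum_fiber[OF f_proper_Q[OF q] rank_pos[OF q]] by linarith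
  then show ?thesis
    using properD[OF f_proper_Q[OF q]] by (auto simp: betti_poset_def)
qed

lemma f_proper_betti_poset: "q \<in> proper Q \<Longrightarrow> f q \<in> proper (betti_poset k L)"
  using f_proper_Q f_betti_poset properD unfolding proper_betti_poset[OF L] by blast

definition stage :: "'a \<Rightarrow> nat \<Rightarrow> 'b set" where
  "stage y n = {x \<in> proper Q. f x < y \<or> (f x = y \<and> rank x \<le> n)}"

lemma down_closed_stage: "down_closed (proper Q) (stage y n)"
  unfolding down_closed_def
proof (intro conjI ballI impI)
  fix x x' assume x: "x \<in> stage y n" "x' \<in> proper Q" "x' \<le> x"
  then have "f x' \<le> f x" "rank x' \<le> rank x"
    using f_mono_Q[of x' x] rank_mono[of x' x] by (auto simp: stage_def dest: properD)
  then show "x' \<in> stage y n"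
    using x by (auto simp: stage_def)
qed (auto simp: stage_def)

lemma stage_maximal:
  assumes "p \<in> proper Q" "x \<in> stage (f p) (rank p)"
  shows "\<not> p < x"
proof
  assume "p < x"
  then have "f p \<le> f x" "rank p < rank x"
    using f_mono_Q rank_strict_mono_proper assms by (auto simp: stage_def)
  then show False
    using assms(2) by (auto simp: stage_def)
qed

text \<open>Otherwise \<open>p\<close> would not contribute to the homology below \<open>f p\<close>.\<close>

lemma incidence_eq_0_if_same_image:
  assumes p: "p \<in> proper Q" and q: "q \<in> proper Q" and rank: "rank q = Suc (rank p)"
    and f: "f p = f q"
  shows "incidence q p = 0"
proof (rule ccontr)
  assume inc: "incidence q p \<noteq> 0"
  define j where "j = int (rank p) - 2"
  let ?h = "\<lambda>x. ohdim k (below Q x) j"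
  let ?less = "{x \<in> proper Q. f x < f p}" and ?le = "{x \<in> proper Q. f x \<le> f p}"
  let ?K = "stage (f p) (rank p)"
  have pK: "p \<in> ?K"
    using p by (simp add: stage_def)
  note down = down_closed_stage[of "f p" "rank p"] and max = stage_maximal[OF p]
  have "x \<in> ?K" if "x \<in> below Q q" for x
    using below_memD[OF properD[OF q] that] f_mono_Q[OF _ q, of x] rank f
    by (auto simp: stage_def order_le_less)
  then have "ohdim k (?K - {p}) j \<le> ohdim k ?K j"
    unfolding j_def using inc rank q by (intro ohdim_remove_le_if_incidence[OF down pK max]) auto
  also have "\<dots> \<le> sum ?h (?le - ?K)"
    by (rule ohdim_down_closed_preimage_le[OF f_proper_Q[OF p] down]) (auto simp: stage_def)
  finally have "hdim k (Delta L (f p)) j \<le> sum ?h (?le - ?K) + sum ?h (?K - {p} - ?less)"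
    using ohdim_preimage_down_closed_le[OF f_proper_Q[OF p]
        down_closed_remove_maximal[OF down max], of j]
    by (force simp: stage_def)
  also have "\<dots> = sum ?h ((?le - ?K) \<union> (?K - {p} - ?less))"
    by (rule sum.union_disjoint[symmetric]) (auto simp: stage_def)
  also have "(?le - ?K) \<union> (?K - {p} - ?less) = fiber (f p) - {p}"
    using pK by (auto simp: stage_def fiber_def)
  also have "sum ?h (fiber (f p) - {p}) < sum ?h (fiber (f p))"
    using p ohdim_below_proper[OF p, of j]
    by (subst (2) sum.remove[of _ p]) (auto simp: fiber_def j_def)
  also have "\<dots> = hdim k (Delta L (f p)) j"
    unfolding j_def by (rule hdim_Delta_eq_sum_fiber[OF f_proper_Q[OF p] rank_pos[OF p], symmetric])
  finally show False by simp
qed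

lemma rel_acyclic_preimage:
  assumes V: "down_closed (proper (betti_poset k L)) V"
  shows "rel_acyclic k {x \<in> proper Q. f x \<in> V} ({x \<in> proper Q. f x \<in> V} \<union> g ` V)"
    (is "rel_acyclic _ ?U ?M")
proof -
  have VL: "V \<subseteq> proper L"
    using V unfolding down_closed_def proper_betti_poset[OF L] by blast
  have "rel_acyclic k (?M \<inter> ?U) ?M"
  proof (rule rel_acyclic_if_lower_fibers_acyclic)
    show "finite ?M"
      using VL finite_proper[OF L] finite_subset by auto
    fix z assume z: "z \<in> ?M - ?U"
    then obtain v where v: "z = g v" "v \<in> V" by blast
    have vL: "v \<in> L" "g v \<in> proper P" "f (g v) = v"
      using v(2) VL g_proper f_g properD by blast+
    have "{x \<in> ?M \<inter> ?U. x < z} = below Q (g v)"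
    proof (intro equalityI subsetI)
      fix x assume "x \<in> below Q (g v)"
      then have x: "x \<in> proper Q" "x < g v"
        by (auto simp: below_eq)
      then have "f x \<le> v"
        using adjoint[OF proper_Q_memD[OF x(1)] vL(1)] less_imp_le[OF x(2)] by blast
      then have "f x \<in> V"
        using V v(2) f_proper_betti_poset[OF x(1)] unfolding down_closed_def by blast
      then show "x \<in> {x \<in> ?M \<inter> ?U. x < z}"
        using x v(1) by simp
    qed (auto simp: below_eq v(1))
    moreover have "g v \<notin> Q"
      using z v vL proper_betti_poset[OF P] by auto
    ultimately show "acyclic_over k {x \<in> ?M \<inter> ?U. x < z}"
      using acyclic_below_betti_poset[OF P vL(2)] by simp
  qed
  moreover have "?M \<inter> ?U = ?U"
    by auto
  ultimately show ?thesis by simp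
qed

lemma acyclic_preimage_betti_poset:
  assumes V: "down_closed (proper (betti_poset k L)) V" "acyclic_over k V"
  shows "acyclic_over k {x \<in> proper Q. f x \<in> V}" (is "acyclic_over _ ?U")
proof -
  let ?M = "?U \<union> g ` V"
  have VL: "V \<subseteq> L"
    using V(1) properD unfolding down_closed_def proper_betti_poset[OF L] by blast
  have finV: "finite V"
    using VL finite_pointedD(1)[OF L] finite_subset by blast
  have M: "finite ?M"
    using finV by simp
  have rel: "rel_acyclic k (?M \<inter> g ` V) ?M"
  proof (rule rel_acyclic_if_upper_fibers_acyclic[OF M])
    fix x assume "x \<in> ?M - g ` V"
    then show "acyclic_over k {z \<in> ?M \<inter> g ` V. x < z}"
      by (intro upper_fiber_acyclic M VL) (auto dest: proper_Q_memD)
  qed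
  have "?M \<inter> g ` V = g ` V"
    by auto
  moreover have "acyclic_over k (g ` V)"
    by (rule acyclic_over_iso[OF finite_imageI[OF finV] poset_iso_inv[OF g_iso[OF VL]] V(2)])
  ultimately have "acyclic_over k ?M"
    using acyclic_over_iff_rel_acyclic[OF M rel] by simp
  then show ?thesis
    using acyclic_over_iff_rel_acyclic[OF M rel_acyclic_preimage[OF V(1)]] by blast
qed

end

section \<open>Resolutions of monomial ideals with isomorphic Betti posets\<close>

context betti_retraction
begin

context
  fixes I :: "('v::finite, 'k) mpoly set" and \<theta> :: "'a \<Rightarrow> 'v monom"
  assumes I: "monomial_ideal I" "finite (lcm_lattice I)"
    and \<theta>: "poset_iso (betti_poset k L) (betti_poset k (lcm_lattice I)) \<theta>"
begin

lemma label_pbot: "\<theta> (f (pbot Q)) = 0"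
proof -
  have "\<theta> (pbot (betti_poset k L)) = pbot (betti_poset k (lcm_lattice I))"
    by (rule finite_pointed_iso(2)[OF betti_poset_pointed[OF L] \<theta>, symmetric])
  then show ?thesis
    using lcm_lattice_pointed[OF I] by (simp add: pbot_betti_poset P L f_pbot)
qed

lemma label_proper:
  assumes "q \<in> proper Q"
  shows "\<theta> (f q) \<in> proper (lcm_lattice I)"
proof -
  have "\<theta> (f q) \<in> proper (betti_poset k (lcm_lattice I))"
    using f_proper_betti_poset[OF assms] proper_iso[OF betti_poset_pointed[OF L] \<theta>] by blast
  then show ?thesis
    by (simp add: proper_betti_poset[OF lcm_lattice_pointed(1)[OF I]])
qed

lemma label_le_iff: "p \<in> Q \<Longrightarrow> q \<in> Q \<Longrightarrow> \<theta> (f p) \<le> \<theta> (f q) \<longleftrightarrow> f p \<le> f q"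
  using poset_isoD(3)[OF \<theta>] f_betti_poset by blast

lemma acyclic_labels_below:
  assumes "x \<in> proper (lcm_lattice I)"
  shows "acyclic_over k {q \<in> proper Q. \<theta> (f q) \<le> x}"
proof -
  let ?B = "betti_poset k L" and ?BI = "betti_poset k (lcm_lattice I)"
  define V where "V = {v \<in> proper ?B. \<theta> v \<le> x}"
  have VB: "V \<subseteq> ?B"
    by (auto simp: V_def dest: properD)
  have "\<theta> ` V = {u \<in> proper ?BI. u \<le> x}"
    using proper_iso[OF betti_poset_pointed[OF L] \<theta>] by (auto simp: V_def)
  then have "acyclic_over k (\<theta> ` V)"
    using acyclic_betti_poset_le[OF lcm_lattice_pointed(1)[OF I] assms, of k] by simp
  moreover have "finite V"
    using VB finite_pointedD(1)[OF betti_poset_pointed[OF L]] finite_subset by blast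
  ultimately have "acyclic_over k V"
    using acyclic_over_iso[OF _ poset_iso_subset[OF \<theta> VB]] by blast
  moreover have "down_closed (proper ?B) V"
    unfolding down_closed_def V_def using poset_isoD(3)[OF \<theta>]
    by (auto dest: properD intro: order_trans)
  ultimately have "acyclic_over k {q \<in> proper Q. f q \<in> V}"
    by (intro acyclic_preimage_betti_poset)
  moreover have "{q \<in> proper Q. f q \<in> V} = {q \<in> proper Q. \<theta> (f q) \<le> x}"
    using f_proper_betti_poset by (auto simp: V_def)
  ultimately show ?thesis by simp
qed

lemma label_neq:
  assumes "q \<in> level (Suc i)" "p \<in> level i" "incidence q p \<noteq> 0"
  shows "\<theta> (f p) \<noteq> \<theta> (f q)"
proof (cases i)
  case 0
  then show ?thesis
    using assms(1,2) label_pbot label_proper[of q] level_SucD(1)[of q 0]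
    by (auto simp: level_0 proper_lcm_lattice[OF I])
next
  case (Suc j)
  then have pq: "p \<in> proper Q" "q \<in> proper Q" "rank q = Suc (rank p)"
    using assms(1,2) level_SucD by auto
  then have "f p \<noteq> f q"
    using incidence_eq_0_if_same_image assms(3) by blast
  then show ?thesis
    using poset_isoD(1)[OF \<theta>] f_betti_poset[OF properD] pq(1,2) by (auto dest: inj_onD)
qed

lemma resolving_labelling_comp:
  assumes "proper P \<noteq> {}"
  shows "resolving_labelling k Q rank I (\<theta> \<circ> f)"
proof
  have nonempty: "proper (lcm_lattice I) \<noteq> {}"
    using betti_poset_proper_nonempty[OF P assms, of k] label_proper by blast
  show "monomial_ideal I"
    by (rule I(1))
  show "mono_on Q (\<theta> \<circ> f)"
    using betti_poset_subset[of k P] by (intro mono_onI) (auto simp: label_le_iff intro!: f_mono)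
  show "(\<theta> \<circ> f) (pbot Q) = 0"
    by (simp add: label_pbot)
  show "(\<theta> \<circ> f) p \<noteq> (\<theta> \<circ> f) q"
    if "q \<in> level (Suc i)" "p \<in> level i" "incidence q p \<noteq> 0" for i p q
    using label_neq[OF that] by simp
  show "t \<in> monoms I" if "q \<in> proper Q" "(\<theta> \<circ> f) q \<le> t" for q t
    using above_lcm_in_monoms[OF I label_proper[OF that(1)]] that(2) by simp
  show "acyclic_over k {q \<in> proper Q. (\<theta> \<circ> f) q \<le> t}" if t: "t \<in> monoms I" for t
  proof -
    obtain x where x: "x \<in> proper (lcm_lattice I)" "\<And>u. u \<in> lcm_lattice I \<Longrightarrow> u \<le> t \<longleftrightarrow> u \<le> x"
      using lcm_below_monomial[OF I t nonempty] by blast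
    then have "{q \<in> proper Q. (\<theta> \<circ> f) q \<le> t} = {q \<in> proper Q. \<theta> (f q) \<le> x}"
      using label_proper properD by fastforce
    then show ?thesis
      using acyclic_labels_below[OF x(1)] by simp
  qed
qed

end

end

lemma supported_on_if_retraction:
  fixes k :: "'k::field itself" and I :: "('v::finite, 'k) mpoly set"
  assumes retraction: "retraction P L f g" and rigid: "rigid k P" and nonempty: "proper P \<noteq> {}"
    and betti: "\<And>i. betti k P i = betti k L i"
    and I: "monomial_ideal I" "finite (lcm_lattice I)"
    and iso: "poset_isomorphic (betti_poset k L) (betti_poset k (lcm_lattice I))"
  shows "supported_on I (betti_poset k P)"
proof -
  obtain \<theta> where \<theta>: "poset_iso (betti_poset k L) (betti_poset k (lcm_lattice I)) \<theta>"
    using iso by (auto simp: poset_isomorphic_def)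
  obtain rank where "rigid_poset k (betti_poset k P) rank"
    using rigid_imp_rigid_poset[OF retraction.P[OF retraction] rigid] .
  then interpret betti_retraction P L f g k rank
    by (intro betti_retraction.intro betti_retraction_axioms.intro retraction betti)
  show ?thesis
    by (rule resolving_labelling.supported_on[OF resolving_labelling_comp[OF I \<theta> nonempty]])
qed

lemma rigid_deformation_if_lcm_lattice_retraction:
  fixes I :: "('v::finite, 'k::field) mpoly set" and J :: "('w::finite, 'k) mpoly set"
  assumes retraction: "retraction (lcm_lattice J) L f g" and rigid: "rigid TYPE('k) (lcm_lattice J)"
    and nonempty: "proper (lcm_lattice J) \<noteq> {}"
    and betti: "\<And>i. betti TYPE('k) (lcm_lattice J) i = betti TYPE('k) L i"
    and J: "monomial_ideal J" and I: "monomial_ideal I" "finite (lcm_lattice I)"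
    and iso: "poset_isomorphic (betti_poset TYPE('k) L) (betti_poset TYPE('k) (lcm_lattice I))"
  shows "rigid_deformation J I"
proof -
  obtain \<theta> where \<theta>: "poset_iso (betti_poset TYPE('k) L) (betti_poset TYPE('k) (lcm_lattice I)) \<theta>"
    using iso by (auto simp: poset_isomorphic_def)
  let ?P = "lcm_lattice J"
  have P: "finite_pointed ?P"
    by (rule retraction.P[OF retraction])
  obtain rank where rank: "rigid_poset TYPE('k) (betti_poset TYPE('k) ?P) rank"
    using rigid_imp_rigid_poset[OF P rigid] .
  have "betti_retraction ?P L f g TYPE('k) rank"
    by (intro betti_retraction.intro betti_retraction_axioms.intro retraction rank betti)
  note labelling_I = betti_retraction.resolving_labelling_comp[OF this I \<theta> nonempty]
  have "betti_retraction ?P ?P id id TYPE('k) rank"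
    by (intro betti_retraction.intro betti_retraction_axioms.intro retraction_id P rank refl)
  moreover have "poset_iso (betti_poset TYPE('k) ?P) (betti_poset TYPE('k) ?P) id"
    by (simp add: poset_iso_def)
  ultimately have "resolving_labelling TYPE('k) (betti_poset TYPE('k) ?P) rank J (id \<circ> id)"
    using betti_retraction.resolving_labelling_comp[OF _ J finite_pointedD(1)[OF P] _ nonempty]
    by blast
  then show ?thesis
    using rigid_deformationI[OF rigid _ labelling_I] by simp
qed

lemma rigid_deformation_if_retraction:
  fixes I :: "('v::finite, 'k::field) mpoly set" and J :: "('w::finite, 'k) mpoly set"
  assumes retraction: "retraction P L f g" and rigid: "rigid TYPE('k) P"
    and nonempty: "proper P \<noteq> {}"
    and betti: "\<And>i. betti TYPE('k) P i = betti TYPE('k) L i"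
    and I: "monomial_ideal I" "finite (lcm_lattice I)"
    and iso: "poset_isomorphic (betti_poset TYPE('k) L) (betti_poset TYPE('k) (lcm_lattice I))"
    and J: "monomial_ideal J" "poset_isomorphic (lcm_lattice J) P"
  shows "rigid_deformation J I"
proof -
  note P = retraction.P[OF retraction]
  obtain e where e: "poset_iso (lcm_lattice J) P e"
    using J(2) by (auto simp: poset_isomorphic_def)
  note inv = poset_iso_inv[OF e]
  have "proper (lcm_lattice J) \<noteq> {}"
    using proper_iso[OF P inv] nonempty by blast
  moreover have "betti TYPE('k) (lcm_lattice J) i = betti TYPE('k) L i" for i
    using betti_iso[OF P inv, of "TYPE('k)" i] betti by simp
  ultimately show ?thesis
    by (rule rigid_deformation_if_lcm_lattice_retraction[OF
          retraction_comp_iso[OF retraction finite_pointed_iso(1)[OF P inv] e]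
          rigid_iso[OF P inv rigid] _ _ J(1) I iso])
qed

section \<open>Retractions between atomic lattices\<close>

lemma isLub_iff: "isLub L X j \<longleftrightarrow> j \<in> L \<and> (\<forall>x\<in>X. x \<le> j) \<and> (\<forall>u\<in>L. (\<forall>x\<in>X. x \<le> u) \<longrightarrow> j \<le> u)"
  by (auto simp: isLub_def leastP_def isUb_def setle_def setge_def)

lemma finite_lattice_pointed:
  assumes "finite_lattice L"
  shows "finite_pointed L"
proof -
  have L: "finite L" "L \<noteq> {}"
    and meet: "\<And>x y. x \<in> L \<Longrightarrow> y \<in> L \<Longrightarrow> \<exists>m. isGlb L {x, y} m"
    using assms by (auto simp: finite_lattice_def)
  obtain m where m: "m \<in> L" "\<not> (\<exists>x\<in>L. x < m)"
    using ex_min_if_finite[OF L] by blast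
  have "m \<le> y" if y: "y \<in> L" for y
  proof -
    obtain z where "isGlb L {m, y} z"
      using meet[OF m(1) y] by blast
    then have "z \<in> L" "z \<le> m" "z \<le> y"
      by (auto simp: isGlb_def greatestP_def isLb_def setge_def setle_def)
    then show ?thesis
      using m(2) by (auto simp: order_le_less)
  qed
  then show ?thesis
    unfolding finite_pointed_def using L m(1) by blast
qed

lemma finite_atomic_latticeD:
  assumes "finite_atomic_lattice L"
  shows "finite_lattice L" "finite_pointed L" "\<And>x. x \<in> L \<Longrightarrow> \<exists>A\<subseteq>atoms L. isLub L A x"
  using assms finite_lattice_pointed by (auto simp: finite_atomic_lattice_def)

lemma atom_in_proper: "a \<in> atoms L \<Longrightarrow> a \<in> proper L"
  by (auto simp: atoms_def covers_def proper_def)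

lemma atom_mem: "a \<in> atoms L \<Longrightarrow> a \<in> L"
  by (rule properD[OF atom_in_proper])

lemma join_preservingD:
  assumes "join_preserving P L f"
  shows "x \<in> P \<Longrightarrow> f x \<in> L" "X \<subseteq> P \<Longrightarrow> isLub P X j \<Longrightarrow> isLub L (f ` X) (f j)"
  using assms by (auto simp: join_preserving_def)

lemma join_preserving_mono:
  assumes "join_preserving P L f" "x \<in> P" "y \<in> P" "x \<le> y"
  shows "f x \<le> f y"
  using join_preservingD(2)[OF assms(1), of "{x, y}" y] assms(2-4) by (auto simp: isLub_iff)

lemma join_preserving_pbot_le:
  assumes "join_preserving P L f" "finite_pointed P" "y \<in> L"
  shows "f (pbot P) \<le> y"
proof -
  have "isLub P {} (pbot P)"
    using finite_pointedD[OF assms(2)] by (auto simp: isLub_iff)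
  then show ?thesis
    using join_preservingD(2)[OF assms(1), of "{}" "pbot P"] assms(3) by (auto simp: isLub_iff)
qed

lemma join_preserving_upper_adjoint:
  assumes P: "finite_lattice P" and f: "join_preserving P L f" and y: "y \<in> L"
  shows "\<exists>j\<in>P. \<forall>x\<in>P. x \<le> j \<longleftrightarrow> f x \<le> y"
proof -
  let ?S = "{x \<in> P. f x \<le> y}"
  note pointed = finite_lattice_pointed[OF P]
  have "finite ?S" "?S \<noteq> {}"
    using finite_pointedD[OF pointed] join_preserving_pbot_le[OF f pointed y] by auto
  then obtain j where j: "j \<in> P" "f j \<le> y" "\<not> (\<exists>x\<in>?S. j < x)"
    using ex_max_if_finite[of ?S] by auto
  have "x \<le> j" if x: "x \<in> P" "f x \<le> y" for x
  proof -
    obtain s where s: "isLub P {x, j} s"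
      using P x(1) j(1) unfolding finite_lattice_def by blast
    then have "isLub L {f x, f j} (f s)"
      using join_preservingD(2)[OF f, of "{x, j}" s] x(1) j(1) by auto
    then have "f s \<le> y"
      using x(2) j(2) y by (auto simp: isLub_iff)
    then have "s \<in> ?S" "j \<le> s" "x \<le> s"
      using s by (auto simp: isLub_iff)
    then show ?thesis
      using j(3) by (auto simp: order_le_less)
  qed
  moreover have "f x \<le> y" if "x \<in> P" "x \<le> j" for x
    using join_preserving_mono[OF f that(1) j(1) that(2)] j(2) by (rule order_trans)
  ultimately show ?thesis
    using j(1) by blast
qed

lemma join_preserving_image_of_upper_adjoint:
  assumes L: "finite_atomic_lattice L" and f: "join_preserving P L f"
    and atoms: "f ` atoms P = atoms L"
    and y: "y \<in> L" and j: "j \<in> P" "\<And>x. x \<in> P \<Longrightarrow> x \<le> j \<longleftrightarrow> f x \<le> y"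
  shows "f j = y"
proof (rule order_antisym)
  show "f j \<le> y"
    using j(2)[OF j(1)] by simp
  obtain A where A: "A \<subseteq> f ` atoms P" "isLub L A y"
    using finite_atomic_latticeD(3)[OF L y] unfolding atoms by blast
  have "a \<le> f j" if a: "a \<in> A" for a
  proof -
    obtain b where b: "b \<in> P" "a = f b"
      using A(1) a atom_mem by blast
    then have "b \<le> j"
      using j(2)[OF b(1)] A(2) a by (auto simp: isLub_iff)
    then show ?thesis
      unfolding b(2) by (rule join_preserving_mono[OF f b(1) j(1)])
  qed
  then show "y \<le> f j"
    using A(2) join_preservingD(1)[OF f j(1)] by (auto simp: isLub_iff)
qed

lemma join_preserving_retraction:
  assumes P: "finite_atomic_lattice P" and L: "finite_atomic_lattice L"
    and f: "join_preserving P L f" and atoms: "f ` atoms P = atoms L"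
  shows "\<exists>g. retraction P L f g"
proof -
  note PD = finite_atomic_latticeD[OF P] and LD = finite_atomic_latticeD[OF L]
  obtain g where g: "\<And>y. y \<in> L \<Longrightarrow> g y \<in> P" "\<And>x y. y \<in> L \<Longrightarrow> x \<in> P \<Longrightarrow> x \<le> g y \<longleftrightarrow> f x \<le> y"
    using join_preserving_upper_adjoint[OF PD(1) f] by metis
  have "retraction P L f g"
  proof
    show "f (g y) = y" if "y \<in> L" for y
      by (rule join_preserving_image_of_upper_adjoint[OF L f atoms that g(1)[OF that] g(2)[OF that]])
    show "x = pbot P" if x: "x \<in> P" "f x = pbot L" for x
    proof -
      obtain A where A: "A \<subseteq> atoms P" "isLub P A x"
        using PD(3)[OF x(1)] by blast
      have "b \<notin> A" for b
      proof
        assume b: "b \<in> A"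
        have "pbot L < f b"
          using atom_in_proper[of "f b" L] A(1) b atoms by (auto simp: proper_def)
        moreover have "f b \<le> f x"
          using join_preserving_mono[OF f _ x(1), of b] atom_mem[of b P] A b
          by (auto simp: isLub_iff)
        ultimately show False
          using x(2) by simp
      qed
      then show ?thesis
        using A(2) finite_pointedD[OF PD(2)] by (intro order_antisym) (auto simp: isLub_iff)
    qed
  qed (use PD(2) LD(2) join_preservingD(1)[OF f] g in auto)
  then show ?thesis by blast
qed

lemma lat_ge_retraction:
  assumes "atom_ordered_lattice n L aL" "atom_ordered_lattice n P aP" "lat_ge n P aP L aL"
  shows "\<exists>f g. retraction P L f g"
proof -
  obtain f where f: "join_preserving P L f" "\<And>i. i < n \<Longrightarrow> f (aP i) = aL i"
    using assms(3) by (auto simp: lat_ge_def)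
  have atoms: "aP ` {..<n} = atoms P" "aL ` {..<n} = atoms L"
    using assms(1,2) by (auto simp: atom_ordered_lattice_def bij_betw_def)
  have "f ` atoms P = atoms L"
    unfolding atoms[symmetric] image_image using f(2) by (intro image_cong) auto
  then show ?thesis
    using join_preserving_retraction[OF _ _ f(1)] assms(1,2)
    by (auto simp: atom_ordered_lattice_def)
qed

lemma finite_atomic_lattice_without_atoms:
  assumes "finite_atomic_lattice L" "atoms L = {}"
  shows "L = {pbot L}"
proof -
  note L = finite_atomic_latticeD[OF assms(1)]
  have "x = pbot L" if "x \<in> L" for x
    using L(3)[OF that] assms(2) finite_pointedD[OF L(2)] that
    by (intro order_antisym) (auto simp: isLub_iff)
  then show ?thesis
    using finite_pointedD(2)[OF L(2)] by blast
qed

lemma lat_gt_proper_nonempty: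
  assumes L: "atom_ordered_lattice n L aL" and P: "atom_ordered_lattice n P aP"
    and gt: "lat_gt n P aP L aL"
  shows "proper P \<noteq> {}"
proof
  assume "proper P = {}"
  then have "atoms P = {}"
    using atom_in_proper by blast
  then have n: "n = 0" and "atoms L = {}"
    using L P by (auto simp: atom_ordered_lattice_def bij_betw_def)
  then have "P = {pbot P}" "L = {pbot L}"
    using L P \<open>atoms P = {}\<close> finite_atomic_lattice_without_atoms
    by (auto simp: atom_ordered_lattice_def)
  moreover have "poset_iso {pbot P} {pbot L} (\<lambda>_. pbot L)"
    by (simp add: poset_iso_def bij_betw_def)
  ultimately have "poset_iso P L (\<lambda>_. pbot L)"
    by metis
  then have "lat_eq n P aP L aL"
    unfolding lat_eq_def n by blast
  then show False
    using gt by (simp add: lat_gt_def)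
qed

theorem corollary2p10:
  fixes L :: "'a::order set" and P :: "'b::order set" and L' :: "'c::order set"
    and aL :: "nat \<Rightarrow> 'a" and aP :: "nat \<Rightarrow> 'b" and n :: nat
  assumes "atom_ordered_lattice n L aL"
    and "atom_ordered_lattice n P aP"
    and "lat_gt n P aP L aL"
    and "rigid TYPE('k::field) P"
    and "\<forall>i. betti TYPE('k) P i = betti TYPE('k) L i"
    and "finite_atomic_lattice L'"
    and "poset_isomorphic (betti_poset TYPE('k) L) (betti_poset TYPE('k) L')"
  shows "\<forall>I :: ('v::finite, 'k) mpoly set.
    monomial_ideal I \<and> poset_isomorphic (lcm_lattice I) L' \<longrightarrow>
      supported_on I (betti_poset TYPE('k) P) \<and>
      (\<forall>J :: ('w::finite, 'k) mpoly set.
        monomial_ideal J \<and> poset_isomorphic (lcm_lattice J) P \<longrightarrow> rigid_deformation J I)"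
proof (intro allI impI conjI; elim conjE)
  fix I :: "('v, 'k) mpoly set"
  assume I: "monomial_ideal I" and I_L': "poset_isomorphic (lcm_lattice I) L'"
  note L' = finite_atomic_latticeD(2)[OF assms(6)]
  have finite: "finite (lcm_lattice I)"
    using finite_poset_isomorphic[OF I_L'] finite_pointedD(1)[OF L'] by simp
  have iso: "poset_isomorphic (betti_poset TYPE('k) L) (betti_poset TYPE('k) (lcm_lattice I))"
    by (rule poset_isomorphic_trans[OF assms(7)
          betti_poset_isomorphic[OF L' poset_isomorphic_sym[OF I_L']]])
  obtain f g where "retraction P L f g"
    using lat_ge_retraction[OF assms(1,2)] assms(3) by (auto simp: lat_gt_def)
  note P_over_L = this assms(4) lat_gt_proper_nonempty[OF assms(1-3)] spec[OF assms(5)]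
  show "supported_on I (betti_poset TYPE('k) P)"
    by (rule supported_on_if_retraction[OF P_over_L I finite iso])
  fix J :: "('w, 'k) mpoly set"
  assume "monomial_ideal J" "poset_isomorphic (lcm_lattice J) P"
  then show "rigid_deformation J I"
    by (rule rigid_deformation_if_retraction[OF P_over_L I finite iso])
qed

end
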